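(* Let $I=(v_1,\dots,v_N)\subset\mathbb C[\lambda_1,\dots,\lambda_n]$ be an ideal, $B_I\mathbb C^n$ the blowup of $\mathbb C^n$ with center $I$, and $E$ its exceptional locus. For $P\in E$ let $k_P=\min_{\alpha(0)=P}k(\alpha)$ be the minimal order of an arc on $B_I\mathbb C^n$ centered at $P$ (and not contained in $E$), and let $k_{max}=\sup_{P\in E}k_P$. Then $$k_{max}<\infty .$$
   Context: Let $Z=Z(I)=\{\lambda\in\mathbb C^n: v_1(\lambda)=\dots=v_N(\lambda)=0\}$. The blowup $B_I\mathbb C^n\subset\mathbb C^n\times\mathbb P^{N-1}$ is the Zariski closure of the graph of the map $\mathbb C^n\setminus Z\to\mathbb P^{N-1}$, $\lambda\mapsto[v_1(\lambda):\dots:v_N(\lambda)]$; $\pi:B_I\mathbb C^n\to\mathbb C^n$ is the projection and $E=\pi^{-1}(Z)$ is the exceptional locus. An arc centered at $E$ is a parameterized formal curve $\varepsilon\mapsto\alpha(\varepsilon)\in B_I\mathbb C^n$ with $\alpha(0)\in E$; the point $\alpha(0)$ is its center. For an arc $\alpha$ not contained in $E$, put $\lambda(\varepsilon)=\pi(\alpha(\varepsilon))$. The order $k(\alpha)$ of $\alpha$ is the natural number $k\ge1$ such that $$(v_1(\lambda(\varepsilon)),\dots,v_N(\lambda(\varepsilon)))=\varepsilon^k\,(p+O(\varepsilon)),\qquad p\in\mathbb C^N\setminus\{0\}.$$ *)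

theory Defs
  imports
    "HOL-Analysis.Finite_Cartesian_Product"
    "HOL-Analysis.Cartesian_Space"
    "HOL-Library.Poly_Mapping"
    "HOL-Library.Extended_Nat"
    "HOL-Computational_Algebra.Formal_Power_Series"
begin

text \<open>
  A polynomial over the complex numbers in variables indexed by \<^typ>\<open>'i\<close> is an element of the
  monoid algebra of the monoid of exponent vectors.
\<close>

type_synonym 'i cpoly = "('i \<Rightarrow>\<^sub>0 nat) \<Rightarrow>\<^sub>0 complex"

text \<open>
  Value in the algebra \<^typ>\<open>'b\<close> whose structure map is \<open>h\<close>: \<open>h = id\<close> evaluates at a point, and
  \<open>h = fps_const\<close> substitutes formal power series for the variables.
\<close>

definition cpoly_value ::
  "(complex \<Rightarrow> 'b) \<Rightarrow> 'i::finite cpoly \<Rightarrow> ('i \<Rightarrow> 'b::comm_semiring_1) \<Rightarrow> 'b" where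
  "cpoly_value h f x =
     (\<Sum>m\<in>Poly_Mapping.keys f. h (Poly_Mapping.lookup f m) *
        (\<Prod>i\<in>UNIV. x i ^ Poly_Mapping.lookup m i))"

definition zero_locus :: "('N \<Rightarrow> 'n::finite cpoly) \<Rightarrow> (complex ^ 'n) set" where
  "zero_locus v = {x. \<forall>i. cpoly_value id (v i) (vec_nth x) = 0}"


definition proportional :: "complex ^ 'N \<Rightarrow> complex ^ 'N::finite \<Rightarrow> bool" where
  "proportional w w' \<longleftrightarrow> w \<noteq> 0 \<and> w' \<noteq> 0 \<and> (\<exists>c. w' = c *s w)"

lemma part_equivp_proportional: "part_equivp proportional"
proof (rule part_equivpI)
  have "proportional 1 (1 :: complex ^ 'N)"
    unfolding proportional_def by (auto intro: exI[of _ 1])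
  then show "\<exists>w :: complex ^ 'N. proportional w w" by blast
  show "symp (proportional :: complex ^ 'N \<Rightarrow> _)"
  proof (rule sympI)
    fix w w' :: "complex ^ 'N"
    assume a: "proportional w w'"
    then obtain c where c: "w' = c *s w" "w \<noteq> 0" "w' \<noteq> 0" unfolding proportional_def by blast
    then have "c \<noteq> 0" by auto
    then have "w = inverse c *s w'" using c by (simp add: vector_smult_assoc)
    then show "proportional w' w" using c unfolding proportional_def by blast
  qed
  show "transp (proportional :: complex ^ 'N \<Rightarrow> _)"
    by (rule transpI) (auto simp: proportional_def vector_smult_assoc)
qed

text \<open>The projective space of lines in the coordinate space indexed by \<^typ>\<open>'N\<close>.\<close>

quotient_type 'N proj = "complex ^ 'N::finite" / partial: proportional
  by (rule part_equivp_proportional)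

text \<open>\<open>proj_class w\<close> is the point with homogeneous coordinates \<open>w\<close>; it is meaningful for
  \<open>w \<noteq> 0\<close> only.\<close>

abbreviation proj_class :: "complex ^ 'N::finite \<Rightarrow> 'N proj" where
  "proj_class w \<equiv> abs_proj w"

lemma proj_class_eq_iff:
  assumes "w \<noteq> 0" "w' \<noteq> 0"
  shows "proj_class w = proj_class w' \<longleftrightarrow> (\<exists>c. w' = c *s w)"
proof -
  have refl: "proportional u u" if "u \<noteq> 0" for u :: "complex ^ 'N"
    using that unfolding proportional_def by (auto intro: exI[of _ 1])
  have "proj_class w = proj_class w' \<longleftrightarrow> proportional w w'"
    using Quotient_rel[OF Quotient_proj, of w w'] refl assms by blast
  then show ?thesis using assms by (simp add: proportional_def)
qed


text \<open>
  Equations on the product of affine and projective space: polynomials in the affine variables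
  (left summand) and the homogeneous coordinates (right summand) that are homogeneous in the latter.
\<close>

definition is_form :: "('n + 'N::finite) cpoly \<Rightarrow> bool" where
  "is_form f \<longleftrightarrow>
     (\<exists>d. \<forall>m\<in>Poly_Mapping.keys f. (\<Sum>j\<in>UNIV. Poly_Mapping.lookup m (Inr j)) = d)"

definition form_vanishes ::
  "('n::finite + 'N::finite) cpoly \<Rightarrow> (complex ^ 'n) \<times> 'N proj \<Rightarrow> bool" where
  "form_vanishes f Q \<longleftrightarrow>
     (\<forall>w. w \<noteq> 0 \<and> proj_class w = snd Q \<longrightarrow>
        cpoly_value id f (case_sum (vec_nth (fst Q)) (vec_nth w)) = 0)"

definition zariski_closed :: "((complex ^ 'n::finite) \<times> 'N::finite proj) set \<Rightarrow> bool" where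
  "zariski_closed S \<longleftrightarrow>
     (\<exists>F. (\<forall>f\<in>F. is_form f) \<and> S = {Q. \<forall>f\<in>F. form_vanishes f Q})"

definition blowup ::
  "('N::finite \<Rightarrow> 'n::finite cpoly) \<Rightarrow> ((complex ^ 'n) \<times> 'N proj) set" where
  "blowup v = zariski_closed hull
     {(x, proj_class (\<chi> i. cpoly_value id (v i) (vec_nth x))) | x. x \<notin> zero_locus v}"

definition exceptional_locus ::
  "('N::finite \<Rightarrow> 'n::finite cpoly) \<Rightarrow> ((complex ^ 'n) \<times> 'N proj) set" where
  "exceptional_locus v = {Q \<in> blowup v. fst Q \<in> zero_locus v}"


text \<open>
  A formal arc in the product of affine and projective space, given in coordinates: since the ring
  of formal power series is local, a formal arc in projective space is given by a vector of power
  series whose constant term is nonzero, unique up to multiplication by an invertible power series.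
  Centre, order and containment below do not depend on this choice.
\<close>

type_synonym ('n, 'N) coord_arc = "((complex fps) ^ 'n) \<times> ((complex fps) ^ 'N)"

definition fps_vec_at_0 :: "(complex fps) ^ 'i \<Rightarrow> complex ^ 'i::finite" where
  "fps_vec_at_0 a = (\<chi> i. fps_nth (vec_nth a i) 0)"

definition is_arc :: "('n::finite, 'N::finite) coord_arc \<Rightarrow> bool" where
  "is_arc \<alpha> \<longleftrightarrow> fps_vec_at_0 (snd \<alpha>) \<noteq> 0"

definition arc_center :: "('n::finite, 'N::finite) coord_arc \<Rightarrow> (complex ^ 'n) \<times> 'N proj" where
  "arc_center \<alpha> = (fps_vec_at_0 (fst \<alpha>), proj_class (fps_vec_at_0 (snd \<alpha>)))"

text \<open>
  An arc lies on a Zariski closed set \<open>S\<close> if every equation satisfied by \<open>S\<close> holds identically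
  along the arc.
\<close>

definition arc_on ::
  "((complex ^ 'n::finite) \<times> 'N::finite proj) set \<Rightarrow> ('n, 'N) coord_arc \<Rightarrow> bool" where
  "arc_on S \<alpha> \<longleftrightarrow>
     (\<forall>f. is_form f \<and> (\<forall>Q\<in>S. form_vanishes f Q) \<longrightarrow>
        cpoly_value fps_const f (case_sum (vec_nth (fst \<alpha>)) (vec_nth (snd \<alpha>))) = 0)"

definition pullback ::
  "('N::finite \<Rightarrow> 'n::finite cpoly) \<Rightarrow> ('n, 'N) coord_arc \<Rightarrow> 'N \<Rightarrow> complex fps" where
  "pullback v \<alpha> i = cpoly_value fps_const (v i) (vec_nth (fst \<alpha>))"

text \<open>
  The exceptional locus is cut out on the blowup by the equations \<open>v i = 0\<close>, so an arc on the blowup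
  is contained in it iff all these functions vanish identically along the arc.
\<close>

definition arc_in_exceptional ::
  "('N::finite \<Rightarrow> 'n::finite cpoly) \<Rightarrow> ('n, 'N) coord_arc \<Rightarrow> bool" where
  "arc_in_exceptional v \<alpha> \<longleftrightarrow> (\<forall>i. pullback v \<alpha> i = 0)"

definition has_arc_order ::
  "('N::finite \<Rightarrow> 'n::finite cpoly) \<Rightarrow> ('n, 'N) coord_arc \<Rightarrow> nat \<Rightarrow> bool" where
  "has_arc_order v \<alpha> k \<longleftrightarrow> k \<ge> 1 \<and>
     (\<exists>u :: (complex fps) ^ 'N.
        fps_vec_at_0 u \<noteq> 0 \<and> (\<forall>i. pullback v \<alpha> i = fps_X ^ k * vec_nth u i))"

definition arc_order ::
  "('N::finite \<Rightarrow> 'n::finite cpoly) \<Rightarrow> ('n, 'N) coord_arc \<Rightarrow> nat" where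
  "arc_order v \<alpha> = (THE k. has_arc_order v \<alpha> k)"

definition arcs_at ::
  "('N::finite \<Rightarrow> 'n::finite cpoly) \<Rightarrow> (complex ^ 'n) \<times> 'N proj \<Rightarrow> ('n, 'N) coord_arc set" where
  "arcs_at v P =
     {\<alpha>. is_arc \<alpha> \<and> arc_on (blowup v) \<alpha> \<and> arc_center \<alpha> = P \<and> \<not> arc_in_exceptional v \<alpha>}"

text \<open>
  The infimum is taken in \<^typ>\<open>enat\<close>: it is the minimum if there is an arc at \<open>P\<close>, and \<open>\<infinity>\<close>
  otherwise. So finiteness of \<open>max_arc_order\<close> includes the existence of an arc at every point
  of the exceptional locus.
\<close>

definition min_arc_order ::
  "('N::finite \<Rightarrow> 'n::finite cpoly) \<Rightarrow> (complex ^ 'n) \<times> 'N proj \<Rightarrow> enat" where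
  "min_arc_order v P = (INF \<alpha>\<in>arcs_at v P. enat (arc_order v \<alpha>))"

definition max_arc_order :: "('N::finite \<Rightarrow> 'n::finite cpoly) \<Rightarrow> enat" where
  "max_arc_order v = (SUP P\<in>exceptional_locus v. min_arc_order v P)"


text \<open>The order is well defined for the arcs it is used for.\<close>

lemma pullback_nth_0:
  "fps_nth (pullback v \<alpha> i) 0 = cpoly_value id (v i) (vec_nth (fps_vec_at_0 (fst \<alpha>)))"
proof -
  have p: "fps_nth (\<Prod>j\<in>A. g j ^ e j) 0 = (\<Prod>j\<in>A. fps_nth (g j) 0 ^ e j)"
    if "finite A" for A :: "'b set" and g :: "'b \<Rightarrow> complex fps" and e
    using that by induction (simp_all add: fps_mult_nth_0 fps_nth_power_0)
  show ?thesis
    by (simp add: pullback_def cpoly_value_def fps_vec_at_0_def fps_sum_nth p)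
qed

lemma ex1_arc_order:
  assumes "arc_center \<alpha> \<in> exceptional_locus v" "\<not> arc_in_exceptional v \<alpha>"
  shows "\<exists>!k. has_arc_order v \<alpha> k"
proof -
  define S where "S = {i. pullback v \<alpha> i \<noteq> 0}"
  define K where "K = Min ((\<lambda>i. subdegree (pullback v \<alpha> i)) ` S)"
  have S: "finite S" "S \<noteq> {}" using assms(2) by (auto simp: S_def arc_in_exceptional_def)
  have "K \<in> (\<lambda>i. subdegree (pullback v \<alpha> i)) ` S" unfolding K_def using S by (intro Min_in) auto
  then obtain i0 where i0: "pullback v \<alpha> i0 \<noteq> 0" "subdegree (pullback v \<alpha> i0) = K"
    by (auto simp: S_def)
  have le: "K \<le> subdegree (pullback v \<alpha> i)" if "pullback v \<alpha> i \<noteq> 0" for i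
    unfolding K_def using S that by (intro Min_le) (auto simp: S_def)
  have low: "fps_nth (pullback v \<alpha> i) j = 0" if "j < K" for i j
    using le[of i] that by (cases "pullback v \<alpha> i = 0") (auto intro: nth_less_subdegree_zero)
  have nz: "fps_nth (pullback v \<alpha> i0) K \<noteq> 0" using i0 by (metis nth_subdegree_nonzero)
  have "fps_nth (pullback v \<alpha> i0) 0 = 0"
    using assms(1) unfolding pullback_nth_0
    by (simp add: arc_center_def exceptional_locus_def zero_locus_def)
  with nz have "K \<noteq> 0" by metis
  then have K1: "K \<ge> 1" by simp
  have eq: "pullback v \<alpha> i = fps_X ^ K * fps_shift K (pullback v \<alpha> i)" for i
    using low by (simp add: fps_eq_iff fps_X_power_mult_nth)
  have "has_arc_order v \<alpha> K"
    unfolding has_arc_order_def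
  proof (intro conjI exI[of _ "\<chi> i. fps_shift K (pullback v \<alpha> i)"] allI K1)
    show "fps_vec_at_0 (\<chi> i. fps_shift K (pullback v \<alpha> i)) \<noteq> 0"
      using nz by (auto simp: fps_vec_at_0_def vec_eq_iff)
  qed (use eq in simp)
  moreover have "k = K" if k: "has_arc_order v \<alpha> k" for k
  proof -
    obtain u where u: "fps_vec_at_0 u \<noteq> 0"
      "\<And>i. pullback v \<alpha> i = fps_X ^ k * vec_nth u i"
      using k unfolding has_arc_order_def by blast
    obtain i1 where "fps_nth (vec_nth u i1) 0 \<noteq> 0"
      using u(1) by (auto simp: fps_vec_at_0_def vec_eq_iff)
    then have "fps_nth (pullback v \<alpha> i1) k \<noteq> 0" using u(2) by (simp add: fps_X_power_mult_nth)
    then have "\<not> k < K" using low by blast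
    moreover have "\<not> K < k" using nz u(2)[of i0] by (auto simp: fps_X_power_mult_nth)
    ultimately show ?thesis by simp
  qed
  ultimately show ?thesis by blast
qed

end

theory Submission
  imports Defs
    "HOL-Computational_Algebra.Fundamental_Theorem_Algebra"
    "HOL-Computational_Algebra.Fraction_Field"
    "HOL-Computational_Algebra.Field_as_Ring"
    "HOL-Computational_Algebra.Polynomial_FPS"
    "Jordan_Normal_Form.Char_Poly"
begin

text \<open>
  On the chart where the \<open>i\<close>-th homogeneous coordinate is nonzero, the blowup is the affine variety with
  coordinate ring \<open>A = \<complex>[x, v\<^sub>j / v\<^sub>i]\<close>, a domain, and the order of an arc is the order of \<open>v\<^sub>i\<close>
  along it. By Noether normalization \<open>A\<close> is finite over a polynomial ring \<open>S = \<complex>[z]\<close>, and some nonzero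
  \<open>N \<in> S\<close> is a multiple of \<open>v\<^sub>i\<close> in \<open>A\<close>. Through the image \<open>z\<^sub>0\<close> of a given point \<open>P\<close> take a line on which
  \<open>N\<close> does not vanish identically, reparametrized as \<open>z\<^sub>0 + t\<^sup>E u\<close>. Then \<open>N\<close>, hence \<open>v\<^sub>i\<close>, has order at
  most \<open>E deg N\<close> on every lift of this arc to \<open>A\<close>. By Puiseux's theorem a fixed \<open>E\<close> makes all
  monic equations of the degrees that occur split along all such arcs.

  A lift centered at \<open>P\<close> exists by a going-down argument: take a linear form \<open>\<theta>\<close> in the generators of \<open>A\<close>
  whose value at \<open>P\<close> differs from its values at the other points of the fibre over \<open>z\<^sub>0\<close>. Since \<open>S\<close> is
  integrally closed, the minimal polynomial of \<open>\<theta>\<close> over \<open>S\<close> generates all relations of \<open>\<theta>\<close>, so it has a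
  root along the arc that starts at \<open>\<theta>(P)\<close>. This defines a lift to \<open>S[\<theta>]\<close>, which extends to the
  integral extension \<open>A\<close>; the choice of \<open>\<theta>\<close> forces its center to be \<open>P\<close>.
\<close>

subsection \<open>Evaluation of polynomials\<close>

text \<open>The difficulty is uniformity in \<open>P\<close>. Lying over alone lifts the arc, but
  the lift may start anywhere in the fibre; the going-down step repairs this at the price of a form
  \<open>\<theta>\<close>, a minimal polynomial and a line that all change with \<open>P\<close>.
  These enter the bound only through data fixed beforehand. The determinant trick gives every
  element of \<open>A\<close> a monic equation of one common degree \<open>D\<close>, so the minimal
  polynomial of any \<open>\<theta>\<close> has degree at most \<open>D\<close>; the exponent in
  Puiseux's theorem depends on the degree alone; and all lines run from \<open>z0\<close> to one
  fixed point where \<open>N\<close> is nonzero, with a degree bound for \<open>N\<close> that is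
  valid on every line.

  Coordinate rings do not occur as types. A domain is represented by a tuple of generators in a
  field, a homomorphism out of it by the fact that all relations of the generators survive, and
  adjoining an element by updating the tuple at a fresh index. This is why polynomials in variables
  indexed by \<open>nat\<close> are used throughout, and why one evaluation map has to serve
  numbers, power series, fractions and polynomials alike.\<close>

class complex_alg = comm_ring_1 +
  fixes cst :: "complex \<Rightarrow> 'a"
  assumes cst_add: "cst (a + b) = cst a + cst b"
    and cst_mult: "cst (a * b) = cst a * cst b"
    and cst_1 [simp]: "cst 1 = 1"
begin

lemma cst_0 [simp]: "cst 0 = 0"
  using cst_add[of 0 0] by simp

lemma cst_uminus: "cst (- a) = - cst a"
  using cst_add[of a "- a"] by (simp add: eq_neg_iff_add_eq_0 add.commute)

lemma cst_diff: "cst (a - b) = cst a - cst b"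
  using cst_add[of a "- b"] by (simp add: cst_uminus)

lemma cst_power: "cst (a ^ n) = cst a ^ n"
  by (induction n) (simp_all add: cst_mult)

lemma cst_neq_0:
  assumes "c \<noteq> 0" shows "cst c \<noteq> 0"
  using cst_mult[of c "inverse c"] assms by (metis cst_1 mult_zero_left right_inverse zero_neq_one)

lemma cst_eq_0_iff [simp]: "cst c = 0 \<longleftrightarrow> c = 0"
  using cst_neq_0 by auto

lemma cst_eq_iff: "cst c = cst d \<longleftrightarrow> c = d"
  using cst_eq_0_iff[of "c - d"] unfolding cst_diff by simp

end

instantiation complex :: complex_alg
begin
definition "cst_complex (c :: complex) = c"
instance by standard (simp_all add: cst_complex_def)
end

instantiation fps :: (complex_alg) complex_alg
begin
definition "cst_fps c = fps_const (cst c)"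
instance by standard (simp_all add: cst_fps_def cst_add cst_mult)
end

instantiation poly :: (complex_alg) complex_alg
begin
definition "cst_poly c = [:cst c:]"
instance by standard (simp_all add: cst_poly_def cst_add cst_mult)
end

instantiation fract :: ("{idom, complex_alg}") complex_alg
begin
definition "cst_fract c = Fract (cst c) 1"
instance by standard (simp_all add: cst_fract_def cst_add cst_mult One_fract_def)
end

instantiation poly_mapping :: (comm_monoid_add, complex_alg) complex_alg
begin
definition "cst_poly_mapping c = Poly_Mapping.single 0 (cst c)"
instance by standard (simp_all add: cst_poly_mapping_def cst_add cst_mult single_add mult_single)
end

text \<open>The inner product runs over the support of the monomial, so that infinitely many
  variables are allowed; for finite index types it agrees with \<open>cpoly_value\<close>. The
  structure map \<open>cst\<close> is determined by the target type.\<close>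

definition ev :: "('i \<Rightarrow> 'a) \<Rightarrow> 'i cpoly \<Rightarrow> 'a::complex_alg" where
  "ev x f = (\<Sum>m\<in>Poly_Mapping.keys f. cst (Poly_Mapping.lookup f m) *
      (\<Prod>i\<in>Poly_Mapping.keys m. x i ^ Poly_Mapping.lookup m i))"

definition var :: "'i \<Rightarrow> 'i cpoly" where
  "var i = Poly_Mapping.single (Poly_Mapping.single i 1) 1"

lemma ev_superset:
  assumes "finite A" "Poly_Mapping.keys f \<subseteq> A"
  shows "ev x f = (\<Sum>m\<in>A. cst (Poly_Mapping.lookup f m) *
      (\<Prod>i\<in>Poly_Mapping.keys m. x i ^ Poly_Mapping.lookup m i))"
  unfolding ev_def
  by (rule sum.mono_neutral_left) (use assms in \<open>auto simp: in_keys_iff\<close>)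

lemma monomial_value_superset:
  assumes "finite A" "Poly_Mapping.keys m \<subseteq> A"
  shows "(\<Prod>i\<in>Poly_Mapping.keys m. x i ^ Poly_Mapping.lookup m i :: 'a::complex_alg)
    = (\<Prod>i\<in>A. x i ^ Poly_Mapping.lookup m i)"
  by (rule prod.mono_neutral_left) (use assms in \<open>auto simp: in_keys_iff\<close>)

lemma monomial_value_add:
  "(\<Prod>i\<in>Poly_Mapping.keys (m + m'). x i ^ Poly_Mapping.lookup (m + m') i :: 'a::complex_alg)
    = (\<Prod>i\<in>Poly_Mapping.keys m. x i ^ Poly_Mapping.lookup m i)
      * (\<Prod>i\<in>Poly_Mapping.keys m'. x i ^ Poly_Mapping.lookup m' i)"
proof -
  let ?A = "Poly_Mapping.keys m \<union> Poly_Mapping.keys m'"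
  have "Poly_Mapping.keys (m + m') \<subseteq> ?A" by (rule Poly_Mapping.keys_add)
  then have "(\<Prod>i\<in>Poly_Mapping.keys (m + m'). x i ^ Poly_Mapping.lookup (m + m') i :: 'a)
    = (\<Prod>i\<in>?A. x i ^ Poly_Mapping.lookup (m + m') i)"
    by (intro monomial_value_superset) auto
  then show ?thesis
    by (simp add: monomial_value_superset[of ?A m] monomial_value_superset[of ?A m'] lookup_add power_add prod.distrib)
qed

lemma ev_0 [simp]: "ev x 0 = 0"
  by (simp add: ev_def)

lemma ev_add: "ev x (f + g) = ev x f + ev x g"
proof -
  let ?A = "Poly_Mapping.keys f \<union> Poly_Mapping.keys g"
  have "Poly_Mapping.keys (f + g) \<subseteq> ?A" by (rule Poly_Mapping.keys_add)
  then show ?thesis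
    by (simp add: ev_superset[of ?A] lookup_add cst_add distrib_right sum.distrib)
qed

lemma ev_single: "ev x (Poly_Mapping.single m c) =
    cst c * (\<Prod>i\<in>Poly_Mapping.keys m. x i ^ Poly_Mapping.lookup m i)"
  by (subst ev_superset[of "{m}"]) auto

lemma cpoly_sum_single:
  "(f :: 'i cpoly) = (\<Sum>m\<in>Poly_Mapping.keys f. Poly_Mapping.single m (Poly_Mapping.lookup f m))"
  by (rule poly_mapping_eqI)
    (auto simp: lookup_sum lookup_single when_def in_keys_iff sum.delta' if_distrib cong: if_cong)

lemma ev_sum: "ev x (sum g A) = (\<Sum>i\<in>A. ev x (g i))"
  by (induction A rule: infinite_finite_induct) (simp_all add: ev_add)

lemma ev_mult: "ev x (f * g) = ev x f * ev x g"
proof -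
  have s: "ev x (Poly_Mapping.single m c * Poly_Mapping.single m' d) =
    ev x (Poly_Mapping.single m c) * ev x (Poly_Mapping.single m' d)" for m c m' d
    by (simp add: mult_single ev_single cst_mult monomial_value_add mult_ac)
  have "ev x (f * g) = ev x ((\<Sum>m\<in>Poly_Mapping.keys f. Poly_Mapping.single m (Poly_Mapping.lookup f m)) *
     (\<Sum>m\<in>Poly_Mapping.keys g. Poly_Mapping.single m (Poly_Mapping.lookup g m)))"
    using cpoly_sum_single by metis
  also have "\<dots> = ev x (\<Sum>m\<in>Poly_Mapping.keys f. Poly_Mapping.single m (Poly_Mapping.lookup f m)) *
     ev x (\<Sum>m\<in>Poly_Mapping.keys g. Poly_Mapping.single m (Poly_Mapping.lookup g m))"
    by (simp add: sum_product ev_sum s)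
  also have "\<dots> = ev x f * ev x g"
    using cpoly_sum_single by metis
  finally show ?thesis .
qed

lemma ev_cst [simp]: "ev x (cst c) = cst c"
  by (simp add: cst_poly_mapping_def cst_complex_def ev_single)

lemma ev_1 [simp]: "ev x 1 = 1"
  using ev_cst[of x 1] by (simp del: ev_cst)

lemma ev_var [simp]: "ev x (var i) = x i"
  by (simp add: var_def ev_single)

lemma comm_ring_hom_ev: "comm_ring_hom (ev x)"
  by standard (simp_all add: ev_add ev_mult)

interpretation ev: comm_ring_hom "ev x" for x :: "'i \<Rightarrow> 'a::complex_alg"
  by (rule comm_ring_hom_ev)

definition alg_hom :: "('a::complex_alg \<Rightarrow> 'b::complex_alg) \<Rightarrow> bool" where
  "alg_hom h \<longleftrightarrow> comm_ring_hom h \<and> (\<forall>c. h (cst c) = cst c)"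

lemma alg_homD: "alg_hom h \<Longrightarrow> comm_ring_hom h" "alg_hom h \<Longrightarrow> h (cst c) = cst c"
  by (simp_all add: alg_hom_def)

lemma alg_hom_ev_eq:
  assumes "alg_hom h"
  shows "h (ev x f) = ev (\<lambda>i. h (x i)) f"
proof -
  interpret comm_ring_hom h using assms by (rule alg_homD)
  show ?thesis
    by (simp add: ev_def hom_distribs alg_homD(2)[OF assms])
qed

lemma alg_hom_ev: "alg_hom (ev x)"
  by (simp add: alg_hom_def comm_ring_hom_ev)

lemma ev_ev: "ev x (ev y f) = ev (\<lambda>i. ev x (y i)) f"
  by (rule alg_hom_ev_eq[OF alg_hom_ev])

lemma ev_var_id [simp]: "ev var f = f"
proof -
  have mon: "(\<Prod>i\<in>A. var i ^ Poly_Mapping.lookup m i)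
    = Poly_Mapping.single (\<Sum>i\<in>A. Poly_Mapping.single i (Poly_Mapping.lookup m i)) (1::complex)"
    if "finite A" for A and m :: "'a \<Rightarrow>\<^sub>0 nat"
    using that
  proof (induction A)
    case (insert i A)
    have "var i ^ n = Poly_Mapping.single (Poly_Mapping.single i n) (1::complex)" for n
      by (induction n) (simp_all add: var_def mult_single single_add[symmetric])
    with insert show ?case by (simp add: mult_single)
  qed simp
  have m: "(\<Sum>i\<in>Poly_Mapping.keys m. Poly_Mapping.single i (Poly_Mapping.lookup m i)) = m"
    for m :: "'a \<Rightarrow>\<^sub>0 nat"
    by (rule poly_mapping_eqI)
      (auto simp: lookup_sum lookup_single when_def in_keys_iff sum.delta' if_distrib cong: if_cong)
  show ?thesis
    by (subst (2) cpoly_sum_single[of f])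
      (simp add: ev_def mon m cst_poly_mapping_def cst_complex_def mult_single)
qed

lemma alg_homI:
  assumes "\<And>a b. h (a + b) = h a + h b" "\<And>a b. h (a * b) = h a * h b"
    and "\<And>c. h (cst c) = cst c"
  shows "alg_hom h"
proof -
  have "h 0 = 0" "h 1 = 1" using assms(3)[of 0] assms(3)[of 1] by simp_all
  then have "comm_ring_hom h" by unfold_locales (use assms in auto)
  then show ?thesis using assms by (simp add: alg_hom_def)
qed

lemma alg_homD':
  assumes "alg_hom h"
  shows "h (a + b) = h a + h b" "h (a * b) = h a * h b" "h 0 = 0" "h 1 = 1"
    "h (a - b) = h a - h b" "h (- a) = - h a" "h (a ^ n) = h a ^ n"
    "h (sum g A) = (\<Sum>i\<in>A. h (g i))" "h (prod g A) = (\<Prod>i\<in>A. h (g i))"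
    "h (cst c) = cst c"
proof -
  interpret comm_ring_hom h using assms by (rule alg_homD)
  show "h (a + b) = h a + h b" "h (a * b) = h a * h b" "h 0 = 0" "h 1 = 1"
    "h (a - b) = h a - h b" "h (- a) = - h a" "h (a ^ n) = h a ^ n"
    "h (sum g A) = (\<Sum>i\<in>A. h (g i))" "h (prod g A) = (\<Prod>i\<in>A. h (g i))"
    by (simp_all add: hom_distribs)
  show "h (cst c) = cst c" using assms by (rule alg_homD)
qed

lemma alg_hom_poly: "alg_hom (\<lambda>p. poly p y)"
  by (rule alg_homI) (auto simp: cst_poly_def)

lemma alg_hom_map_poly:
  assumes "alg_hom h" shows "alg_hom (map_poly h)"
proof -
  interpret map_poly_comm_ring_hom h
    using assms alg_homD(1) by (simp add: map_poly_comm_ring_hom_def)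
  show ?thesis
    by (rule alg_homI)
      (simp_all add: hom_distribs cst_poly_def map_poly_pCons alg_homD'[OF assms])
qed

lemma alg_hom_comp: "alg_hom g \<Longrightarrow> alg_hom h \<Longrightarrow> alg_hom (\<lambda>x. g (h x))"
  by (rule alg_homI) (simp_all add: alg_homD')

lemma alg_hom_to_fract: "alg_hom (to_fract :: 'a::{idom,complex_alg} \<Rightarrow> 'a fract)"
  by (rule alg_homI) (simp_all add: cst_fract_def to_fract_def)

lemma alg_hom_fps_nth_0: "alg_hom (\<lambda>a :: 'a::complex_alg fps. fps_nth a 0)"
  by (rule alg_homI) (simp_all add: cst_fps_def)

lemma alg_hom_fps_compose:
  assumes "fps_nth b 0 = (0::complex)"
  shows "alg_hom (\<lambda>a. fps_compose a b)"
  by (rule alg_homI) (simp_all add: cst_fps_def fps_compose_add_distrib fps_compose_mult_distrib assms)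

subsection \<open>Truncation and Noether normalization\<close>

text \<open>Reduction modulo \<open>B\<close> isolates the lowest digit, and the induction treats
  the rest. This makes the exponents of a Kronecker substitution injective.\<close>

lemma digits_unique:
  fixes a b :: "nat \<Rightarrow> nat"
  assumes "\<And>i. i < n \<Longrightarrow> a i < B" "\<And>i. i < n \<Longrightarrow> b i < B"
    and "(\<Sum>i<n. a i * B ^ i) = (\<Sum>i<n. b i * B ^ i)" "i < n"
  shows "a i = b i"
  using assms
proof (induction n arbitrary: a b i)
  case (Suc n)
  have e: "(\<Sum>i<Suc n. c i * B ^ i) = c 0 + B * (\<Sum>i<n. c (Suc i) * B ^ i)" for c :: "nat \<Rightarrow> nat"
    by (simp only: sum.lessThan_Suc_shift) (simp add: sum_distrib_left mult_ac)
  have eq: "a 0 + B * (\<Sum>i<n. a (Suc i) * B ^ i) = b 0 + B * (\<Sum>i<n. b (Suc i) * B ^ i)"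
    using Suc.prems(3) by (simp only: e)
  have lt: "a 0 < B" "b 0 < B" using Suc.prems(1,2) by auto
  from eq have "(a 0 + B * (\<Sum>i<n. a (Suc i) * B ^ i)) mod B = (b 0 + B * (\<Sum>i<n. b (Suc i) * B ^ i)) mod B"
    by simp
  with lt have 0: "a 0 = b 0" by simp
  with eq lt have "(\<Sum>i<n. a (Suc i) * B ^ i) = (\<Sum>i<n. b (Suc i) * B ^ i)" by auto
  with Suc.IH[of "\<lambda>i. a (Suc i)" "\<lambda>i. b (Suc i)" "i - 1"] Suc.prems 0
  show ?case by (cases i) auto
qed simp

text \<open>Kronecker substitution: distinct monomials get distinct exponents.\<close>

lemma ex_ev_neq_0:
  fixes f :: "nat cpoly"
  assumes "f \<noteq> 0"
  shows "\<exists>c :: nat \<Rightarrow> complex. ev c f \<noteq> 0"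
proof -
  let ?K = "Poly_Mapping.keys f"
  have "finite (\<Union>m\<in>?K. Poly_Mapping.keys m)" by simp
  then obtain n where n: "\<And>m i. m \<in> ?K \<Longrightarrow> i \<in> Poly_Mapping.keys m \<Longrightarrow> i < n"
    unfolding finite_nat_set_iff_bounded by blast
  have "finite (\<Union>m\<in>?K. Poly_Mapping.lookup m ` Poly_Mapping.keys m)" by simp
  then obtain B where B: "\<And>m i. m \<in> ?K \<Longrightarrow> i \<in> Poly_Mapping.keys m \<Longrightarrow> Poly_Mapping.lookup m i < B"
    unfolding finite_nat_set_iff_bounded by blast
  \<comment> \<open>The bound \<open>B\<close> only concerns exponents of variables that occur. The
    successor also makes the exponent 0 of the other variables a legal digit when
    \<open>B = 0\<close>.\<close>
  define B' where "B' = Suc B"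
  define w where "w m = (\<Sum>i<n. Poly_Mapping.lookup m i * B' ^ i)" for m :: "nat \<Rightarrow>\<^sub>0 nat"
  have lt: "Poly_Mapping.lookup m i < B'" if "m \<in> ?K" for m i
    using B[OF that, of i] by (cases "i \<in> Poly_Mapping.keys m") (auto simp: B'_def in_keys_iff)
  have inj: "m = m'" if "m \<in> ?K" "m' \<in> ?K" "w m = w m'" for m m'
  proof (rule poly_mapping_eqI)
    fix i
    show "Poly_Mapping.lookup m i = Poly_Mapping.lookup m' i"
    proof (cases "i < n")
      case True
      show ?thesis
        by (rule digits_unique[of n _ B']) (use that lt True in \<open>auto simp: w_def\<close>)
    next
      case False
      then show ?thesis using n[OF that(1), of i] n[OF that(2), of i] by (metis in_keys_iff)
    qed
  qed
  define P :: "complex poly" where "P = ev (\<lambda>i. monom 1 (B' ^ i)) f"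
  have "(\<Prod>i\<in>Poly_Mapping.keys m. monom (1::complex) (B' ^ i) ^ Poly_Mapping.lookup m i) = monom 1 (w m)"
    if "m \<in> ?K" for m
  proof -
    have "(\<Prod>i\<in>Poly_Mapping.keys m. monom (1::complex) (B' ^ i) ^ Poly_Mapping.lookup m i)
      = (\<Prod>i<n. monom (1::complex) (B' ^ i) ^ Poly_Mapping.lookup m i)"
      by (rule monomial_value_superset) (use n[OF that] in auto)
    also have "\<dots> = (\<Prod>i<n. monom 1 (Poly_Mapping.lookup m i * B' ^ i))"
      by (simp add: monom_power mult.commute)
    also have "\<dots> = monom 1 (w m)"
      unfolding w_def by (induction n) (simp_all add: mult_monom)
    finally show ?thesis .
  qed
  then have P: "P = (\<Sum>m\<in>?K. monom (Poly_Mapping.lookup f m) (w m))"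
    by (simp add: P_def ev_def cst_poly_def cst_complex_def smult_monom)
  obtain m0 where m0: "m0 \<in> ?K" using assms by fastforce
  have "coeff P (w m0) = (\<Sum>m\<in>?K. if m = m0 then Poly_Mapping.lookup f m else 0)"
    unfolding P coeff_sum by (rule sum.cong) (use inj m0 in auto)
  also have "\<dots> \<noteq> 0" using m0 by (simp add: in_keys_iff)
  finally have "P \<noteq> 0" by auto
  then have "finite {t. poly P t = 0}" by (rule poly_roots_finite)
  then have "{t. poly P t = 0} \<noteq> UNIV" by (metis infinite_UNIV_char_0)
  then obtain t where "poly P t \<noteq> 0" by blast
  then have "ev (\<lambda>i. t ^ B' ^ i) f \<noteq> 0"
    using alg_hom_ev_eq[OF alg_hom_poly, of "\<lambda>i. monom 1 (B' ^ i)" f t]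
    by (simp add: P_def poly_monom)
  then show ?thesis by blast
qed

text \<open>Finite tuples are functions on \<^typ>\<open>nat\<close> that vanish from some index on; \<open>restr r\<close> truncates
  to length \<open>r\<close>, and \<open>ev (restr r var)\<close> projects onto the polynomials in the first \<open>r\<close> variables.\<close>

definition restr :: "nat \<Rightarrow> (nat \<Rightarrow> 'a) \<Rightarrow> nat \<Rightarrow> 'a::zero" where
  "restr r x = (\<lambda>i. if i < r then x i else 0)"

lemma ev_restr_var: "ev x (ev (restr r var) f) = ev (restr r x) f"
  by (simp add: ev_ev restr_def if_distrib cong: if_cong)

lemma restr_restr [simp]: "restr r (restr r x) = restr r x"
  by (auto simp: restr_def)

lemma ev_restr_neq_0:
  assumes "ev (restr r var) f \<noteq> 0"
  shows "\<exists>c :: nat \<Rightarrow> complex. ev (restr r c) f \<noteq> 0"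
  using ex_ev_neq_0[OF assms] by (simp add: ev_restr_var)

lemma lookup_ev_restr_var:
  "Poly_Mapping.lookup (ev (restr r var) f) m =
     (if Poly_Mapping.keys m \<subseteq> {..<r} then Poly_Mapping.lookup f m else 0)"
proof -
  have "ev (restr r var) (Poly_Mapping.single m' c) =
     (if Poly_Mapping.keys m' \<subseteq> {..<r} then Poly_Mapping.single m' c else 0)" for m' c
  proof (cases "Poly_Mapping.keys m' \<subseteq> {..<r}")
    case True
    have "ev (restr r var) (Poly_Mapping.single m' c) = ev var (Poly_Mapping.single m' c)"
      unfolding ev_single using True by (auto simp: restr_def intro!: prod.cong arg_cong2[of _ _ _ _ "(*)"])
    with True show ?thesis by simp
  next
    case False
    then obtain i where "i \<in> Poly_Mapping.keys m'" "\<not> i < r" by auto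
    then have "(\<Prod>i\<in>Poly_Mapping.keys m'. restr r var i ^ Poly_Mapping.lookup m' i) = (0 :: nat cpoly)"
      by (intro prod_zero) (auto simp: restr_def in_keys_iff intro!: bexI[of _ i])
    with False show ?thesis by (simp add: ev_single)
  qed
  note single = this
  let ?g = "\<lambda>m'. Poly_Mapping.single m' (Poly_Mapping.lookup f m')"
  have "ev (restr r var) f = ev (restr r var) (\<Sum>m'\<in>Poly_Mapping.keys f. ?g m')"
    by (rule arg_cong[OF cpoly_sum_single])
  then have "Poly_Mapping.lookup (ev (restr r var) f) m = (\<Sum>m'\<in>Poly_Mapping.keys f.
      Poly_Mapping.lookup (if Poly_Mapping.keys m' \<subseteq> {..<r} then ?g m' else 0) m)"
    by (simp add: ev_sum lookup_sum single)
  also have "\<dots> = (\<Sum>m'\<in>Poly_Mapping.keys f. if m' = m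
      then (if Poly_Mapping.keys m \<subseteq> {..<r} then Poly_Mapping.lookup f m else 0) else 0)"
    by (rule sum.cong) (auto simp: lookup_single when_def)
  finally show ?thesis by (simp add: in_keys_iff)
qed

text \<open>For a tuple with \<open>restr r z = z\<close> this is algebraic independence of the
  first \<open>r\<close> entries: a relation may involve later variables, whose values are 0, so
  only its truncation has to vanish.\<close>

definition indep :: "nat \<Rightarrow> (nat \<Rightarrow> 'a::complex_alg) \<Rightarrow> bool" where
  "indep r z \<longleftrightarrow> (\<forall>f. ev z f = 0 \<longrightarrow> ev (restr r var) f = 0)"

definition rspan :: "'a set \<Rightarrow> 'a set \<Rightarrow> 'a::comm_ring_1 set" where
  "rspan S B = {t. \<exists>s. (\<forall>b\<in>B. s b \<in> S) \<and> t = (\<Sum>b\<in>B. s b * b)}"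

lemma rspanI:
  assumes "\<And>b. b \<in> B \<Longrightarrow> s b \<in> S" "t = (\<Sum>b\<in>B. s b * b)"
  shows "t \<in> rspan S B"
  using assms by (auto simp: rspan_def)

lemma rspan_range_add:
  assumes "t \<in> rspan (range (ev z)) B" "u \<in> rspan (range (ev z)) B"
  shows "t + u \<in> rspan (range (ev z)) B"
proof -
  obtain s s' where s: "\<forall>b\<in>B. s b \<in> range (ev z)" "t = (\<Sum>b\<in>B. s b * b)"
    "\<forall>b\<in>B. s' b \<in> range (ev z)" "u = (\<Sum>b\<in>B. s' b * b)"
    using assms unfolding rspan_def by blast
  have "s b + s' b \<in> range (ev z)" if "b \<in> B" for b
  proof -
    obtain f g where "s b = ev z f" "s' b = ev z g" using s(1,3) \<open>b \<in> B\<close> by blast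
    then have "s b + s' b = ev z (f + g)" by (simp add: ev_add)
    then show ?thesis by simp
  qed
  moreover have "t + u = (\<Sum>b\<in>B. (s b + s' b) * b)"
    by (simp add: s(2,4) sum.distrib distrib_right)
  ultimately show ?thesis by (rule rspanI)
qed

lemma rspan_range_0: "0 \<in> rspan (range (ev z)) B"
  by (rule rspanI[of _ "\<lambda>_. ev z 0"]) (rule rangeI, simp)

lemma rspan_range_sum:
  assumes "\<And>i. i \<in> I \<Longrightarrow> g i \<in> rspan (range (ev z)) B"
  shows "sum g I \<in> rspan (range (ev z)) B"
  using assms
  by (induction I rule: infinite_finite_induct) (simp_all add: rspan_range_0 rspan_range_add)

lemma rspan_range_single:
  assumes "finite B" "b \<in> B"
  shows "ev z f * b \<in> rspan (range (ev z)) B"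
proof -
  define s where "s = (\<lambda>b'. if b' = b then ev z f else ev z 0)"
  have "(\<Sum>b'\<in>B. s b' * b') = (\<Sum>b'\<in>B. if b' = b then ev z f * b else 0)"
    by (rule sum.cong) (auto simp: s_def)
  also have "\<dots> = ev z f * b" using assms by simp
  finally have "ev z f * b = (\<Sum>b'\<in>B. s b' * b')" by simp
  moreover have "s b' \<in> range (ev z)" for b' by (auto simp: s_def intro: range_eqI[of _ _ 0])
  ultimately show ?thesis by (intro rspanI[of _ s]) auto
qed

section \<open>Leading coefficients, division by monic polynomials, and finite extensions\<close>

lemma coeff_mult_top:
  fixes p q :: "'a::comm_ring_1 poly"
  assumes "degree p \<le> m" "degree q \<le> n"
  shows "coeff (p * q) (m + n) = coeff p m * coeff q n"
proof -
  have "coeff (p * q) (m + n) = (\<Sum>i\<le>m + n. coeff p i * coeff q (m + n - i))"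
    by (rule coeff_mult)
  also have "\<dots> = (\<Sum>i\<le>m + n. if i = m then coeff p m * coeff q n else 0)"
  proof (rule sum.cong)
    fix i assume "i \<in> {..m + n}"
    show "coeff p i * coeff q (m + n - i) = (if i = m then coeff p m * coeff q n else 0)"
    proof (cases i m rule: linorder_cases)
      case less
      then have "degree q < m + n - i" using assms(2) by linarith
      then show ?thesis using less by (simp add: coeff_eq_0)
    next
      case greater
      then show ?thesis using assms(1) by (simp add: coeff_eq_0)
    qed simp
  qed simp
  also have "\<dots> = coeff p m * coeff q n" by simp
  finally show ?thesis .
qed

lemma coeff_linear_power:
  fixes u v :: "'a::comm_ring_1"
  shows "degree ([:u, v:] ^ n) \<le> n" and "coeff ([:u, v:] ^ n) n = v ^ n"
proof -
  have "degree ([:u, v:] ^ n) \<le> n \<and> coeff ([:u, v:] ^ n) n = v ^ n"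
  proof (induction n)
    case (Suc n)
    have "degree ([:u, v:] * [:u, v:] ^ n) \<le> 1 + n"
      by (rule order_trans[OF degree_mult_le]) (use Suc in auto)
    moreover have "coeff ([:u, v:] * [:u, v:] ^ n) (1 + n) = coeff [:u, v:] 1 * coeff ([:u, v:] ^ n) n"
      by (rule coeff_mult_top) (use Suc in auto)
    ultimately show ?case using Suc by (simp only: power_Suc) simp
  qed simp
  then show "degree ([:u, v:] ^ n) \<le> n" and "coeff ([:u, v:] ^ n) n = v ^ n" by auto
qed

lemma coeff_prod_linear_powers:
  fixes x y :: "'i \<Rightarrow> 'a::comm_ring_1" and e :: "'i \<Rightarrow> nat"
  assumes "finite A"
  shows "degree (\<Prod>i\<in>A. [:x i, y i:] ^ e i) \<le> (\<Sum>i\<in>A. e i)"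
    and "coeff (\<Prod>i\<in>A. [:x i, y i:] ^ e i) (\<Sum>i\<in>A. e i) = (\<Prod>i\<in>A. y i ^ e i)"
proof -
  have "degree (\<Prod>i\<in>A. [:x i, y i:] ^ e i) \<le> (\<Sum>i\<in>A. e i) \<and>
     coeff (\<Prod>i\<in>A. [:x i, y i:] ^ e i) (\<Sum>i\<in>A. e i) = (\<Prod>i\<in>A. y i ^ e i)"
    using assms
  proof (induction A)
    case (insert j A)
    let ?p = "[:x j, y j:] ^ e j" and ?q = "\<Prod>i\<in>A. [:x i, y i:] ^ e i"
    have "degree (?p * ?q) \<le> e j + (\<Sum>i\<in>A. e i)"
      by (rule order_trans[OF degree_mult_le add_mono]) (use insert coeff_linear_power(1) in auto)
    moreover have "coeff (?p * ?q) (e j + (\<Sum>i\<in>A. e i)) = coeff ?p (e j) * coeff ?q (\<Sum>i\<in>A. e i)"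
      by (rule coeff_mult_top) (use insert coeff_linear_power(1) in auto)
    ultimately show ?case using insert by (simp add: coeff_linear_power(2))
  qed simp
  then show "degree (\<Prod>i\<in>A. [:x i, y i:] ^ e i) \<le> (\<Sum>i\<in>A. e i)"
    and "coeff (\<Prod>i\<in>A. [:x i, y i:] ^ e i) (\<Sum>i\<in>A. e i) = (\<Prod>i\<in>A. y i ^ e i)" by auto
qed

text \<open>Pseudo-division multiplies the dividend by a power of the leading coefficient of the
  divisor, which is 1 here; no field of coefficients is required.\<close>

lemma monic_division:
  fixes f g :: "'a::idom poly"
  assumes "lead_coeff g = 1"
  obtains q r where "f = g * q + r" "r = 0 \<or> degree r < degree g"
proof -
  obtain q r where qr: "pseudo_divmod f g = (q, r)" by fastforce
  have "g \<noteq> 0" using assms by auto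
  from pseudo_divmod[OF this qr] assms that show thesis by auto
qed

lemma map_poly_pCons_hom:
  "h 0 = 0 \<Longrightarrow> map_poly h (pCons c p) = pCons (h c) (map_poly h p)"
  by (cases "c = 0 \<and> p = 0") (auto simp: map_poly_simps)

definition fin_over :: "'a set \<Rightarrow> 'a::comm_ring_1 set \<Rightarrow> bool" where
  "fin_over S T \<longleftrightarrow> (\<exists>B. finite B \<and> B \<subseteq> T \<and> T \<subseteq> rspan S B)"

text \<open>Determinant trick: the annihilator is the characteristic polynomial of multiplication by \<open>y\<close> on
  the module generators, so its degree does not depend on \<open>y\<close>.\<close>

lemma fin_over_monic_annihilator:
  fixes z a :: "nat \<Rightarrow> 'k::{field, complex_alg}"
  assumes "fin_over (range (ev z)) (range (ev a))"
  shows "\<exists>n. \<forall>y \<in> range (ev a). \<exists>q. degree q = n \<and> lead_coeff q = 1 \<and> poly (map_poly (ev z) q) y = 0"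
proof -
  obtain B where B: "finite B" "B \<subseteq> range (ev a)" "range (ev a) \<subseteq> rspan (range (ev z)) B"
    using assms unfolding fin_over_def by blast
  obtain bs where bs: "set bs = B" "distinct bs" using B(1) finite_distinct_list by blast
  define n where "n = length bs"
  have "\<exists>q. degree q = n \<and> lead_coeff q = 1 \<and> poly (map_poly (ev z) q) y = 0"
    if "y \<in> range (ev a)" for y
  proof -
    have span: "\<exists>s. t = (\<Sum>j<n. ev z (s j) * bs ! j)" if t: "t \<in> range (ev a)" for t
    proof -
      obtain s where s: "\<forall>b\<in>B. s b \<in> range (ev z)" "t = (\<Sum>b\<in>B. s b * b)"
        using B(3) t unfolding rspan_def by blast
      then have "\<forall>b\<in>B. \<exists>f. s b = ev z f" by blast
      then obtain F where F: "\<forall>b\<in>B. s b = ev z (F b)" by metis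
      have "t = (\<Sum>b\<in>set bs. ev z (F b) * b)" using s(2) F bs by simp
      also have "\<dots> = (\<Sum>j<n. ev z (F (bs ! j)) * bs ! j)"
        by (simp add: sum.distinct_set_conv_list[OF bs(2)] sum_list_sum_nth n_def atLeast0LessThan)
      finally show ?thesis by (rule exI[of _ "\<lambda>j. F (bs ! j)"])
    qed
    have "\<exists>s. y * bs ! i = (\<Sum>j<n. ev z (s j) * bs ! j)" if "i < n" for i
    proof (rule span)
      have "bs ! i \<in> range (ev a)" using that bs B(2) by (metis n_def nth_mem subsetD)
      with \<open>y \<in> range (ev a)\<close> show "y * bs ! i \<in> range (ev a)" by (auto simp flip: ev_mult)
    qed
    then obtain s where s: "\<And>i. i < n \<Longrightarrow> y * bs ! i = (\<Sum>j<n. ev z (s i j) * bs ! j)"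
      by metis
    define M where "M = mat n n (\<lambda>(i, j). s i j)"
    have M: "M \<in> carrier_mat n n" by (simp add: M_def)
    let ?M = "map_mat (ev z) M"
    let ?b = "Matrix.vec n (\<lambda>i. bs ! i)"
    \<comment> \<open>Since 1 is a combination of the generators, their vector \<open>?b\<close> is
      nonzero. Multiplication by \<open>y\<close> sends it to \<open>?M\<close> times itself, so it
      is an eigenvector for \<open>y\<close>.\<close>
    have "\<exists>t. 1 = (\<Sum>j<n. ev z (t j) * bs ! j)" by (rule span) (auto intro: range_eqI[of _ _ 1])
    then obtain t where t: "1 = (\<Sum>j<n. ev z (t j) * bs ! j)" by blast
    have "?b \<noteq> 0\<^sub>v n"
    proof
      assume "?b = 0\<^sub>v n"
      then have "bs ! j = 0" if "j < n" for j using that by (metis index_vec index_zero_vec(1))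
      with t show False by simp
    qed
    moreover have "?M *\<^sub>v ?b = y \<cdot>\<^sub>v ?b"
      by (rule eq_vecI) (auto simp: M_def scalar_prod_def s atLeast0LessThan)
    ultimately have "eigenvalue ?M y"
      unfolding eigenvalue_def eigenvector_def using M by (intro exI[of _ ?b]) auto
    then have "poly (char_poly ?M) y = 0"
      using eigenvalue_root_char_poly[of ?M n y] M by simp
    then have "poly (map_poly (ev z) (char_poly M)) y = 0"
      by (simp add: ev.char_poly_hom[OF M])
    with degree_monic_char_poly[OF M] show ?thesis by (intro exI[of _ "char_poly M"]) auto
  qed
  then show ?thesis by blast
qed

lemma ev_range_subset:
  assumes "\<And>i. x i \<in> range (ev y)"
  shows "range (ev x) \<subseteq> range (ev y)"
proof -
  have "\<forall>i. \<exists>g. x i = ev y g" using assms by blast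
  then obtain g where "\<And>i. x i = ev y (g i)" by metis
  then have "x = (\<lambda>i. ev y (g i))" by blast
  then have "ev x f = ev y (ev g f)" for f
    by (simp add: ev_ev)
  then show ?thesis by auto
qed

text \<open>Tower argument: by \<open>gen\<close>, every element is a polynomial in \<open>y\<close>
  over the smaller ring. Division by the monic \<open>p\<close> leaves degree below
  \<open>d = degree p\<close>, so the products of the old module generators with
  \<open>y ^ i\<close>, \<open>i < d\<close>, suffice.\<close>

lemma fin_over_adjoin:
  fixes z a a' :: "nat \<Rightarrow> 'a::{idom, complex_alg}"
  assumes fin: "fin_over (range (ev z)) (range (ev a'))"
    and sub: "range (ev a') \<subseteq> range (ev a)" and y: "y \<in> range (ev a)"
    and p: "lead_coeff p = 1" "poly (map_poly (ev a') p) y = 0"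
    and gen: "\<And>i. a i = poly (map_poly (ev a') (g i)) y"
  shows "fin_over (range (ev z)) (range (ev a))"
proof -
  obtain B where B: "finite B" "B \<subseteq> range (ev a')" "range (ev a') \<subseteq> rspan (range (ev z)) B"
    using fin unfolding fin_over_def by blast
  define d where "d = degree p"
  define B' where "B' = (\<lambda>(b, i). b * y ^ i) ` (B \<times> {..<d})"
  have fB': "finite B'" using B(1) by (simp add: B'_def)
  have prod: "u * v \<in> range (ev a)" if "u \<in> range (ev a)" "v \<in> range (ev a)" for u v
    using that by (auto simp flip: ev_mult)
  have yi: "y ^ i \<in> range (ev a)" for i
    using y by (auto simp flip: ev.hom_power)
  have hom: "alg_hom (\<lambda>f. poly (map_poly (ev a') f) y)"
    by (rule alg_hom_comp[OF alg_hom_poly alg_hom_map_poly[OF alg_hom_ev]])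
  have "t \<in> rspan (range (ev z)) B'" if t: "t \<in> range (ev a)" for t
  proof -
    obtain f where "t = ev a f" using t by blast
    also have "\<dots> = poly (map_poly (ev a') (ev g f)) y"
      by (simp add: alg_hom_ev_eq[OF hom] flip: gen)
    also obtain q r where qr: "ev g f = p * q + r" "r = 0 \<or> degree r < degree p"
      using monic_division[OF p(1)] by metis
    have "poly (map_poly (ev a') (ev g f)) y = poly (map_poly (ev a') r) y"
      unfolding qr(1) using p(2) by (simp only: alg_homD'[OF hom]) simp
    also have "\<dots> = (\<Sum>i<d. ev a' (coeff r i) * y ^ i)"
    proof (cases "r = 0")
      case False
      with qr have "degree r < d" by (simp add: d_def)
      then have "degree (map_poly (ev a') r) < d"
        using degree_map_poly_le[of "ev a'" r] by linarith
      then have "poly (map_poly (ev a') r) y = (\<Sum>i<d. coeff (map_poly (ev a') r) i * y ^ i)"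
        unfolding poly_altdef by (intro sum.mono_neutral_left) (auto intro!: le_degree simp: coeff_map_poly)
      then show ?thesis by (simp add: coeff_map_poly)
    qed simp
    also have "\<dots> \<in> rspan (range (ev z)) B'"
    proof (rule rspan_range_sum)
      fix i assume i: "i \<in> {..<d}"
      obtain s where s: "\<forall>b\<in>B. s b \<in> range (ev z)" "ev a' (coeff r i) = (\<Sum>b\<in>B. s b * b)"
        using B(3) unfolding rspan_def by blast
      have "ev a' (coeff r i) * y ^ i = (\<Sum>b\<in>B. s b * (b * y ^ i))"
        by (simp add: s(2) sum_distrib_right mult.assoc)
      also have "\<dots> \<in> rspan (range (ev z)) B'"
      proof (rule rspan_range_sum)
        fix b assume b: "b \<in> B"
        then obtain h where "s b = ev z h" using s(1) by blast
        moreover have "b * y ^ i \<in> B'" using b i by (auto simp: B'_def)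
        ultimately show "s b * (b * y ^ i) \<in> rspan (range (ev z)) B'"
          using rspan_range_single[OF fB'] by simp
      qed
      finally show "ev a' (coeff r i) * y ^ i \<in> rspan (range (ev z)) B'" .
    qed
    finally show ?thesis .
  qed
  moreover have "B' \<subseteq> range (ev a)"
  proof
    fix x assume "x \<in> B'"
    then obtain b i where x: "x = b * y ^ i" and b: "b \<in> B" by (auto simp: B'_def)
    have "b \<in> range (ev a)" using b B(2) sub by blast
    then show "x \<in> range (ev a)" unfolding x by (rule prod[OF _ yi])
  qed
  ultimately show ?thesis using fB' unfolding fin_over_def by blast
qed

text \<open>With \<open>d\<close> the total degree of the truncation of \<open>f\<close> and
  \<open>G\<close> its form of degree \<open>d\<close>, the substitution of \<open>x + c T\<close>
  for the variables has degree at most \<open>d\<close> in \<open>T\<close>, and its coefficient of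
  \<open>T ^ d\<close> is the constant \<open>G(c)\<close>. A point \<open>c\<close> where
  \<open>G * h\<close> is nonzero does the job; the factor \<open>h\<close> lets the caller impose
  one more open condition on the direction.\<close>

lemma generic_linear_change:
  fixes f :: "nat cpoly"
  assumes "ev (restr n var) f \<noteq> 0" "h \<noteq> 0"
  shows "\<exists>(c :: nat \<Rightarrow> complex) d e. ev c h \<noteq> 0 \<and> e \<noteq> 0 \<and>
    degree (ev (\<lambda>i. [:restr n var i, cst (restr n c i):]) f) = d \<and>
    coeff (ev (\<lambda>i. [:restr n var i, cst (restr n c i) :: nat cpoly:]) f) d = cst e"
proof -
  define g where "g = ev (restr n var) f"
  let ?K = "Poly_Mapping.keys g"
  define sz where "sz m = (\<Sum>i\<in>Poly_Mapping.keys m. Poly_Mapping.lookup m i)" for m :: "nat \<Rightarrow>\<^sub>0 nat"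
  define d where "d = Max (sz ` ?K)"
  have K: "?K \<noteq> {}" using assms(1) by (simp add: g_def)
  have dle: "sz m \<le> d" if "m \<in> ?K" for m using that by (simp add: d_def)
  have "d \<in> sz ` ?K" unfolding d_def using K by (intro Max_in) auto
  then obtain m0 where m0: "m0 \<in> ?K" "sz m0 = d" by blast
  define G where "G = (\<Sum>m\<in>{m\<in>?K. sz m = d}. Poly_Mapping.single m (Poly_Mapping.lookup g m))"
  have "Poly_Mapping.lookup G m0 = (\<Sum>m\<in>{m\<in>?K. sz m = d}. if m = m0 then Poly_Mapping.lookup g m0 else 0)"
    unfolding G_def lookup_sum by (rule sum.cong) (auto simp: lookup_single when_def)
  also have "\<dots> \<noteq> 0" using m0 by (simp add: in_keys_iff)
  finally have "G \<noteq> 0" by auto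
  with assms(2) have "G * h \<noteq> 0" by simp
  then obtain c :: "nat \<Rightarrow> complex" where "ev c (G * h) \<noteq> 0" using ex_ev_neq_0 by blast
  then have c: "ev c G \<noteq> 0" "ev c h \<noteq> 0" by (auto simp: ev_mult)
  have keys: "Poly_Mapping.keys m \<subseteq> {..<n}" if "m \<in> ?K" for m
    using that by (auto simp: g_def in_keys_iff lookup_ev_restr_var split: if_splits)
  let ?x = "\<lambda>i. [:restr n var i, cst (restr n c i) :: nat cpoly:]"
  let ?P = "ev ?x f"
  let ?m = "\<lambda>m. \<Prod>i\<in>Poly_Mapping.keys m. ?x i ^ Poly_Mapping.lookup m i"
  have "?P = ev ?x g"
  proof -
    have "restr n ?x = ?x" by (auto simp: restr_def)
    then show ?thesis by (simp add: g_def ev_restr_var)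
  qed
  then have P: "?P = (\<Sum>m\<in>?K. Polynomial.smult (cst (Poly_Mapping.lookup g m)) (?m m))"
    by (simp add: ev_def cst_poly_def)
  have deg: "degree (?m m) \<le> sz m"
    and co: "coeff (?m m) (sz m) = cst (\<Prod>i\<in>Poly_Mapping.keys m. restr n c i ^ Poly_Mapping.lookup m i)" for m
  proof -
    have "cst (\<Prod>i\<in>A. restr n c i ^ e i) = (\<Prod>i\<in>A. (cst (restr n c i) :: nat cpoly) ^ e i)"
      for A :: "nat set" and e :: "nat \<Rightarrow> nat"
      by (induction A rule: infinite_finite_induct) (simp_all add: cst_mult cst_power)
    then show "degree (?m m) \<le> sz m"
      and "coeff (?m m) (sz m) = cst (\<Prod>i\<in>Poly_Mapping.keys m. restr n c i ^ Poly_Mapping.lookup m i)"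
      unfolding sz_def by (simp_all add: coeff_prod_linear_powers)
  qed
  have "degree ?P \<le> d"
    unfolding P
  proof (rule degree_sum_le)
    fix m assume "m \<in> ?K"
    then show "degree (Polynomial.smult (cst (Poly_Mapping.lookup g m)) (?m m)) \<le> d"
      using degree_smult_le[of _ "?m m"] deg[of m] dle[of m] by (meson order_trans)
  qed simp
  moreover have "coeff ?P d = cst (ev c G)"
  proof -
    have "coeff ?P d = (\<Sum>m\<in>?K. cst (Poly_Mapping.lookup g m) * coeff (?m m) d)"
      by (simp add: P coeff_sum)
    also have "\<dots> = (\<Sum>m\<in>{m\<in>?K. sz m = d}. cst (Poly_Mapping.lookup g m) * coeff (?m m) d)"
    proof (rule sum.mono_neutral_right)
      show "\<forall>m\<in>?K - {m\<in>?K. sz m = d}. cst (Poly_Mapping.lookup g m) * coeff (?m m) d = 0"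
      proof
        fix m assume "m \<in> ?K - {m\<in>?K. sz m = d}"
        then have "degree (?m m) < d" using deg[of m] dle[of m] by auto
        then show "cst (Poly_Mapping.lookup g m) * coeff (?m m) d = 0" by (simp add: coeff_eq_0)
      qed
    qed auto
    also have "\<dots> = (\<Sum>m\<in>{m\<in>?K. sz m = d}. cst (Poly_Mapping.lookup g m *
        (\<Prod>i\<in>Poly_Mapping.keys m. c i ^ Poly_Mapping.lookup m i)))"
    proof (rule sum.cong)
      fix m assume m: "m \<in> {m\<in>?K. sz m = d}"
      then have "(\<Prod>i\<in>Poly_Mapping.keys m. restr n c i ^ Poly_Mapping.lookup m i) =
          (\<Prod>i\<in>Poly_Mapping.keys m. c i ^ Poly_Mapping.lookup m i)"
        using keys[of m] by (intro prod.cong) (auto simp: restr_def)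
      then show "cst (Poly_Mapping.lookup g m) * coeff (?m m) d = (cst (Poly_Mapping.lookup g m *
        (\<Prod>i\<in>Poly_Mapping.keys m. c i ^ Poly_Mapping.lookup m i)) :: nat cpoly)"
        using co[of m] m by (simp add: cst_mult)
    qed simp
    also have "\<dots> = cst (ev c G)"
    proof -
      have "cst (sum w A) = (\<Sum>m\<in>A. cst (w m) :: nat cpoly)" for w and A :: "(nat \<Rightarrow>\<^sub>0 nat) set"
        by (induction A rule: infinite_finite_induct) (simp_all add: cst_add)
      then show ?thesis
        unfolding G_def by (simp add: ev_sum ev_single cst_complex_def)
    qed
    finally show ?thesis .
  qed
  moreover have "ev c G \<noteq> 0" by (fact c)
  ultimately show ?thesis using c(2)
    by (intro exI[of _ c] exI[of _ d] exI[of _ "ev c G"]) (auto intro!: antisym le_degree)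
qed


lemma alg_hom_cst: "alg_hom (cst :: complex \<Rightarrow> 'a::complex_alg)"
  by (rule alg_homI) (simp_all add: cst_add cst_mult cst_complex_def)

lemma fin_over_refl: "fin_over (range (ev a)) (range (ev a))"
proof -
  have "{1} \<subseteq> range (ev a)" by (auto intro: range_eqI[of _ _ 1])
  moreover have "range (ev a) \<subseteq> rspan (range (ev a)) {1}"
    by (auto intro!: rspanI[of _ "\<lambda>_. x" for x])
  ultimately show ?thesis unfolding fin_over_def by blast
qed

text \<open>Induction on the number of generators. A relation becomes monic in a suitable multiple
  \<open>T\<close> of the last generator once the others are shifted by multiples of
  \<open>T\<close>, so the ring is finite over the one generated by the shifted tuple, which has one
  entry fewer. The normalizing elements are returned as polynomials \<open>\<zeta>\<close> in the
  generators, so that they can be evaluated at every specialization of \<open>a\<close> as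
  well.\<close>

lemma noether_normalization:
  fixes a :: "nat \<Rightarrow> 'k::{field, complex_alg}"
  assumes "restr m a = a"
  shows "\<exists>r \<zeta>. (\<forall>i\<ge>r. \<zeta> i = 0) \<and> indep r (\<lambda>i. ev a (\<zeta> i)) \<and>
    fin_over (range (ev (\<lambda>i. ev a (\<zeta> i)))) (range (ev a))"
  using assms
proof (induction m arbitrary: a)
  case (0 a)
  have a: "a = (\<lambda>_. 0)" using 0 by (simp add: restr_def fun_eq_iff)
  have "ev (restr 0 var) f = 0" if "ev a f = 0" for f
  proof (rule ccontr)
    assume "ev (restr 0 var) f \<noteq> 0"
    then obtain c :: "nat \<Rightarrow> complex" where "ev (restr 0 c) f \<noteq> 0" using ev_restr_neq_0 by blast
    then have c: "ev (\<lambda>_. 0 :: complex) f \<noteq> 0" by (simp add: restr_def)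
    have "cst (ev (\<lambda>_. 0) f) = (ev (\<lambda>_. cst 0) f :: 'k)"
      by (rule alg_hom_ev_eq[OF alg_hom_cst])
    with c that show False by (simp add: a)
  qed
  then have "indep 0 a" by (simp add: indep_def)
  then show ?case
    by (intro exI[of _ 0] exI[of _ "\<lambda>_. 0"]) (use fin_over_refl[of a] in \<open>simp add: a\<close>)
next
  case (Suc m a)
  have a0: "a i = 0" if "i \<ge> Suc m" for i
    using fun_cong[OF Suc.prems, of i] that by (simp add: restr_def)
  show ?case
  proof (cases "indep (Suc m) a")
    case True
    have "(\<lambda>i. ev a (restr (Suc m) var i)) = a"
      by (rule ext) (use a0 in \<open>simp add: restr_def\<close>)
    with True show ?thesis
      by (intro exI[of _ "Suc m"] exI[of _ "restr (Suc m) var"])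
        (simp add: fin_over_refl, simp add: restr_def)
  next
    case False
    then obtain f where f: "ev a f = 0" "ev (restr (Suc m) var) f \<noteq> 0" by (auto simp: indep_def)
    \<comment> \<open>Taking \<open>h = var m\<close> forces \<open>c m \<noteq> 0\<close>, so that
      one can divide by \<open>c m\<close>.\<close>
    have "var m \<noteq> (0 :: nat cpoly)"
      using ev_var[of "\<lambda>_. 1 :: complex" m] by (metis ev_0 zero_neq_one)
    from generic_linear_change[OF f(2) this] obtain c :: "nat \<Rightarrow> complex" and d e where
      c': "ev c (var m) \<noteq> 0" and e: "e \<noteq> 0" and
      d: "degree (ev (\<lambda>i. [:restr (Suc m) var i, cst (restr (Suc m) c i) :: nat cpoly:]) f) = d"
      "coeff (ev (\<lambda>i. [:restr (Suc m) var i, cst (restr (Suc m) c i) :: nat cpoly:]) f) d = cst e"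
      by blast
    have c: "c m \<noteq> 0" using c' by simp
    define \<kappa> where "\<kappa> = restr (Suc m) c"
    define Tp where "Tp = cst (inverse (c m)) * (var m :: nat cpoly)"
    \<comment> \<open>This scaling makes the shifted last generator
      \<open>a' m = a m - cst (c m) * T\<close> vanish.\<close>
    define T where "T = cst (inverse (c m)) * a m"
    define a' where "a' i = a i - cst (\<kappa> i) * T" for i
    define \<alpha> where "\<alpha> i = var i - cst (\<kappa> i) * Tp" for i
    have T: "T = ev a Tp" by (simp add: T_def Tp_def ev_mult)
    have a'\<alpha>: "a' = (\<lambda>i. ev a (\<alpha> i))"
      by (simp add: a'_def \<alpha>_def T ev.hom_minus ev_mult fun_eq_iff)
    have "cst (c m) * T = a m"
      using c by (simp add: T_def flip: mult.assoc cst_mult)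
    then have am: "a' m = 0" by (simp add: a'_def \<kappa>_def restr_def)
    have "a' i = 0" if "i \<ge> m" for i
      using am a0[of i] that by (cases "i = m") (simp_all add: a'_def \<kappa>_def restr_def)
    then have "restr m a' = a'" by (simp add: restr_def fun_eq_iff)
    from Suc.IH[OF this] obtain r \<zeta> where \<zeta>: "\<And>i. i \<ge> r \<Longrightarrow> \<zeta> i = 0" "indep r (\<lambda>i. ev a' (\<zeta> i))"
      "fin_over (range (ev (\<lambda>i. ev a' (\<zeta> i)))) (range (ev a'))" by blast
    have evz: "ev a (ev \<alpha> g) = ev a' g" for g by (simp add: ev_ev a'\<alpha>)
    define P where "P = ev (\<lambda>i. [:restr (Suc m) var i, cst (\<kappa> i) :: nat cpoly:]) f"
    define p where "p = Polynomial.smult (cst (inverse e)) P"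
    have Pd: "degree P = d" "coeff P d = cst e" using d by (simp_all add: P_def \<kappa>_def)
    have cn: "cst (inverse e) \<noteq> (0 :: nat cpoly)" using e by simp
    have "degree p = d" using Pd cn by (simp add: p_def)
    moreover have "coeff p d = 1" using Pd e by (simp add: p_def flip: cst_mult)
    ultimately have p1: "lead_coeff p = 1" by simp
    have hom: "alg_hom (\<lambda>f. poly (map_poly (ev a') f) T)"
      by (rule alg_hom_comp[OF alg_hom_poly alg_hom_map_poly[OF alg_hom_ev]])
    have aT: "a i = a' i + T * cst (\<kappa> i)" for i by (simp add: a'_def)
    have aT': "poly (map_poly (ev a') [:restr (Suc m) var i, cst (\<kappa> i):]) T = a i" for i
    proof -
      have "ev a' (restr (Suc m) var i) + T * cst (\<kappa> i) = a i"
        using aT[of i] a0[of i] by (cases "i < Suc m") (simp_all add: restr_def \<kappa>_def)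
      then show ?thesis by (simp add: map_poly_pCons_hom)
    qed
    have "poly (map_poly (ev a') P) T = ev a f"
      using alg_hom_ev_eq[OF hom, of "\<lambda>i. [:restr (Suc m) var i, cst (\<kappa> i):]" f] by (simp only: aT' P_def)
    then have "poly (map_poly (ev a') P) T = 0" using f(1) by simp
    moreover have "p = cst (inverse e) * P" by (simp add: p_def cst_poly_def)
    ultimately have p0: "poly (map_poly (ev a') p) T = 0"
      using alg_homD'(2)[OF hom, of "cst (inverse e)" P] by simp
    have "fin_over (range (ev (\<lambda>i. ev a' (\<zeta> i)))) (range (ev a))"
    proof (rule fin_over_adjoin[OF \<zeta>(3) _ _ p1 p0])
      show "range (ev a') \<subseteq> range (ev a)" by (rule ev_range_subset) (simp add: a'\<alpha>)
      show "T \<in> range (ev a)" by (simp add: T)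
      show "a i = poly (map_poly (ev a') [:restr (Suc m) var i, cst (\<kappa> i):]) T" for i
        by (simp only: aT')
    qed
    note fin = this
    have eq: "(\<lambda>i. ev a (ev \<alpha> (\<zeta> i))) = (\<lambda>i. ev a' (\<zeta> i))"
      by (rule ext) (rule evz)
    show ?thesis
    proof (rule exI[of _ r], rule exI[of _ "\<lambda>i. ev \<alpha> (\<zeta> i)"], intro conjI)
      show "\<forall>i\<ge>r. ev \<alpha> (\<zeta> i) = 0" using \<zeta>(1) by auto
      show "indep r (\<lambda>i. ev a (ev \<alpha> (\<zeta> i)))" unfolding eq by (rule \<zeta>(2))
      show "fin_over (range (ev (\<lambda>i. ev a (ev \<alpha> (\<zeta> i))))) (range (ev a))"
        unfolding eq by (rule fin)
    qed
  qed
qed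

subsection \<open>Hensel's lemma\<close>

text \<open>\<open>hensel_seq\<close> computes the coefficients of the powers of the uniformizer in the two factors;
  \<open>sol E\<close> is to return \<open>(g, h)\<close> with \<open>G\<^sub>0 h + H\<^sub>0 g = E\<close>.\<close>

fun hensel_seq :: "('a \<Rightarrow> 'a \<times> 'a) \<Rightarrow> (nat \<Rightarrow> 'a) \<Rightarrow> 'a \<times> 'a \<Rightarrow> nat \<Rightarrow> 'a::comm_ring_1 \<times> 'a" where
  "hensel_seq sol F GH k = (if k = 0 then GH else
     sol (F k - (\<Sum>i\<in>{1..<k}. fst (hensel_seq sol F GH i) * snd (hensel_seq sol F GH (k - i)))))"

declare hensel_seq.simps [simp del]

text \<open>Any Bezout solution can be changed so that \<open>g\<close> is reduced modulo
  \<open>G\<close>; the equation itself and the bound on \<open>degree E\<close> then limit the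
  degree of \<open>h\<close>.\<close>

lemma bezout_bounded:
  fixes G H E :: "complex poly"
  assumes "coprime G H" "degree G > 0" "degree H > 0" "degree E < degree G + degree H"
  shows "\<exists>g h. G * h + H * g = E \<and> degree g < degree G \<and> degree h < degree H"
proof -
  obtain u v where "u * G + v * H = gcd G H" using bezout_coefficients_fst_snd by blast
  with assms(1) have uv: "u * G + v * H = 1" by simp
  define g where "g = E * v mod G"
  define h where "h = E * u + H * (E * v div G)"
  have "G * h + H * g = E * (u * G) + H * (E * v div G * G + g)"
    by (simp add: h_def algebra_simps)
  also have "E * v div G * G + g = E * v" by (simp add: g_def)
  also have "E * (u * G) + H * (E * v) = E * (u * G + v * H)" by (simp add: algebra_simps)
  finally have eq: "G * h + H * g = E" by (simp add: uv)
  have "G \<noteq> 0" "H \<noteq> 0" using assms by auto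
  then have g: "degree g < degree G"
    using degree_mod_less[of G "E * v"] assms(2) by (auto simp: g_def)
  have "degree h < degree H"
  proof (cases "h = 0")
    case False
    have "degree (H * g) < degree G + degree H"
      using degree_mult_le[of H g] g by linarith
    then have "degree (E - H * g) < degree G + degree H"
      using assms(4) degree_diff_le_max[of E "H * g"] by linarith
    moreover have "E - H * g = G * h" using eq by (simp add: algebra_simps)
    ultimately show ?thesis using \<open>G \<noteq> 0\<close> False by (simp add: degree_mult_eq)
  qed (use assms in simp)
  with eq g show ?thesis by blast
qed

text \<open>Write \<open>F\<close> as a series in the uniformizer with coefficients
  \<open>f k\<close> in the polynomials over the complex numbers. Comparing coefficients gives
  \<open>G0 * h k + H0 * g k = f k - ...\<close>, where the dots involve only earlier terms;
  \<open>bezout_bounded\<close> solves this with corrections of degree below those of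
  \<open>G0\<close> and \<open>H0\<close>, so both factors stay monic of the right degree.\<close>

lemma hensel:
  fixes F :: "complex fps poly" and G0 H0 :: "complex poly"
  assumes F: "lead_coeff F = 1" and GH: "map_poly (\<lambda>a. fps_nth a 0) F = G0 * H0"
    and m: "lead_coeff G0 = 1" "lead_coeff H0 = 1" and cop: "coprime G0 H0"
    and pos: "degree G0 > 0" "degree H0 > 0"
  shows "\<exists>G H. F = G * H \<and> lead_coeff G = 1 \<and> lead_coeff H = 1 \<and>
    degree G = degree G0 \<and> degree H = degree H0"
proof -
  define p q where "p = degree G0" and "q = degree H0"
  define f where "f k = map_poly (\<lambda>a. fps_nth a k) F" for k
  have cf: "coeff (f k) j = fps_nth (coeff F j) k" for k j
    by (simp add: f_def coeff_map_poly)
  have "coeff (f 0) (degree F) = 1" using F by (simp add: cf)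
  then have "degree F \<le> degree (f 0)" by (intro le_degree) simp
  moreover have "degree (f 0) \<le> degree F" unfolding f_def by (rule degree_map_poly_le)
  moreover have "degree (f 0) = p + q"
    using GH pos m unfolding f_def p_def q_def by (metis degree_mult_eq degree_0 less_irrefl)
  ultimately have dF: "degree F = p + q" by simp
  \<comment> \<open>The leading coefficient of \<open>F\<close> is the constant series 1, hence
    contributes to \<open>f 0\<close> only. The strict bound is what makes the equation for
    \<open>g k\<close>, \<open>h k\<close> solvable.\<close>
  have df: "degree (f k) < p + q" if "k > 0" for k
  proof -
    have "coeff (f k) j = 0" if "j > p + q - 1" for j
    proof (cases "j = p + q")
      case True
      then show ?thesis using F dF \<open>k > 0\<close> by (simp add: cf)
    next
      case False
      then have "j > degree F" using that dF by simp
      then show ?thesis by (simp add: cf coeff_eq_0)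
    qed
    then have "degree (f k) \<le> p + q - 1" by (intro degree_le) auto
    then show ?thesis using pos by (simp add: p_def)
  qed
  have "\<forall>E. \<exists>gh. degree E < p + q \<longrightarrow> G0 * snd gh + H0 * fst gh = E \<and> degree (fst gh) < p \<and> degree (snd gh) < q"
    using bezout_bounded[OF cop pos] unfolding p_def q_def by (metis fst_conv snd_conv)
  then obtain sol where sol: "\<And>E. degree E < p + q \<Longrightarrow>
      G0 * snd (sol E) + H0 * fst (sol E) = E \<and> degree (fst (sol E)) < p \<and> degree (snd (sol E)) < q"
    by metis
  define g h where "g k = fst (hensel_seq sol f (G0, H0) k)" and "h k = snd (hensel_seq sol f (G0, H0) k)" for k
  have g0: "g 0 = G0" and h0: "h 0 = H0" by (simp_all add: g_def h_def hensel_seq.simps)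
  define E where "E k = f k - (\<Sum>i\<in>{1..<k}. g i * h (k - i))" for k
  have gh: "g k = fst (sol (E k))" "h k = snd (sol (E k))" if "k > 0" for k
    using that unfolding g_def h_def E_def by (subst hensel_seq.simps; simp)+
  have bound: "degree (g k) < p \<and> degree (h k) < q \<and> G0 * h k + H0 * g k = E k" if "k > 0" for k
    using that
  proof (induction k rule: less_induct)
    case (less k)
    have "degree (\<Sum>i\<in>{1..<k}. g i * h (k - i)) < p + q"
    proof (rule degree_sum_less)
      fix i assume i: "i \<in> {1..<k}"
      then have "degree (g i) < p" "degree (h (k - i)) < q" using less.IH[of i] less.IH[of "k - i"] by auto
      then show "degree (g i * h (k - i)) < p + q" using degree_mult_le[of "g i" "h (k - i)"] by linarith
    qed (use pos in \<open>simp add: p_def\<close>)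
    with df[OF less.prems] have "degree (E k) < p + q"
      unfolding E_def using degree_diff_le_max[of "f k" "\<Sum>i\<in>{1..<k}. g i * h (k - i)"] by linarith
    from sol[OF this] gh[OF less.prems] show ?case by simp
  qed
  have conv: "(\<Sum>i\<le>k. g i * h (k - i)) = f k" for k
  proof (cases "k = 0")
    case True
    then show ?thesis using GH by (simp add: g0 h0 f_def)
  next
    case False
    have "{..k} = insert 0 (insert k {1..<k})" using False by auto
    then have "(\<Sum>i\<le>k. g i * h (k - i)) = G0 * h k + (g k * H0 + (\<Sum>i\<in>{1..<k}. g i * h (k - i)))"
      using False by (simp add: g0 h0)
    also have "\<dots> = (G0 * h k + H0 * g k) + (\<Sum>i\<in>{1..<k}. g i * h (k - i))" by (simp add: algebra_simps)
    also have "\<dots> = f k" using bound[of k] False by (simp add: E_def)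
    finally show ?thesis .
  qed
  \<comment> \<open>This interchanges the two indices: a sequence of polynomials becomes a
    polynomial whose coefficients are power series.\<close>
  define lift where "lift n s = (\<Sum>j\<le>n. monom (Abs_fps (\<lambda>k. coeff (s k) j)) j)"
    for n and s :: "nat \<Rightarrow> complex poly"
  have lift: "coeff (lift n s) j = Abs_fps (\<lambda>k. coeff (s k) j)" if "\<And>k. degree (s k) \<le> n" for n s j
  proof -
    have "coeff (lift n s) j = (if j \<le> n then Abs_fps (\<lambda>k. coeff (s k) j) else 0)"
      by (simp add: lift_def coeff_sum)
    also have "\<dots> = Abs_fps (\<lambda>k. coeff (s k) j)"
      using le_less_trans[OF that] by (auto simp: fps_eq_iff coeff_eq_0)
    finally show ?thesis .
  qed
  have dg: "degree (g k) \<le> p" and dh: "degree (h k) \<le> q" for k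
    using bound[of k] by (cases "k = 0"; simp add: g0 h0 p_def q_def)+
  define G H where "G = lift p g" and "H = lift q h"
  have cG: "fps_nth (coeff G j) k = coeff (g k) j" and cH: "fps_nth (coeff H j) k = coeff (h k) j" for j k
    unfolding G_def H_def by (simp_all add: lift dg dh)
  have "F = G * H"
  proof (rule poly_eqI, rule fps_ext)
    fix j k
    have "fps_nth (coeff (G * H) j) k = (\<Sum>i\<le>j. \<Sum>l\<le>k. coeff (g l) i * coeff (h (k - l)) (j - i))"
      by (simp add: coeff_mult fps_sum_nth fps_mult_nth cG cH atLeast0AtMost)
    also have "\<dots> = (\<Sum>l\<le>k. \<Sum>i\<le>j. coeff (g l) i * coeff (h (k - l)) (j - i))"
      by (rule sum.swap)
    also have "\<dots> = coeff (\<Sum>l\<le>k. g l * h (k - l)) j"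
      by (simp add: coeff_sum coeff_mult)
    finally show "fps_nth (coeff F j) k = fps_nth (coeff (G * H) j) k"
      by (simp add: conv cf)
  qed
  moreover have "degree G = p \<and> coeff G p = 1"
  proof -
    have "coeff (g k) p = (if k = 0 then 1 else 0)" for k
      using bound[of k] m by (auto simp: g0 p_def coeff_eq_0)
    then have 1: "coeff G p = 1" by (simp add: fps_eq_iff cG)
    have "coeff G j = 0" if "j > p" for j
      using dg that by (auto simp: fps_eq_iff cG intro: coeff_eq_0 le_less_trans)
    with 1 show ?thesis by (metis antisym degree_le le_degree zero_neq_one)
  qed
  moreover have "degree H = q \<and> coeff H q = 1"
  proof -
    have "coeff (h k) q = (if k = 0 then 1 else 0)" for k
      using bound[of k] m by (auto simp: h0 q_def coeff_eq_0)
    then have 1: "coeff H q = 1" by (simp add: fps_eq_iff cH)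
    have "coeff H j = 0" if "j > q" for j
      using dh that by (auto simp: fps_eq_iff cH intro: coeff_eq_0 le_less_trans)
    with 1 show ?thesis by (metis antisym degree_le le_degree zero_neq_one)
  qed
  ultimately show ?thesis by (intro exI[of _ G] exI[of _ H]) (auto simp: p_def q_def)
qed


subsection \<open>Puiseux's theorem\<close>

text \<open>The ramified base change \<open>t \<mapsto> t ^ e\<close>. It plays the role of
  adjoining an \<open>e\<close>-th root of the uniformizer while staying in the same ring.\<close>

definition tpow :: "nat \<Rightarrow> complex fps \<Rightarrow> complex fps" where
  "tpow e a = fps_compose a (fps_X ^ e)"

lemma alg_hom_tpow: "e > 0 \<Longrightarrow> alg_hom (tpow e)"
  using alg_hom_fps_compose[of "fps_X ^ e"] by (simp add: tpow_def[abs_def])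

lemma tpow_nth:
  assumes "e > 0"
  shows "fps_nth (tpow e a) k = (if e dvd k then fps_nth a (k div e) else 0)"
proof -
  have "fps_nth (tpow e a) k = (\<Sum>i\<in>{0..k}. fps_nth a i * (if k = e * i then 1 else 0))"
    by (simp add: tpow_def fps_compose_nth fps_X_power_nth flip: power_mult)
  also have "\<dots> = (\<Sum>i\<in>{0..k}. if e dvd k \<and> i = k div e then fps_nth a i else 0)"
    using assms by (intro sum.cong) auto
  also have "\<dots> = (if e dvd k then fps_nth a (k div e) else 0)"
    by (auto simp: sum.delta)
  finally show ?thesis .
qed

lemma tpow_tpow:
  assumes "e > 0" "e' > 0"
  shows "tpow e (tpow e' a) = tpow (e * e') a"
proof (rule fps_ext)
  fix k
  show "fps_nth (tpow e (tpow e' a)) k = fps_nth (tpow (e * e') a) k"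
  proof (cases "e dvd k")
    case True
    then obtain j where "k = e * j" by blast
    then show ?thesis using assms by (simp add: tpow_nth)
  next
    case False
    then have "\<not> e * e' dvd k" using dvd_mult_left by blast
    then show ?thesis using False assms by (simp add: tpow_nth)
  qed
qed

lemma tpow_X: "e > 0 \<Longrightarrow> tpow e (fps_X ^ m) = fps_X ^ (e * m)"
  by (simp add: tpow_def fps_X_power_compose flip: power_mult)

section \<open>Splitting into linear factors, translation and scaling of roots\<close>

definition splits :: "'a::comm_ring_1 poly \<Rightarrow> bool" where
  "splits F \<longleftrightarrow> (\<exists>xs. F = (\<Prod>x\<leftarrow>xs. [:-x, 1:]))"

lemma splits_mult:
  assumes "splits F" "splits G" shows "splits (F * G)"
proof -
  obtain xs ys where "F = (\<Prod>x\<leftarrow>xs. [:-x, 1:])" "G = (\<Prod>x\<leftarrow>ys. [:-x, 1:])"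
    using assms unfolding splits_def by (elim exE)
  then have "F * G = (\<Prod>x\<leftarrow>xs @ ys. [:-x, 1:])" by simp
  then show ?thesis unfolding splits_def by (rule exI)
qed

lemma map_poly_linear_factors:
  assumes "alg_hom h"
  shows "map_poly h (\<Prod>x\<leftarrow>xs. [:-x, 1:]) = (\<Prod>x\<leftarrow>map h xs. [:-x, 1:])"
proof (induction xs)
  case Nil
  show ?case using alg_homD'(4)[OF alg_hom_map_poly[OF assms]] by simp
next
  case (Cons a xs)
  have "map_poly h [:-a, 1:] = [:- h a, 1:]"
    using alg_homD'(3,4,6)[OF assms] by (simp add: map_poly_pCons_hom)
  then show ?case
    using alg_homD'(2)[OF alg_hom_map_poly[OF assms], of "[:-a, 1:]" "\<Prod>x\<leftarrow>xs. [:-x, 1:]"]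
    by (simp only: list.map prod_list.Cons Cons.IH)
qed

lemma splits_map_poly:
  assumes "alg_hom h" "splits F"
  shows "splits (map_poly h F)"
proof -
  obtain xs where "F = (\<Prod>x\<leftarrow>xs. [:-x, 1:])" using assms(2) unfolding splits_def by (elim exE)
  then have "map_poly h F = (\<Prod>x\<leftarrow>map h xs. [:-x, 1:])"
    by (simp only: map_poly_linear_factors[OF assms(1)])
  then show ?thesis unfolding splits_def by (rule exI)
qed

lemma map_poly_tpow_tpow:
  assumes "e > 0" "e' > 0"
  shows "map_poly (tpow e) (map_poly (tpow e') F) = map_poly (tpow (e * e')) F"
proof -
  have "tpow k 0 = 0" if "k > 0" for k using alg_homD'(3)[OF alg_hom_tpow[OF that]] .
  then show ?thesis using assms by (intro poly_eqI) (simp add: coeff_map_poly tpow_tpow)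
qed

lemma pcompose_linear_factors:
  fixes b :: "'a::comm_ring_1"
  shows "pcompose (\<Prod>x\<leftarrow>xs. [:-x, 1:]) [:b, 1:] = (\<Prod>x\<leftarrow>map (\<lambda>x. x - b) xs. [:-x, 1:])"
proof (induction xs)
  case (Cons a xs)
  have "pcompose [:-a, 1:] [:b, 1:] = [:- (a - b), 1:]" by (simp add: pcompose_pCons)
  then show ?case by (simp only: list.map prod_list.Cons pcompose_mult Cons.IH)
qed (simp add: pcompose_1)

lemma splits_pcomposeD:
  fixes F :: "'a::comm_ring_1 poly"
  assumes "splits (pcompose F [:b, 1:])"
  shows "splits F"
proof -
  obtain xs where "pcompose F [:b, 1:] = (\<Prod>x\<leftarrow>xs. [:-x, 1:])"
    using assms unfolding splits_def by (elim exE)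
  then have c: "pcompose (pcompose F [:b, 1:]) [:-b, 1:] = (\<Prod>x\<leftarrow>map (\<lambda>x. x - (- b)) xs. [:-x, 1:])"
    by (simp only: pcompose_linear_factors)
  have "pcompose [:b, 1:] [:-b, 1:] = [:0, 1:]" by (simp add: pcompose_pCons)
  then have "pcompose (pcompose F [:b, 1:]) [:-b, 1:] = F"
    by (simp only: pcompose_assoc[symmetric] pcompose_idR)
  with c have "F = (\<Prod>x\<leftarrow>map (\<lambda>x. x - (- b)) xs. [:-x, 1:])" by (simp only:)
  then show ?thesis unfolding splits_def by (rule exI)
qed

text \<open>Translation by a suitable \<open>b\<close> removes the coefficient below the leading one
  (Tschirnhaus), as \<open>Suc n\<close> is invertible in the power series ring over the complex
  numbers.\<close>

lemma depressed_coeff: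
  fixes F :: "'a::idom poly"
  assumes "lead_coeff F = 1" "degree F = Suc n"
  shows "coeff (pcompose F [:-b, 1:]) n = coeff F n - of_nat (Suc n) * b"
    and "degree (pcompose F [:-b, 1:]) = Suc n" and "lead_coeff (pcompose F [:-b, 1:]) = 1"
proof -
  have "F = (\<Sum>i\<le>Suc n. monom (coeff F i) i)"
    using poly_as_sum_of_monoms[of F] assms(2) by simp
  then have "pcompose F [:-b, 1:] = (\<Sum>i\<le>Suc n. pcompose (monom (coeff F i) i) [:-b, 1:])"
    by (simp only: pcompose_sum[symmetric])
  also have "\<dots> = (\<Sum>i\<le>Suc n. Polynomial.smult (coeff F i) ([:-b, 1:] ^ i))"
    by (simp add: monom_altdef pcompose_smult pcompose_hom.hom_power pcompose_pCons)
  finally have "coeff (pcompose F [:-b, 1:]) n = (\<Sum>i\<le>Suc n. coeff F i * coeff ([:-b, 1:] ^ i) n)"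
    by (simp add: coeff_sum)
  also have "\<dots> = coeff F (Suc n) * coeff ([:-b, 1:] ^ Suc n) n + coeff F n * coeff ([:-b, 1:] ^ n) n"
  proof -
    have "coeff ([:-b, 1:] ^ i) n = 0" if "i < n" for i
      using coeff_linear_power(1)[of "-b" 1 i] that by (intro coeff_eq_0) simp
    then have "(\<Sum>i<n. coeff F i * coeff ([:-b, 1:] ^ i) n) = 0" by (intro sum.neutral) auto
    then show ?thesis by (simp add: lessThan_Suc_atMost[symmetric] del: power_Suc)
  qed
  also have "coeff ([:-b, 1:] ^ Suc n) n = of_nat (Suc n choose n) * 1 ^ n * (-b) ^ (Suc n - n)"
    by (rule coeff_linear_poly_power) simp
  also have "coeff ([:-b, 1:] ^ n) n = 1" using coeff_linear_power(2)[of "-b" 1 n] by simp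
  finally show "coeff (pcompose F [:-b, 1:]) n = coeff F n - of_nat (Suc n) * b"
    using assms(1) unfolding assms(2) by (simp add: algebra_simps)
  show "degree (pcompose F [:-b, 1:]) = Suc n" by (simp add: degree_pcompose assms)
  show "lead_coeff (pcompose F [:-b, 1:]) = 1"
    using lead_coeff_comp[of "[:-b, 1:]" F] assms(1) by simp
qed

lemma degree_linear_factors: "degree (\<Prod>x\<leftarrow>xs. [:- x, 1 :: 'a::idom:]) = length xs"
  and monic_linear_factors: "lead_coeff (\<Prod>x\<leftarrow>xs. [:- x, 1 :: 'a::idom:]) = 1"
proof -
  have "degree (\<Prod>x\<leftarrow>xs. [:- x, 1 :: 'a:]) = length xs \<and> lead_coeff (\<Prod>x\<leftarrow>xs. [:- x, 1 :: 'a:]) = 1"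
  proof (induction xs)
    case (Cons a xs)
    let ?P = "\<Prod>x\<leftarrow>xs. [:- x, 1 :: 'a:]"
    have "?P \<noteq> 0" using Cons by auto
    then have "degree ([:-a, 1:] * ?P) = Suc (length xs)"
      using Cons by (subst degree_mult_eq) auto
    moreover have "lead_coeff ([:-a, 1:] * ?P) = 1"
      using Cons by (subst lead_coeff_mult) auto
    ultimately show ?case
      by (simp only: list.map prod_list.Cons list.size add_0_right add_Suc_right simp_thms)
  qed simp
  then show "degree (\<Prod>x\<leftarrow>xs. [:- x, 1 :: 'a:]) = length xs"
    and "lead_coeff (\<Prod>x\<leftarrow>xs. [:- x, 1 :: 'a:]) = 1" by auto
qed

lemma pcompose_scale_linear_factors:
  fixes u :: "'a::comm_ring_1"
  shows "pcompose (\<Prod>x\<leftarrow>map (\<lambda>x. u * x) xs. [:-x, 1:]) [:0, u:] =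
    Polynomial.smult (u ^ length xs) (\<Prod>x\<leftarrow>xs. [:-x, 1:])"
proof (induction xs)
  case (Cons a xs)
  have "pcompose [:- (u * a), 1:] [:0, u:] = Polynomial.smult u [:-a, 1:]" by (simp add: pcompose_pCons)
  then show ?case
    by (simp only: list.map prod_list.Cons pcompose_mult Cons.IH list.size power_Suc
        mult_smult_left mult_smult_right smult_smult add_0_right add_Suc_right) (simp only: mult.commute)
qed (simp add: pcompose_1)

text \<open>The coefficient condition says \<open>F(u T) = u ^ d * F'(T)\<close>, so the roots of
  \<open>F\<close> are the roots of \<open>F'\<close> multiplied by \<open>u\<close>.\<close>

lemma splits_rescale:
  fixes u :: "'a::idom"
  assumes "u \<noteq> 0" "splits F'" "degree F' = d"
    and "\<And>j. j \<le> d \<Longrightarrow> coeff F j = u ^ (d - j) * coeff F' j" "degree F \<le> d"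
  shows "splits F"
proof -
  obtain xs where xs: "F' = (\<Prod>x\<leftarrow>xs. [:-x, 1:])" using assms(2) unfolding splits_def by (elim exE)
  have len: "length xs = d" using assms(3) unfolding xs degree_linear_factors .
  define Q where "Q = (\<Prod>x\<leftarrow>map (\<lambda>x. u * x) xs. [:-x, 1:])"
  have Q: "pcompose Q [:0, u:] = Polynomial.smult (u ^ d) F'"
    unfolding Q_def xs pcompose_scale_linear_factors len ..
  have "degree Q = d" unfolding Q_def degree_linear_factors by (simp add: len)
  have "F = Q"
  proof (rule poly_eqI)
    fix j
    show "coeff F j = coeff Q j"
    proof (cases "j \<le> d")
      case True
      have "u ^ j * coeff Q j = u ^ d * coeff F' j"
        using arg_cong[OF Q, of "\<lambda>p. coeff p j"] by (simp add: coeff_pcompose_linear)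
      also have "u ^ d = u ^ j * u ^ (d - j)" using True by (simp flip: power_add)
      finally have "u ^ j * coeff Q j = u ^ j * coeff F j" using assms(4)[OF True] by simp
      then show ?thesis using assms(1) by simp
    next
      case False
      then show ?thesis using \<open>degree Q = d\<close> assms(5) by (simp add: coeff_eq_0)
    qed
  qed
  then show ?thesis unfolding splits_def Q_def by (rule exI)
qed


lemma monic_degreeI:
  assumes "coeff P d = (1 :: 'a::comm_ring_1)" "degree P \<le> d"
  shows "degree P = d \<and> lead_coeff P = 1"
  using assms le_degree[of P d] by (metis antisym zero_neq_one)

text \<open>The least slope of the Newton polygon is the minimum of
  \<open>ord (coeff F j) / (d - j)\<close> with \<open>d = Suc n\<close>. After ramification of
  order \<open>fact d\<close> it is an integer \<open>m\<close>. Replacing the variable by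
  \<open>fps_X ^ m\<close> times itself and dividing by \<open>fps_X ^ (m * d)\<close> keeps all
  coefficients integral, and a coefficient where the minimum is attained acquires a nonzero constant
  term.\<close>

lemma newton_step:
  fixes F :: "complex fps poly"
  assumes F: "lead_coeff F = 1" "degree F = Suc n" "coeff F n = 0"
    and nz: "\<exists>j\<le>n. coeff F j \<noteq> 0"
  shows "\<exists>m F'. degree F' = Suc n \<and> lead_coeff F' = 1 \<and> coeff F' n = 0 \<and>
    (\<exists>j\<le>n. fps_nth (coeff F' j) 0 \<noteq> 0) \<and>
    (\<forall>j\<le>Suc n. coeff (map_poly (tpow (fact (Suc n))) F) j = fps_X ^ (m * (Suc n - j)) * coeff F' j)"
proof -
  define d where "d = Suc n"
  define N :: nat where "N = fact d"
  have N: "N > 0" by (simp add: N_def)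
  have dv: "(d - j) dvd N" if "j \<le> n" for j
    unfolding N_def using that by (intro dvd_fact) (auto simp: d_def)
  define J where "J = {j. j \<le> n \<and> coeff F j \<noteq> 0}"
  have J: "finite J" "J \<noteq> {}" using nz by (auto simp: J_def)
  \<comment> \<open>The slope at \<open>j\<close> after ramification; the division is exact because
    \<open>d - j\<close> divides \<open>fact d\<close>.\<close>
  define \<mu> where "\<mu> j = N div (d - j) * subdegree (coeff F j)" for j
  define m where "m = Min (\<mu> ` J)"
  have "m \<in> \<mu> ` J" unfolding m_def using J by (intro Min_in) auto
  then obtain j0 where j0: "j0 \<in> J" "\<mu> j0 = m" by blast
  have mu: "\<mu> j * (d - j) = N * subdegree (coeff F j)" if "j \<le> n" for j
    using dv[OF that] by (simp add: \<mu>_def mult_ac)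
  define b where "b j = (if j = d then 1 else fps_shift (m * (d - j)) (tpow N (coeff F j)))" for j
  have eq: "tpow N (coeff F j) = fps_X ^ (m * (d - j)) * b j" if "j \<le> d" for j
  proof (cases "j = d")
    case True
    then show ?thesis using F alg_homD'(4)[OF alg_hom_tpow[OF N]] by (simp add: b_def d_def)
  next
    case False
    with that have jn: "j \<le> n" by (simp add: d_def)
    have low: "fps_nth (tpow N (coeff F j)) i = 0" if i: "i < m * (d - j)" for i
    proof (cases "coeff F j = 0 \<or> \<not> N dvd i")
      case True
      then show ?thesis by (auto simp: tpow_nth[OF N])
    next
      case False
      then have "j \<in> J" using jn by (simp add: J_def)
      then have "m \<le> \<mu> j" unfolding m_def using J by simp
      then have "m * (d - j) \<le> N * subdegree (coeff F j)" using mu[OF jn] by (metis mult_le_mono1)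
      then have "i < N * subdegree (coeff F j)" using i by linarith
      moreover obtain l where "i = N * l" using False by blast
      ultimately have "i div N < subdegree (coeff F j)" using N by simp
      then have "fps_nth (coeff F j) (i div N) = 0" by (rule nth_less_subdegree_zero)
      then show ?thesis by (simp only: tpow_nth[OF N] if_cancel)
    qed
    show ?thesis
      by (rule fps_ext) (use False low in \<open>auto simp: b_def fps_X_power_mult_nth\<close>)
  qed
  define F' where "F' = (\<Sum>j\<le>d. monom (b j) j)"
  have cF': "coeff F' j = (if j \<le> d then b j else 0)" for j
    by (simp add: F'_def coeff_sum)
  have "coeff F' d = 1" by (simp add: cF' b_def)
  moreover have "degree F' \<le> d" by (rule degree_le) (simp add: cF')
  ultimately have dF': "degree F' = d" "lead_coeff F' = 1" using monic_degreeI[of F' d] by auto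
  have t0: "tpow N 0 = 0" using alg_homD'(3)[OF alg_hom_tpow[OF N]] .
  have "coeff F' n = 0" using F(3) t0 by (simp add: cF' b_def d_def)
  moreover have "fps_nth (coeff F' j0) 0 \<noteq> 0"
  proof -
    have jn: "j0 \<le> n" and "coeff F j0 \<noteq> 0" using j0(1) by (auto simp: J_def)
    have "m * (d - j0) = N * subdegree (coeff F j0)" using mu[OF jn] j0(2) by simp
    moreover have "fps_nth (coeff F j0) (subdegree (coeff F j0)) \<noteq> 0"
      using \<open>coeff F j0 \<noteq> 0\<close> by (rule nth_subdegree_nonzero)
    ultimately show ?thesis using jn N by (simp add: cF' b_def d_def tpow_nth)
  qed
  moreover have "j0 \<le> n" using j0 by (simp add: J_def)
  moreover have "coeff (map_poly (tpow N) F) j = fps_X ^ (m * (d - j)) * coeff F' j" if "j \<le> d" for j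
    using eq[OF that] that t0 by (simp add: coeff_map_poly cF')
  ultimately show ?thesis using dF' unfolding d_def N_def by blast
qed

text \<open>Split off the full power of one root. If nothing remained, \<open>P\<close> would be a
  power of \<open>T - c\<close>, whose coefficient of \<open>T ^ n\<close> is
  \<open>- (n + 1) * c\<close>; as this vanishes, \<open>c = 0\<close> and all lower coefficients
  are zero, contrary to assumption.\<close>

lemma monic_not_pure_power_factors:
  fixes P :: "complex poly"
  assumes "lead_coeff P = 1" "degree P = Suc n" "coeff P n = 0" "\<exists>j\<le>n. coeff P j \<noteq> 0"
  shows "\<exists>G H. P = G * H \<and> lead_coeff G = 1 \<and> lead_coeff H = 1 \<and> coprime G H \<and> degree G > 0 \<and> degree H > 0"
proof -
  have "\<not> constant (poly P)" using assms(2) by (simp add: constant_degree)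
  then obtain c where c: "poly P c = 0" using fundamental_theorem_of_algebra by blast
  have "P \<noteq> 0" using assms by auto
  from order_decomp[OF this, of c] obtain H where H: "P = [:- c, 1:] ^ order c P * H" "\<not> [:- c, 1:] dvd H" by blast
  define k where "k = order c P"
  define G where "G = [:- c, 1:] ^ k"
  have k: "k > 0" using c \<open>P \<noteq> 0\<close> by (simp add: k_def order_root)
  have G: "degree G = k \<and> lead_coeff G = 1" unfolding G_def
    using coeff_linear_power[of "-c" 1 k] by (intro monic_degreeI) auto
  have P: "P = G * H" using H(1) by (simp add: G_def k_def)
  then have lH: "lead_coeff H = 1" using assms(1) G by (metis lead_coeff_mult mult_1)
  have "degree H > 0"
  proof (rule ccontr)
    assume "\<not> degree H > 0"
    then have "H = 1" using lH by (auto elim!: degree_eq_zeroE)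
    then have PG: "P = [:- c, 1:] ^ Suc n" using P G assms(2) by (simp add: G_def)
    have "coeff ([:- c, 1:] ^ Suc n) n = of_nat (Suc n choose n) * 1 ^ n * (- c) ^ (Suc n - n)"
      by (rule coeff_linear_poly_power) simp
    then have "of_nat (Suc n) * c = 0" using assms(3) PG by simp
    then have "c = 0" by (metis mult_eq_0_iff of_nat_eq_0_iff nat.distinct(1))
    then have "P = monom 1 (Suc n)" using PG by (simp add: monom_altdef)
    with assms(4) show False by auto
  qed
  moreover have "coprime G H"
  proof -
    have "prime_elem [:- c, 1:]" by (rule prime_elem_linear_field_poly) simp
    then have "coprime [:- c, 1:] H" using H(2) by (rule prime_elem_imp_coprime)
    then show ?thesis by (simp add: G_def)
  qed
  ultimately show ?thesis using P G k lH by blast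
qed

text \<open>The product of the exponents for the single degrees serves, because splitting survives
  further ramification.\<close>

lemma common_exponent:
  assumes "\<And>k. k < d \<Longrightarrow> \<exists>e>0. \<forall>F. lead_coeff F = 1 \<and> degree F = k \<longrightarrow> splits (map_poly (tpow e) F)"
  shows "\<exists>e>0. \<forall>F. lead_coeff F = 1 \<and> degree F < d \<longrightarrow> splits (map_poly (tpow e) F)"
proof -
  from assms obtain e where e: "\<And>k. k < d \<Longrightarrow> e k > 0"
    "\<And>k F. k < d \<Longrightarrow> lead_coeff F = 1 \<Longrightarrow> degree F = k \<Longrightarrow> splits (map_poly (tpow (e k)) F)"
    by metis
  define E where "E = (\<Prod>k<d. e k)"
  have E: "E > 0" unfolding E_def using e(1) by (intro prod_pos) auto
  have "splits (map_poly (tpow E) F)" if "degree F < d" "lead_coeff F = 1" for F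
  proof -
    have "E = (\<Prod>k\<in>{..<d} - {degree F}. e k) * e (degree F)"
      unfolding E_def using that by (subst prod.remove[of _ "degree F"]) auto
    moreover from this have "(\<Prod>k\<in>{..<d} - {degree F}. e k) > 0" using E by (metis gr0I mult_0)
    ultimately show ?thesis
      using splits_map_poly[OF alg_hom_tpow e(2)[of "degree F" F]] that e(1)[of "degree F"]
      by (simp add: map_poly_tpow_tpow)
  qed
  with E show ?thesis by blast
qed

text \<open>The exponent is uniform over all \<open>F\<close> of the given degree, which the final
  bound depends on. After translation, a Newton step makes the reduction at 0 a product of two
  coprime factors. Hensel's lemma lifts them to factors of smaller degree, which split after the
  exponent \<open>E\<close> of the induction; together with \<open>N = fact d\<close> from the
  Newton step this gives \<open>E * N\<close>.\<close>

theorem puiseux: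
  "\<exists>e>0. \<forall>F. lead_coeff F = 1 \<and> degree F = d \<longrightarrow> splits (map_poly (tpow e) F)"
proof (induction d rule: less_induct)
  case (less d)
  show ?case
  proof (cases d)
    case 0
    have "splits (map_poly (tpow 1) F)" if "lead_coeff F = 1 \<and> degree F = 0" for F
    proof -
      have "F = 1" using that by (auto elim!: degree_eq_zeroE)
      moreover have "splits (1 :: complex fps poly)" unfolding splits_def by (rule exI[of _ "[]"]) simp
      ultimately show ?thesis using alg_homD'(4)[OF alg_hom_map_poly[OF alg_hom_tpow[of 1]]] by simp
    qed
    with 0 show ?thesis by (intro exI[of _ 1]) auto
  next
    case (Suc n)
    obtain E where E: "E > 0" and splE: "\<And>F. lead_coeff F = 1 \<Longrightarrow> degree F < d \<Longrightarrow> splits (map_poly (tpow E) F)"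
      using common_exponent[of d] less.IH by metis
    define N :: nat where "N = fact d"
    have N: "N > 0" by (simp add: N_def)
    have depressed: "splits (map_poly (tpow (E * N)) F)"
      if F: "lead_coeff F = 1" "degree F = d" "coeff F n = 0" for F
    proof (cases "\<exists>j\<le>n. coeff F j \<noteq> 0")
      case False
      have "F = monom 1 d"
      proof (rule poly_eqI)
        fix j
        show "coeff F j = coeff (monom 1 d) j"
          using False F Suc by (cases j d rule: linorder_cases) (auto simp: coeff_eq_0)
      qed
      then have "F = (\<Prod>x\<leftarrow>replicate d 0. [:-x, 1:])" by (simp add: monom_altdef)
      then have "splits F" unfolding splits_def by (rule exI)
      then show ?thesis using alg_hom_tpow[of "E * N"] E N by (intro splits_map_poly) auto
    next
      case True
      from newton_step[OF F(1) F(2)[unfolded Suc] F(3) True] obtain m F' where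
        F': "degree F' = d" "lead_coeff F' = 1" "coeff F' n = 0" "\<exists>j\<le>n. fps_nth (coeff F' j) 0 \<noteq> 0"
        and cF: "\<And>j. j \<le> d \<Longrightarrow> coeff (map_poly (tpow N) F) j = fps_X ^ (m * (d - j)) * coeff F' j"
        unfolding Suc[symmetric] N_def by blast
      define P where "P = map_poly (\<lambda>a. fps_nth a 0) F'"
      have cP: "coeff P j = fps_nth (coeff F' j) 0" for j by (simp add: P_def coeff_map_poly)
      have "coeff P d = 1" using F'(1,2) by (simp add: cP)
      moreover have "degree P \<le> d" unfolding P_def using degree_map_poly_le F'(1) by metis
      ultimately have P: "degree P = d" "lead_coeff P = 1" using monic_degreeI[of P d] by auto
      obtain G0 H0 where GH0: "P = G0 * H0" "lead_coeff G0 = 1" "lead_coeff H0 = 1" "coprime G0 H0"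
        "degree G0 > 0" "degree H0 > 0"
        using monic_not_pure_power_factors[of P n] P Suc F'(3,4) by (auto simp: cP)
      from hensel[OF F'(2) GH0(1)[unfolded P_def] GH0(2-6)] obtain G H where
        GH: "F' = G * H" "lead_coeff G = 1" "lead_coeff H = 1" "degree G = degree G0" "degree H = degree H0" by blast
      have "degree P = degree G0 + degree H0" unfolding GH0(1) using GH0(5,6) by (intro degree_mult_eq) auto
      with P(1) GH(4,5) GH0(5,6) have "degree G < d" "degree H < d" by auto
      then have "splits (map_poly (tpow E) G * map_poly (tpow E) H)"
        using splE GH by (intro splits_mult) auto
      then have sF': "splits (map_poly (tpow E) F')"
        using alg_homD'(2)[OF alg_hom_map_poly[OF alg_hom_tpow[OF E]]] by (simp add: GH(1))
      have t: "tpow E 0 = 0" "tpow E 1 = 1" using alg_homD'(3,4)[OF alg_hom_tpow[OF E]] .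
      show ?thesis
      proof (rule splits_rescale[OF _ sF'])
        show "fps_X ^ (E * m) \<noteq> (0 :: complex fps)" by simp
        have "coeff (map_poly (tpow E) F') d = 1" using F' t by (simp add: coeff_map_poly)
        then show "degree (map_poly (tpow E) F') = d"
          using degree_map_poly_le[of "tpow E" F'] F'(1) monic_degreeI by metis
        show "degree (map_poly (tpow (E * N)) F) \<le> d" using degree_map_poly_le F(2) by metis
        fix j assume j: "j \<le> d"
        have "coeff (map_poly (tpow (E * N)) F) j = tpow E (coeff (map_poly (tpow N) F) j)"
          using map_poly_tpow_tpow[OF E N, of F] t by (simp add: coeff_map_poly flip: map_poly_tpow_tpow[OF E N])
        also have "\<dots> = tpow E (fps_X ^ (m * (d - j))) * tpow E (coeff F' j)"
          by (simp only: cF[OF j] alg_homD'(2)[OF alg_hom_tpow[OF E]])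
        finally show "coeff (map_poly (tpow (E * N)) F) j =
            (fps_X ^ (E * m)) ^ (d - j) * coeff (map_poly (tpow E) F') j"
          using t by (simp add: coeff_map_poly tpow_X[OF E] mult_ac flip: power_mult)
      qed
    qed
    have "splits (map_poly (tpow (E * N)) F)" if F: "lead_coeff F = 1 \<and> degree F = d" for F
    proof -
      define b where "b = fps_const (1 / of_nat (Suc n)) * coeff F n"
      have "of_nat (Suc n) * fps_const (1 / of_nat (Suc n) :: complex) = 1"
        by (simp only: fps_of_nat[symmetric] fps_const_mult) (simp del: of_nat_Suc)
      then have b: "of_nat (Suc n) * b = coeff F n" by (simp only: b_def mult.assoc[symmetric]) simp
      have "splits (map_poly (tpow (E * N)) (pcompose F [:-b, 1:]))"
        using F Suc depressed_coeff[of F n b] b by (intro depressed) auto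
      moreover have "map_poly (tpow (E * N)) (pcompose F [:-b, 1:]) =
          pcompose (map_poly (tpow (E * N)) F) (map_poly (tpow (E * N)) [:-b, 1:])"
      proof -
        interpret comm_ring_hom "tpow (E * N)" using alg_homD(1)[OF alg_hom_tpow] E N by simp
        show ?thesis by (rule map_poly_pcompose)
      qed
      moreover have "map_poly (tpow (E * N)) [:-b, 1:] = [:- tpow (E * N) b, 1:]"
        using alg_homD'(3,4,6)[OF alg_hom_tpow[of "E * N"]] E N by (simp add: map_poly_pCons_hom)
      ultimately show ?thesis using splits_pcomposeD by metis
    qed
    then show ?thesis using E N by (intro exI[of _ "E * N"]) auto
  qed
qed

subsection \<open>Specializations\<close>

text \<open>Specialization in the sense of Weil: \<open>\<alpha> \<mapsto> \<beta>\<close> extends to an algebra homomorphism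
  \<open>\<complex>[\<alpha>] \<rightarrow> \<complex>[\<beta>]\<close>. Points and arcs of an affine variety are the specializations of its generic point.\<close>

definition spec :: "(nat \<Rightarrow> 'a::complex_alg) \<Rightarrow> (nat \<Rightarrow> 'b::complex_alg) \<Rightarrow> bool" where
  "spec \<alpha> \<beta> \<longleftrightarrow> (\<forall>f. ev \<alpha> f = 0 \<longrightarrow> ev \<beta> f = 0)"

lemma map_poly_ev_hom: "alg_hom (\<lambda>f. poly (map_poly (ev \<alpha>) f) y)"
  by (rule alg_hom_comp[OF alg_hom_poly alg_hom_map_poly[OF alg_hom_ev]])

text \<open>Singles out variable \<open>n\<close> as a polynomial indeterminate. The coefficients no
  longer contain it, so the old value \<open>x n\<close> has no influence.\<close>

lemma poly_ev_fun_upd: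
  fixes x :: "nat \<Rightarrow> 'a::complex_alg"
  shows "poly (map_poly (ev x) (ev (\<lambda>i. if i = n then [:0, 1:] else [:var i:]) f)) t = ev (x(n := t)) f"
proof -
  have eq: "(\<lambda>i. poly (map_poly (ev x) (if i = n then [:0, 1:] else [:var i:])) t) = x(n := t)"
    by (rule ext) (simp add: map_poly_pCons_hom)
  show ?thesis
    using alg_hom_ev_eq[OF map_poly_ev_hom[of x t], of "\<lambda>i. if i = n then [:0, 1:] else [:var i:]" f]
    unfolding eq .
qed

lemma spec_fun_upd:
  assumes "\<And>f. poly (map_poly (ev \<alpha>) f) y = 0 \<Longrightarrow> poly (map_poly (ev \<beta>) f) \<eta> = 0"
  shows "spec (\<alpha>(n := y)) (\<beta>(n := \<eta>))"
  unfolding spec_def poly_ev_fun_upd[symmetric] using assms by blast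

text \<open>A root of \<open>f * V\<close> that is not a root of \<open>f\<close> is a root of
  \<open>V\<close>. Removing one factor at a time takes care of multiplicities.\<close>

lemma linear_factors_dvd_cancel:
  fixes f V :: "'a::idom poly"
  assumes "(\<Prod>x\<leftarrow>xs. [:-x, 1:]) dvd f * V" "\<And>x. x \<in> set xs \<Longrightarrow> poly f x \<noteq> 0"
  shows "(\<Prod>x\<leftarrow>xs. [:-x, 1:]) dvd V"
  using assms
proof (induction xs arbitrary: V)
  case (Cons x xs)
  let ?P = "\<Prod>x\<leftarrow>xs. [:-x, 1:]"
  have d: "[:-x, 1:] * ?P dvd f * V" using Cons.prems(1) by (simp only: list.map prod_list.Cons)
  then have "[:-x, 1:] dvd f * V" by (rule dvd_mult_left)
  then have "poly (f * V) x = 0" by (simp only: poly_eq_0_iff_dvd)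
  with Cons.prems(2)[of x] have "poly V x = 0" by simp
  then obtain V' where V': "V = [:-x, 1:] * V'" by (auto simp only: poly_eq_0_iff_dvd elim: dvdE)
  have "[:-x, 1:] * ?P dvd [:-x, 1:] * (f * V')" using d unfolding V' by (simp only: mult_ac)
  then have "?P dvd f * V'" by (subst (asm) dvd_mult_cancel_left) simp
  with Cons.IH[of V'] Cons.prems(2) have "?P dvd V'" by simp
  then show ?case unfolding V' list.map prod_list.Cons by (rule mult_dvd_mono[OF dvd_refl])
qed simp

text \<open>The matrix \<open>M\<close> of multiplication by \<open>f\<close> modulo \<open>q\<close> becomes singular under \<open>\<alpha>\<close>, hence under \<open>\<beta>\<close>;
  a kernel vector there is a polynomial \<open>V\<close> of degree less than that of \<open>q\<close> with \<open>q dvd f * V\<close>.\<close>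

lemma extend_spec_single:
  fixes \<alpha> :: "nat \<Rightarrow> 'k::{idom, complex_alg}" and \<beta> :: "nat \<Rightarrow> 'b::{idom, complex_alg}"
  assumes sp: "spec \<alpha> \<beta>"
    and q: "lead_coeff q = 1" "poly (map_poly (ev \<alpha>) q) y = 0"
    and xs: "map_poly (ev \<beta>) q = (\<Prod>x\<leftarrow>xs. [:-x, 1:])"
    and f: "poly (map_poly (ev \<alpha>) f) y = 0"
  shows "\<exists>x\<in>set xs. poly (map_poly (ev \<beta>) f) x = 0"
proof (rule ccontr)
  assume "\<not> ?thesis"
  then have nz: "\<And>x. x \<in> set xs \<Longrightarrow> poly (map_poly (ev \<beta>) f) x \<noteq> 0" by blast
  define n where "n = degree q"
  have "\<exists>r s. f * monom 1 i = q * s + r \<and> (r = 0 \<or> degree r < n)" for i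
    using monic_division[OF q(1)] unfolding n_def by metis
  then obtain r s where rs: "\<And>i. f * monom 1 i = q * s i + r i" "\<And>i. r i = 0 \<or> degree (r i) < n" by metis
  have n: "n > 0"
  proof (rule ccontr)
    assume "\<not> n > 0"
    then have "q = 1" using q(1) by (auto simp: n_def elim!: degree_eq_zeroE)
    with q(2) alg_homD'(4)[OF map_poly_ev_hom] show False by simp
  qed
  have cr: "coeff (r i) j = 0" if "j \<ge> n" for i j
    using rs(2)[of i] that by (auto simp: coeff_eq_0)
  have sumr: "map_poly (ev x) (r i) = (\<Sum>j<n. monom (ev x (coeff (r i) j)) j)"
    for x :: "nat \<Rightarrow> 'c::complex_alg" and i
    by (rule poly_eqI) (auto simp: coeff_sum coeff_map_poly cr not_less)
  define M where "M = mat n n (\<lambda>(i, j). coeff (r i) j)"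
  have M: "M \<in> carrier_mat n n" by (simp add: M_def)
  have "det (map_mat (ev \<alpha>) M) = 0"
  proof -
    \<comment> \<open>Every remainder \<open>r i\<close> vanishes at \<open>y\<close>, since
      \<open>f\<close> and \<open>q\<close> do; so the powers of \<open>y\<close> form a kernel
      vector, nonzero because its entry at 0 is 1.\<close>
    let ?v = "Matrix.vec n (\<lambda>j. y ^ j)"
    have "(\<Sum>j<n. ev \<alpha> (coeff (r i) j) * y ^ j) = 0" for i
    proof -
      have "poly (map_poly (ev \<alpha>) (r i)) y = poly (map_poly (ev \<alpha>) (f * monom 1 i - q * s i)) y"
        using rs(1)[of i] by simp
      also have "\<dots> = 0"
        using f q(2) by (simp only: alg_homD'[OF map_poly_ev_hom]) simp
      finally show ?thesis by (simp add: sumr poly_sum poly_monom)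
    qed
    then have "map_mat (ev \<alpha>) M *\<^sub>v ?v = 0\<^sub>v n"
      by (intro eq_vecI) (auto simp: M_def scalar_prod_def atLeast0LessThan)
    moreover have "?v \<noteq> 0\<^sub>v n"
    proof
      assume "?v = 0\<^sub>v n"
      then have "vec_index ?v 0 = vec_index (0\<^sub>v n) 0" by simp
      with n show False by simp
    qed
    moreover have "?v \<in> carrier_vec n" by simp
    moreover have A: "map_mat (ev \<alpha>) M \<in> carrier_mat n n" using M by simp
    ultimately show ?thesis
      unfolding det_0_iff_vec_prod_zero[OF A] by (intro exI[of _ ?v] conjI)
  qed
  then have "ev \<alpha> (det M) = 0" by simp
  with sp have "ev \<beta> (det M) = 0" by (simp add: spec_def)
  then have "det (transpose_mat (map_mat (ev \<beta>) M)) = 0"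
    using M by (subst det_transpose[of _ n]) auto
  \<comment> \<open>A kernel vector of the transpose is a linear dependence between the rows, that
    is, between the remainders of the \<open>f * monom 1 i\<close>. Its entries are the coefficients
    of \<open>V\<close>.\<close>
  then obtain v where v: "v \<in> carrier_vec n" "v \<noteq> 0\<^sub>v n"
    "transpose_mat (map_mat (ev \<beta>) M) *\<^sub>v v = 0\<^sub>v n"
    using det_0_iff_vec_prod_zero[of "transpose_mat (map_mat (ev \<beta>) M)" n] M by auto
  have v0: "(\<Sum>i<n. vec_index v i * ev \<beta> (coeff (r i) j)) = 0" if "j < n" for j
  proof -
    have "vec_index (transpose_mat (map_mat (ev \<beta>) M) *\<^sub>v v) j = (\<Sum>i<n. vec_index v i * ev \<beta> (coeff (r i) j))"
      using that v(1) by (simp add: M_def scalar_prod_def atLeast0LessThan mult.commute)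
    with v(3) that show ?thesis by simp
  qed
  define V where "V = (\<Sum>i<n. monom (vec_index v i) i)"
  have cV: "coeff V i = (if i < n then vec_index v i else 0)" for i
    by (simp add: V_def coeff_sum)
  have "V \<noteq> 0"
  proof
    assume "V = 0"
    then have "vec_index v i = 0" if "i < n" for i using cV[of i] that by simp
    then have "v = 0\<^sub>v n" using v(1) by (intro eq_vecI) auto
    with v(2) show False by simp
  qed
  let ?h = "map_poly (ev \<beta>)"
  have hom: "alg_hom ?h" by (rule alg_hom_map_poly[OF alg_hom_ev])
  have "?h f * V = (\<Sum>i<n. [:vec_index v i:] * ?h (f * monom 1 i))"
    unfolding V_def sum_distrib_left
    by (intro sum.cong) (simp_all add: alg_homD'[OF hom] map_poly_monom smult_monom mult_smult_right[symmetric])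
  also have "\<dots> = (\<Sum>i<n. [:vec_index v i:] * (?h q * ?h (s i) + ?h (r i)))"
    by (simp only: rs(1) alg_homD'[OF hom])
  also have "\<dots> = ?h q * (\<Sum>i<n. [:vec_index v i:] * ?h (s i)) + (\<Sum>i<n. [:vec_index v i:] * ?h (r i))"
    by (simp add: sum_distrib_left algebra_simps sum.distrib)
  also have "(\<Sum>i<n. [:vec_index v i:] * ?h (r i)) = 0"
  proof (rule poly_eqI)
    fix j
    show "coeff (\<Sum>i<n. [:vec_index v i:] * ?h (r i)) j = coeff 0 j"
      using v0[of j] by (cases "j < n") (simp_all add: coeff_sum coeff_map_poly cr)
  qed
  finally have "?h q dvd ?h f * V" by simp
  with linear_factors_dvd_cancel nz have "(\<Prod>x\<leftarrow>xs. [:-x, 1:]) dvd V" unfolding xs by blast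
  from dvd_imp_degree_le[OF this \<open>V \<noteq> 0\<close>] have "length xs \<le> degree V"
    unfolding degree_linear_factors .
  moreover have "degree V \<le> n - 1" by (rule degree_le) (auto simp: cV)
  then have "degree V < n" using n by simp
  moreover have "length xs = n"
  proof -
    have "coeff (?h q) n = 1" using q(1) by (simp add: coeff_map_poly n_def)
    then have "degree (?h q) = n"
      using degree_map_poly_le[of "ev \<beta>" q] monic_degreeI unfolding n_def by blast
    then show ?thesis by (simp only: xs degree_linear_factors)
  qed
  ultimately show False by simp
qed

lemma finite_cst_roots:
  fixes u v :: "'a::{idom, complex_alg}"
  assumes "u \<noteq> 0"
  shows "finite {c. u * cst c + v = 0}"
proof (cases "{c. u * cst c + v = 0} = {}")
  case True
  then show ?thesis by (simp only: finite.emptyI)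
next
  case False
  then obtain c0 where c0: "u * cst c0 + v = 0" by blast
  have "c = c0" if "u * cst c + v = 0" for c
  proof -
    have "u * cst c + v = u * cst c0 + v" using c0 that by (simp only:)
    then have "u * cst c = u * cst c0" by (rule add_right_imp_eq)
    then have "cst c = (cst c0 :: 'a)" using assms by (simp only: mult_cancel_left simp_thms)
    then show ?thesis by (simp only: cst_eq_iff)
  qed
  then have "{c. u * cst c + v = 0} \<subseteq> {c0}" by blast
  then show ?thesis by (rule finite_subset) simp
qed

text \<open>\<open>extend_spec_single\<close> provides a root that depends on the relation
  \<open>f\<close>; one root has to serve all relations. Otherwise each of the finitely many roots
  violates some relation, and a generic combination \<open>f * cst c + g\<close> of such relations
  is violated by all roots at once, a contradiction.\<close>

lemma extend_spec:
  fixes \<alpha> :: "nat \<Rightarrow> 'k::{idom, complex_alg}" and \<beta> :: "nat \<Rightarrow> 'b::{idom, complex_alg}"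
  assumes sp: "spec \<alpha> \<beta>"
    and q: "lead_coeff q = 1" "poly (map_poly (ev \<alpha>) q) y = 0"
    and xs: "map_poly (ev \<beta>) q = (\<Prod>x\<leftarrow>xs. [:-x, 1:])"
  shows "\<exists>\<eta>\<in>set xs. spec (\<alpha>(n := y)) (\<beta>(n := \<eta>))"
proof (rule ccontr)
  assume "\<not> ?thesis"
  then have bad: "\<exists>f. poly (map_poly (ev \<alpha>) f) y = 0 \<and> poly (map_poly (ev \<beta>) f) x \<noteq> 0"
    if "x \<in> set xs" for x
    using that spec_fun_upd by blast
  have "\<exists>f. poly (map_poly (ev \<alpha>) f) y = 0 \<and> (\<forall>x\<in>X. poly (map_poly (ev \<beta>) f) x \<noteq> 0)"
    if "finite X" "X \<subseteq> set xs" for X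
    using that
  proof (induction X)
    case empty
    show ?case by (intro exI[of _ 0]) simp
  next
    case (insert x X)
    then obtain f where f: "poly (map_poly (ev \<alpha>) f) y = 0" "\<And>x. x \<in> X \<Longrightarrow> poly (map_poly (ev \<beta>) f) x \<noteq> 0"
      by auto
    obtain g where g: "poly (map_poly (ev \<alpha>) g) y = 0" "poly (map_poly (ev \<beta>) g) x \<noteq> 0"
      using bad[of x] insert.prems by auto
    let ?C = "\<lambda>t. {c. poly (map_poly (ev \<beta>) f) t * cst c + poly (map_poly (ev \<beta>) g) t = 0}"
    have fin: "finite (?C t)" if "t \<in> insert x X" for t
    proof (cases "poly (map_poly (ev \<beta>) f) t = 0")
      case True
      then have "t = x" using f(2) that by auto
      with True g(2) show ?thesis by simp
    next
      case False
      then show ?thesis by (rule finite_cst_roots)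
    qed
    have "finite (\<Union>t\<in>insert x X. ?C t)" using fin insert.hyps by blast
    then have "(\<Union>t\<in>insert x X. ?C t) \<noteq> UNIV" using infinite_UNIV_char_0[where 'a = complex] by metis
    then obtain c where c: "\<And>t. t \<in> insert x X \<Longrightarrow> c \<notin> ?C t" by blast
    have e: "poly (map_poly (ev w) (f * cst c + g)) t = poly (map_poly (ev w) f) t * cst c + poly (map_poly (ev w) g) t"
      for w :: "nat \<Rightarrow> 'c::complex_alg" and t
      by (simp only: alg_homD'[OF map_poly_ev_hom])
    show ?case
      using f(1) g(1) c by (intro exI[of _ "f * cst c + g"]) (simp add: e)
  qed
  from this[of "set xs"] obtain f where "poly (map_poly (ev \<alpha>) f) y = 0"
    "\<forall>x\<in>set xs. poly (map_poly (ev \<beta>) f) x \<noteq> 0" by auto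
  with extend_spec_single[OF sp q xs] show False by blast
qed

subsection \<open>Integral closedness of the polynomial ring\<close>

lemma content_monic:
  fixes q :: "'a::{factorial_semiring, semiring_gcd} poly"
  assumes "lead_coeff q = 1" shows "content q = 1"
proof -
  have "content q dvd 1" using content_dvd_coeff[of q "degree q"] assms by simp
  then show ?thesis by (metis is_unit_normalize normalize_content)
qed

text \<open>Gauss's lemma: a monic polynomial has content 1, so the contents of \<open>G\<close> and
  \<open>H\<close> multiply to \<open>c\<close> up to a unit, which is also the product of the
  leading coefficients. As \<open>content H\<close> divides \<open>lead_coeff H\<close>,
  \<open>lead_coeff G\<close> divides \<open>content G\<close>. In one variable this is the
  normality needed along lines.\<close>

lemma lead_coeff_dvd_coeff:
  fixes G H q :: "complex poly poly"
  assumes eq: "Polynomial.smult c q = G * H" and q: "lead_coeff q = 1" and c: "c \<noteq> 0"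
  shows "lead_coeff G dvd coeff G i"
proof -
  have "content G * content H = normalize c"
    using arg_cong[OF eq, of content] content_monic[OF q] by (simp add: content_mult)
  also have "c = lead_coeff G * lead_coeff H"
    using arg_cong[OF eq, of lead_coeff] q c by (simp add: lead_coeff_mult)
  finally have n: "content G * content H = normalize (lead_coeff G * lead_coeff H)" .
  have nz: "lead_coeff G \<noteq> 0" "lead_coeff H \<noteq> 0" using \<open>c = _\<close> c by auto
  have "lead_coeff G * lead_coeff H dvd content G * content H" unfolding n by simp
  also have "content G * content H dvd content G * lead_coeff H"
    by (rule mult_dvd_mono[OF dvd_refl content_dvd_coeff])
  finally have "lead_coeff G dvd content G" using nz by simp
  then show ?thesis using content_dvd_coeff[of G i] by (rule dvd_trans)
qed

lemma map_poly_ev_ev: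
  "map_poly (ev x) (map_poly (ev y) p) = map_poly (ev (\<lambda>i. ev x (y i))) p"
  by (rule poly_eqI) (simp add: coeff_map_poly ev_ev)

text \<open>After making the divisor monic along a generic direction, the remainder of the division
  vanishes at every point off \<open>w = 0\<close>.\<close>

lemma dvd_on_lines:
  fixes f g w :: "nat cpoly"
  assumes fixed: "ev (restr r var) f = f" "ev (restr r var) g = g" "ev (restr r var) w = w"
    and "g \<noteq> 0" "w \<noteq> 0"
    and lines: "\<And>x :: nat \<Rightarrow> complex poly. restr r x = x \<Longrightarrow> ev x w \<noteq> 0 \<Longrightarrow> ev x g dvd ev x f"
  shows "\<exists>h. f = g * h"
proof -
  have "ev (restr r var) g \<noteq> 0" using fixed \<open>g \<noteq> 0\<close> by simp
  from generic_linear_change[OF this one_neq_zero] obtain c :: "nat \<Rightarrow> complex" and d e where e: "e \<noteq> 0"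
    and d: "degree (ev (\<lambda>i. [:restr r var i, cst (restr r c i):]) g) = d"
    "coeff (ev (\<lambda>i. [:restr r var i, cst (restr r c i) :: nat cpoly:]) g) d = cst e"
    by blast
  define \<psi> where "\<psi> = ev (\<lambda>i. [:restr r var i, cst (restr r c i) :: nat cpoly:])"
  \<comment> \<open>The divisor \<open>g\<close> restricted to a generic line through a variable
    base point, with its constant leading coefficient normalized to 1.\<close>
  define p where "p = Polynomial.smult (cst (inverse e)) (\<psi> g)"
  have cn: "cst (inverse e) \<noteq> (0 :: nat cpoly)" using e by simp
  have dp: "degree p = d" using d cn by (simp add: p_def \<psi>_def)
  have cp: "coeff p d = 1" using d e by (simp add: p_def \<psi>_def flip: cst_mult)
  then have p1: "lead_coeff p = 1" by (simp add: dp)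
  obtain Q H where QH: "\<psi> f = p * Q + H" "H = 0 \<or> degree H < degree p"
    using monic_division[OF p1] by blast
  have evpsi: "map_poly (ev b) (\<psi> h) = ev (\<lambda>i. [:restr r b i, cst (restr r c i):]) h"
    for b :: "nat \<Rightarrow> complex" and h
    unfolding \<psi>_def alg_hom_ev_eq[OF alg_hom_map_poly[OF alg_hom_ev]]
    by (rule arg_cong2[of _ _ _ _ ev]) (auto simp: map_poly_pCons_hom restr_def)
  have "H = 0"
  proof (rule poly_eqI)
    fix i
    \<comment> \<open>The factor \<open>w\<close> turns vanishing outside its zero set into
      vanishing everywhere, and is cancelled afterwards.\<close>
    have "ev b (coeff H i * w) = 0" for b :: "nat \<Rightarrow> complex"
    proof (cases "ev b w = 0")
      case True
      then show ?thesis by (simp add: ev_mult)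
    next
      case False
      let ?m = "map_poly (ev b)" and ?x = "\<lambda>i. [:restr r b i, cst (restr r c i):]"
      have hom: "alg_hom ?m" by (rule alg_hom_map_poly[OF alg_hom_ev])
      have "poly (ev ?x w) 0 = ev (\<lambda>i. poly (?x i) 0) w"
        by (rule alg_hom_ev_eq[OF alg_hom_poly])
      also have "\<dots> = ev (restr r b) w" by simp
      also have "\<dots> = ev b w" using fixed(3) ev_restr_var[of b r w] by simp
      finally have "ev ?x w \<noteq> 0" using False by auto
      moreover have "restr r ?x = ?x" by (auto simp: restr_def)
      ultimately have "ev ?x g dvd ev ?x f" by (intro lines)
      moreover have "ev ?x g = cst e * ?m p"
      proof -
        have "?m p = ?m (cst (inverse e) * \<psi> g)" by (simp add: p_def cst_poly_def)
        also have "\<dots> = cst (inverse e) * ev ?x g" by (simp only: alg_homD'[OF hom] evpsi)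
        finally show ?thesis using e by (simp flip: mult.assoc cst_mult)
      qed
      ultimately have "?m p dvd ?m (\<psi> f)" unfolding evpsi by (metis dvd_mult_right)
      then have "?m p dvd ?m H" unfolding QH(1) alg_homD'[OF hom] by (simp add: dvd_add_right_iff)
      have "coeff (?m p) d = 1" using cp by (simp add: coeff_map_poly)
      then have dm: "degree (?m p) = d" using monic_degreeI[of "?m p" d] degree_map_poly_le[of "ev b" p] dp by metis
      have "?m H = 0"
      proof (cases "H = 0")
        case False
        then have "degree (?m H) < d" using QH(2) dp degree_map_poly_le[of "ev b" H] by simp
        with \<open>?m p dvd ?m H\<close> dm show ?thesis by (meson dvd_imp_degree_le not_le)
      qed simp
      then have "ev b (coeff H i) = 0" using coeff_map_poly[of "ev b" H i] by simp
      then show ?thesis by (simp add: ev_mult)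
    qed
    then have "coeff H i * w = 0" using ex_ev_neq_0 by blast
    with \<open>w \<noteq> 0\<close> show "coeff H i = coeff 0 i" by simp
  qed
  have at0: "poly (\<psi> h) 0 = ev (restr r var) h" for h
    unfolding \<psi>_def alg_hom_ev_eq[OF alg_hom_poly] by simp
  have "f = poly (\<psi> f) 0" using at0[of f] fixed(1) by simp
  also have "\<dots> = poly p 0 * poly Q 0" using QH(1) \<open>H = 0\<close> by simp
  also have "poly p 0 = cst (inverse e) * g" using at0[of g] fixed(2) by (simp add: p_def)
  finally have "f = g * (cst (inverse e) * poly Q 0)" by (simp add: mult_ac)
  then show ?thesis by blast
qed

text \<open>A relation \<open>G\<close> of least degree need not be monic a priori. Pseudo-division
  of the monic \<open>q\<close> gives \<open>g ^ k * q = G * H\<close> with \<open>g\<close> the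
  leading coefficient of \<open>G\<close>; by Gauss's lemma on lines and
  \<open>dvd_on_lines\<close>, \<open>g\<close> divides all coefficients of \<open>G\<close>. The
  quotient \<open>F\<close> is monic, so division by it shows that every relation is a multiple of
  it.\<close>

lemma minimal_polynomial:
  fixes z :: "nat \<Rightarrow> 'k::{idom, complex_alg}"
  assumes ind: "indep r z" and z: "restr r z = z"
    and q: "lead_coeff q = 1" "poly (map_poly (ev z) q) \<theta> = 0"
  shows "\<exists>F. lead_coeff F = 1 \<and> degree F \<le> degree q \<and> poly (map_poly (ev z) F) \<theta> = 0 \<and>
    (\<forall>f. poly (map_poly (ev z) f) \<theta> = 0 \<longrightarrow> (\<exists>s. map_poly (ev (restr r var)) f = F * s))"
proof -
  let ?t = "map_poly (ev (restr r var))"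
  let ?v = "\<lambda>f. poly (map_poly (ev z) f) \<theta>"
  have homt: "alg_hom ?t" by (rule alg_hom_map_poly[OF alg_hom_ev])
  note th = alg_homD'[OF homt] and vh = alg_homD'[OF map_poly_ev_hom[of z \<theta>]]
  have rr: "ev (restr r var) (ev (restr r var) f) = ev (restr r var) f" for f
    by (simp add: ev_restr_var)
  have tt: "?t (?t f) = ?t f" for f
    by (rule poly_eqI) (simp add: coeff_map_poly rr)
  have vt: "?v (?t f) = ?v f" for f
    using z by (simp add: map_poly_ev_ev if_distrib restr_def cong: if_cong)
  have dt: "degree (?t f) \<le> degree f" for f by (rule degree_map_poly_le)
  have inj: "g = 0" if "ev (restr r var) g = g" "ev z g = 0" for g
    using ind that by (auto simp: indep_def)
  have tmonic: "degree (?t f) = degree f \<and> lead_coeff (?t f) = 1" if "lead_coeff f = 1" for f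
    using that dt[of f] by (intro monic_degreeI) (auto simp: coeff_map_poly)
  define I where "I = {G. ?t G = G \<and> G \<noteq> 0 \<and> ?v G = 0}"
  have "?t q \<noteq> 0" using tmonic[OF q(1)] by (metis leading_coeff_0_iff zero_neq_one)
  then have qI: "?t q \<in> I" using q(2) by (simp add: I_def tt vt)
  define G where "G = arg_min degree (\<lambda>G. G \<in> I)"
  have G: "G \<in> I" unfolding G_def using qI by (rule arg_min_natI)
  have Gmin: "degree G \<le> degree f" if "f \<in> I" for f unfolding G_def using that by (rule arg_min_nat_le)
  have Gt: "?t G = G" and G0: "G \<noteq> 0" and Gv: "?v G = 0" using G by (auto simp: I_def)
  define g where "g = lead_coeff G"
  have g0: "g \<noteq> 0" using G0 by (simp add: g_def)
  have ct: "ev (restr r var) (coeff G i) = coeff G i" for i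
    using arg_cong[OF Gt, of "\<lambda>p. coeff p i"] by (simp add: coeff_map_poly)
  then have gt: "ev (restr r var) g = g" by (simp add: g_def)
  have zg: "ev z g \<noteq> 0" using inj[OF gt] g0 by blast
  have zero: "?t R = 0" if "?v R = 0" "R = 0 \<or> degree R < degree G" for R
  proof (rule ccontr)
    assume "?t R \<noteq> 0"
    then have "?t R \<in> I" using that by (simp add: I_def tt vt)
    from Gmin[OF this] dt[of R] that \<open>?t R \<noteq> 0\<close> show False by auto
  qed
  \<comment> \<open>The pseudo-remainder is again a relation, of degree below that of
    \<open>G\<close>; by minimality its truncation is zero.\<close>
  obtain k c H where c: "c = g ^ k" and H: "Polynomial.smult c (?t q) = G * H"
  proof -
    obtain s R where sR: "pseudo_divmod (?t q) G = (s, R)" by fastforce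
    define k where "k = Suc (degree (?t q)) - degree G"
    have eq: "Polynomial.smult (g ^ k) (?t q) = G * s + R" "R = 0 \<or> degree R < degree G"
      using pseudo_divmod[OF G0 sR] by (simp_all add: g_def k_def)
    have "R = Polynomial.smult (g ^ k) (?t q) - G * s" using eq(1) by simp
    also have "?v \<dots> = 0"
    proof -
      have "Polynomial.smult (g ^ k) (?t q) = [:g ^ k:] * ?t q" by simp
      then show ?thesis using q(2) Gv by (simp only: vh vt) simp
    qed
    finally have "?t R = 0" using eq(2) by (rule zero)
    have "Polynomial.smult (g ^ k) (?t q) = ?t (Polynomial.smult (g ^ k) (?t q))"
      by (rule poly_eqI) (simp add: coeff_map_poly ev_mult rr gt ev.hom_power)
    also have "\<dots> = G * ?t s" by (simp only: eq(1) th Gt \<open>?t R = 0\<close> add_0_right)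
    finally show ?thesis using that by blast
  qed
  have "\<exists>h. coeff G i = g * h" for i
  proof (rule dvd_on_lines[of r _ _ c])
    show "ev (restr r var) c = c" by (simp add: c ev.hom_power gt)
    show "c \<noteq> 0" using g0 by (simp add: c)
    fix x :: "nat \<Rightarrow> complex poly"
    assume x: "restr r x = x" and nz: "ev x c \<noteq> 0"
    let ?m = "map_poly (ev x)"
    have hom: "alg_hom ?m" by (rule alg_hom_map_poly[OF alg_hom_ev])
    have "Polynomial.smult (ev x c) (?m (?t q)) = ?m (Polynomial.smult c (?t q))"
      by (rule poly_eqI) (simp add: coeff_map_poly ev_mult)
    also have "\<dots> = ?m G * ?m H" by (simp only: H alg_homD'[OF hom])
    finally have eq: "Polynomial.smult (ev x c) (?m (?t q)) = ?m G * ?m H" .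
    have l: "lead_coeff (?m (?t q)) = 1"
    proof -
      have "coeff (?m (?t q)) (degree q) = 1"
        using q(1) by (simp add: coeff_map_poly)
      moreover have "degree (?m (?t q)) \<le> degree q" using degree_map_poly_le[of "ev x"] dt order_trans by blast
      ultimately show ?thesis using monic_degreeI by blast
    qed
    have "lead_coeff (Polynomial.smult c (?t q)) = c * lead_coeff (?t q)" by (rule lead_coeff_smult)
    also have "lead_coeff (?t q) = 1" using tmonic[OF q(1)] by blast
    finally have "lead_coeff H * g = c"
      unfolding H by (simp add: lead_coeff_mult g_def mult.commute)
    then have "ev x g \<noteq> 0" using nz by (auto simp: ev_mult)
    then have "coeff (?m G) (degree G) \<noteq> 0" by (simp add: coeff_map_poly g_def)
    then have "degree (?m G) = degree G" using degree_map_poly_le[of "ev x" G] le_degree by (metis antisym)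
    then have "lead_coeff (?m G) = ev x g" by (simp add: coeff_map_poly g_def)
    with lead_coeff_dvd_coeff[OF eq l nz, of i] show "ev x g dvd ev x (coeff G i)"
      by (simp add: coeff_map_poly)
  qed (use ct gt g0 in auto)
  then obtain h where h: "\<And>i. coeff G i = g * h i" by metis
  define F where "F = (\<Sum>i\<le>degree G. monom (h i) i)"
  have hz: "h i = 0" if "i > degree G" for i using h[of i] that g0 by (simp add: coeff_eq_0)
  have cF: "coeff F i = h i" for i
    using hz[of i] by (cases "i \<le> degree G") (auto simp: F_def coeff_sum)
  have GF: "G = [:g:] * F" by (rule poly_eqI) (simp add: h cF)
  have "g * coeff F (degree G) = g * 1" using h[of "degree G"] by (simp add: cF g_def)
  then have "coeff F (degree G) = 1" using g0 by (simp only: mult_cancel_left) simp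
  moreover have "degree F \<le> degree G" by (rule degree_le) (simp add: cF hz)
  ultimately have F: "degree F = degree G" "lead_coeff F = 1" using monic_degreeI[of F "degree G"] by auto
  have "ev z g * ?v F = 0" using Gv unfolding GF vh(2) by (simp add: map_poly_pCons_hom)
  with zg have Fv: "?v F = 0" by simp
  have Ft: "?t F = F"
  proof (rule poly_eqI)
    fix i
    have "g * ev (restr r var) (coeff F i) = g * coeff F i"
      using ct[of i] gt unfolding h cF by (simp add: ev_mult)
    then show "coeff (?t F) i = coeff F i" using g0 by (simp add: coeff_map_poly)
  qed
  have "\<exists>s. ?t f = F * s" if f: "?v f = 0" for f
  proof -
    obtain s R where sR: "f = F * s + R" "R = 0 \<or> degree R < degree F"
      using monic_division[OF F(2)] by blast
    then have "R = f - F * s" by simp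
    then have "?v R = 0" using f Fv by (simp only: vh) simp
    then have "?t R = 0" using sR(2) F(1) by (intro zero) simp_all
    then have "?t f = F * ?t s" unfolding sR(1) by (simp only: th Ft add_0_right)
    then show ?thesis by blast
  qed
  moreover have "degree F \<le> degree q" using Gmin[OF qI] dt[of q] F(1) by simp
  ultimately show ?thesis using F(2) Fv by blast
qed

subsection \<open>Arcs through specializations\<close>

text \<open>The sum of the total degrees of all monomials is a crude bound, but the same for every
  line.\<close>

lemma degree_on_lines_bounded:
  "\<exists>M. \<forall>x y :: 'i \<Rightarrow> 'a::complex_alg. degree (ev (\<lambda>i. [:x i, y i:]) f) \<le> M"
proof -
  let ?K = "Poly_Mapping.keys f"
  define sz where "sz m = (\<Sum>i\<in>Poly_Mapping.keys m. Poly_Mapping.lookup m i)" for m :: "'i \<Rightarrow>\<^sub>0 nat"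
  have "degree (ev (\<lambda>i. [:x i, y i:]) f) \<le> (\<Sum>m\<in>?K. sz m)" for x y :: "'i \<Rightarrow> 'a"
    unfolding ev_def
  proof (rule degree_sum_le)
    fix m assume m: "m \<in> ?K"
    have "degree (\<Prod>i\<in>Poly_Mapping.keys m. [:x i, y i:] ^ Poly_Mapping.lookup m i) \<le> sz m"
      unfolding sz_def by (rule coeff_prod_linear_powers(1)) simp
    also have "sz m \<le> (\<Sum>m\<in>?K. sz m)" using m by (intro member_le_sum) auto
    finally show "degree (cst (Poly_Mapping.lookup f m) *
        (\<Prod>i\<in>Poly_Mapping.keys m. [:x i, y i:] ^ Poly_Mapping.lookup m i)) \<le> (\<Sum>m\<in>?K. sz m)"
      unfolding cst_poly_def using degree_smult_le order_trans by fastforce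
  qed simp
  then show ?thesis by blast
qed

lemma subdegree_tpow_le:
  assumes "e > 0" "a \<noteq> 0"
  shows "tpow e a \<noteq> 0" "subdegree (tpow e a) \<le> e * subdegree a"
proof -
  have "fps_nth (tpow e a) (e * subdegree a) \<noteq> 0" using assms by (simp add: tpow_nth)
  then show "tpow e a \<noteq> 0" "subdegree (tpow e a) \<le> e * subdegree a"
    by (auto intro: subdegree_leI)
qed

lemma alg_hom_fps_of_poly: "alg_hom (fps_of_poly :: complex poly \<Rightarrow> _)"
  by (rule alg_homI) (simp_all add: fps_of_poly_add fps_of_poly_mult cst_poly_def cst_fps_def fps_of_poly_const)

text \<open>For \<open>x\<close> differing from \<open>p\<close> below \<open>m\<close>, the
  difference of the two values is a nonzero polynomial in \<open>c\<close>. Only finitely many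
  \<open>x\<close> compete, so some \<open>c\<close> avoids all their roots.\<close>

lemma ex_separating_form:
  fixes X :: "nat \<Rightarrow> complex set" and p :: "nat \<Rightarrow> complex"
  assumes "\<And>j. finite (X j)"
  obtains c where "\<forall>x. (\<forall>j<m. x j \<in> X j) \<longrightarrow>
    (\<Sum>j<m. c ^ j * x j) = (\<Sum>j<m. c ^ j * p j) \<longrightarrow> (\<forall>j<m. x j = p j)"
proof -
  define P where "P x = (\<Sum>j<m. monom (x j - p j) j)" for x
  have Pc: "poly (P x) c = (\<Sum>j<m. c ^ j * x j) - (\<Sum>j<m. c ^ j * p j)" for x c
    by (simp add: P_def poly_sum poly_monom sum_subtractf[symmetric] algebra_simps)
  have P0: "x j = p j" if "P x = 0" "j < m" for x j
  proof -
    have "coeff (P x) j = x j - p j" using that(2) by (simp add: P_def coeff_sum)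
    with that(1) show ?thesis by simp
  qed
  define Y where "Y = {x \<in> PiE {..<m} X. P x \<noteq> 0}"
  have "finite (PiE {..<m} X)" by (rule finite_PiE) (use assms in auto)
  then have "finite Y" unfolding Y_def by (rule finite_subset[rotated]) auto
  then have "finite (\<Union>x\<in>Y. {c. poly (P x) c = 0})"
    by (intro finite_UN_I poly_roots_finite) (auto simp: Y_def)
  then have "(\<Union>x\<in>Y. {c. poly (P x) c = 0}) \<noteq> UNIV" using infinite_UNIV_char_0[where 'a = complex] by metis
  then obtain c where c: "\<And>x. x \<in> Y \<Longrightarrow> poly (P x) c \<noteq> 0" by blast
  have "x j = p j" if x: "\<forall>j<m. x j \<in> X j" "(\<Sum>j<m. c ^ j * x j) = (\<Sum>j<m. c ^ j * p j)" "j < m" for x j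
  proof -
    have PP: "P (restrict x {..<m}) = P x" by (simp add: P_def)
    have "poly (P x) c = 0" using x(2) by (simp add: Pc)
    then have "restrict x {..<m} \<notin> Y" using c PP by metis
    then have "P x = 0" using x(1) PP by (auto simp: Y_def)
    then show ?thesis using x(3) by (rule P0)
  qed
  with that show thesis by blast
qed

lemma ev_poly_map_poly:
  "ev x (poly (map_poly (ev \<zeta>) F) t) = poly (map_poly (ev (\<lambda>i. ev x (\<zeta> i))) F) (ev x t)"
proof -
  have "ev x (poly (map_poly (ev \<zeta>) F) t) = poly (map_poly (ev x) (map_poly (ev \<zeta>) F)) (ev x t)"
    by simp
  then show ?thesis by (simp only: map_poly_ev_ev)
qed

lemma map_poly_alg_hom_ev:
  assumes "alg_hom h"
  shows "map_poly h (map_poly (ev x) F) = map_poly (ev (\<lambda>i. h (x i))) F"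
  using alg_homD'(3)[OF assms] by (intro poly_eqI) (simp add: coeff_map_poly alg_hom_ev_eq[OF assms])

lemma monic_map_poly_ev:
  assumes "lead_coeff q = 1"
  shows "lead_coeff (map_poly (ev x) q) = 1" and "degree (map_poly (ev x) q) = degree q"
  using monic_degreeI[of "map_poly (ev x) q" "degree q"] degree_map_poly_le[of "ev x" q] assms
  by (simp_all add: coeff_map_poly)

text \<open>The bound is \<open>K = E * M\<close>: \<open>M\<close> bounds the degree of
  \<open>N\<close> on lines and \<open>E\<close> is the ramification that splits all monic equations
  of degree at most \<open>D\<close>. Both are fixed before \<open>p\<close> is chosen.\<close>

theorem arcs_through_specializations:
  fixes a :: "nat \<Rightarrow> 'k::{field, complex_alg}"
  assumes am: "restr m a = a" and b: "ev a \<beta> \<noteq> 0"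
  shows "\<exists>K. \<forall>p :: nat \<Rightarrow> complex. spec a p \<longrightarrow> (\<exists>\<eta> :: nat \<Rightarrow> complex fps. spec a \<eta> \<and>
    (\<forall>i. fps_nth (\<eta> i) 0 = p i) \<and> ev \<eta> \<beta> \<noteq> 0 \<and> subdegree (ev \<eta> \<beta>) \<le> K)"
proof -
  obtain r \<zeta> where \<zeta>: "\<And>i. i \<ge> r \<Longrightarrow> \<zeta> i = 0" and ind: "indep r (\<lambda>i. ev a (\<zeta> i))"
    and fin: "fin_over (range (ev (\<lambda>i. ev a (\<zeta> i)))) (range (ev a))"
    using noether_normalization[OF am] by blast
  define z where "z i = ev a (\<zeta> i)" for i
  have z: "(\<lambda>i. ev a (\<zeta> i)) = z" by (simp add: z_def fun_eq_iff)
  have zr: "restr r z = z" using \<zeta> by (auto simp: restr_def z_def fun_eq_iff)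
  obtain D where D: "\<And>y. y \<in> range (ev a) \<Longrightarrow>
      \<exists>q. degree q = D \<and> lead_coeff q = 1 \<and> poly (map_poly (ev z) q) y = 0"
    using fin_over_monic_annihilator[OF fin] unfolding z by blast
  have "\<exists>q. degree q = D \<and> lead_coeff q = 1 \<and> poly (map_poly (ev z) q) (a j) = 0" for j
    by (rule D) (auto intro: range_eqI[of _ _ "var j"])
  then obtain Q where Q: "\<And>j. degree (Q j) = D" "\<And>j. lead_coeff (Q j) = 1"
    "\<And>j. poly (map_poly (ev z) (Q j)) (a j) = 0" by metis
  \<comment> \<open>\<open>N\<close> is the lowest nonzero coefficient in a monic equation of
    \<open>\<beta>\<close>. Cancelling the power \<open>\<beta> ^ k\<close> leaves \<open>N\<close>
    equal to a multiple of \<open>\<beta>\<close>.\<close>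
  obtain N \<gamma> where N: "ev z N \<noteq> 0" "ev z N = ev a (\<beta> * \<gamma>)"
  proof -
    obtain q where q: "lead_coeff q = 1" "poly (map_poly (ev z) q) (ev a \<beta>) = 0" using D by blast
    let ?P = "map_poly (ev z) q"
    have "?P \<noteq> 0" using monic_map_poly_ev(1)[OF q(1), of z] by (metis leading_coeff_0_iff zero_neq_one)
    define k where "k = (LEAST k. coeff ?P k \<noteq> 0)"
    have "coeff ?P (degree ?P) \<noteq> 0" using \<open>?P \<noteq> 0\<close> unfolding leading_coeff_0_iff .
    then have k: "coeff ?P k \<noteq> 0" unfolding k_def by (rule LeastI)
    have lt: "coeff ?P i = 0" if "i < k" for i using not_less_Least that unfolding k_def by blast
    have kd: "k \<le> degree ?P" using k by (rule le_degree)
    define n where "n = degree ?P - k"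
    have n: "degree ?P = k + n" using kd by (simp add: n_def)
    define \<gamma> where "\<gamma> = - (\<Sum>i<n. ev \<zeta> (coeff q (Suc (k + i))) * \<beta> ^ i)"
    have "0 = (\<Sum>i\<le>k + n. coeff ?P i * ev a \<beta> ^ i)" using q(2) n by (simp add: poly_altdef)
    also have "\<dots> = (\<Sum>i\<in>{k..k + n}. coeff ?P i * ev a \<beta> ^ i)"
      using lt by (intro sum.mono_neutral_right) auto
    also have "\<dots> = (\<Sum>i\<le>n. coeff ?P (k + i) * ev a \<beta> ^ (k + i))"
      using sum.shift_bounds_cl_nat_ivl[of "\<lambda>i. coeff ?P i * ev a \<beta> ^ i" 0 k n]
      by (simp add: atLeast0AtMost add.commute)
    also have "\<dots> = ev a \<beta> ^ k * (\<Sum>i\<le>n. coeff ?P (k + i) * ev a \<beta> ^ i)"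
      by (simp add: sum_distrib_left power_add mult_ac)
    finally have "(\<Sum>i\<le>n. coeff ?P (k + i) * ev a \<beta> ^ i) = 0" using b by simp
    also have "(\<Sum>i\<le>n. coeff ?P (k + i) * ev a \<beta> ^ i) =
        coeff ?P k + (\<Sum>i<n. coeff ?P (Suc (k + i)) * ev a \<beta> ^ Suc i)"
      by (simp only: lessThan_Suc_atMost[symmetric] sum.lessThan_Suc_shift) simp
    finally have "coeff ?P k = - (\<Sum>i<n. coeff ?P (Suc (k + i)) * ev a \<beta> ^ Suc i)"
      by (simp only: eq_neg_iff_add_eq_0)
    also have "\<dots> = ev a (\<beta> * \<gamma>)"
      by (simp add: \<gamma>_def ev_mult ev.hom_uminus ev_sum ev.hom_power coeff_map_poly ev_ev z
          sum_distrib_left mult_ac)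
    finally show thesis using k that[of "coeff q k" \<gamma>] by (simp add: coeff_map_poly)
  qed
  have "ev (restr r var) N \<noteq> 0" using N(1) ev_restr_var[of z r N] zr by auto
  then obtain c' :: "nat \<Rightarrow> complex" where c': "ev (restr r c') N \<noteq> 0" using ev_restr_neq_0 by blast
  obtain M where M: "\<And>x y :: nat \<Rightarrow> complex. degree (ev (\<lambda>i. [:x i, y i:]) N) \<le> M"
    using degree_on_lines_bounded by blast
  obtain E where E: "E > 0" and spl: "\<And>F. lead_coeff F = 1 \<Longrightarrow> degree F \<le> D \<Longrightarrow> splits (map_poly (tpow E) F)"
    using common_exponent[of "Suc D"] puiseux by (auto simp: less_Suc_eq_le)
  have main: "\<exists>\<eta> :: nat \<Rightarrow> complex fps. spec a \<eta> \<and>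
    (\<forall>i. fps_nth (\<eta> i) 0 = p i) \<and> ev \<eta> \<beta> \<noteq> 0 \<and> subdegree (ev \<eta> \<beta>) \<le> E * M"
    if p: "spec a p" for p :: "nat \<Rightarrow> complex"
  proof -
    define z0 where "z0 i = ev p (\<zeta> i)" for i
    have z0: "(\<lambda>i. ev p (\<zeta> i)) = z0" by (simp add: z0_def fun_eq_iff)
    have z0r: "z0 i = 0" if "i \<ge> r" for i using \<zeta>[OF that] by (simp add: z0_def)
    \<comment> \<open>The product of the finite sets \<open>X j\<close> contains the whole fibre
      over \<open>z0\<close>; separating \<open>p\<close> from it is enough, and the fibre itself
      never has to be determined.\<close>
    define X where "X j = {x. poly (map_poly (ev z0) (Q j)) x = 0}" for j
    have finX: "finite (X j)" for j
    proof -
      have "map_poly (ev z0) (Q j) \<noteq> 0"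
        using monic_map_poly_ev(1)[OF Q(2), of z0 j] by (metis leading_coeff_0_iff zero_neq_one)
      then show ?thesis unfolding X_def by (rule poly_roots_finite)
    qed
    obtain c where c: "\<forall>x. (\<forall>j<m. x j \<in> X j) \<longrightarrow>
      (\<Sum>j<m. c ^ j * x j) = (\<Sum>j<m. c ^ j * p j) \<longrightarrow> (\<forall>j<m. x j = p j)"
      by (rule ex_separating_form[of X m p, OF finX])
    define \<theta> where "\<theta> = (\<Sum>j<m. cst (c ^ j) * (var j :: nat cpoly))"
    have ev\<theta>: "ev x \<theta> = (\<Sum>j<m. cst (c ^ j) * x j)" for x :: "nat \<Rightarrow> 'c::complex_alg"
      by (simp add: \<theta>_def ev_sum ev_mult)
    obtain F where F: "lead_coeff F = 1" "degree F \<le> D" "poly (map_poly (ev z) F) (ev a \<theta>) = 0"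
      and Fdvd: "\<And>f. poly (map_poly (ev z) f) (ev a \<theta>) = 0 \<Longrightarrow> \<exists>s. map_poly (ev (restr r var)) f = F * s"
    proof -
      obtain q where "degree q = D" "lead_coeff q = 1" "poly (map_poly (ev z) q) (ev a \<theta>) = 0"
        using D by blast
      with minimal_polynomial[OF ind[unfolded z] zr, of q "ev a \<theta>"] that show thesis by blast
    qed
    have transfer: "poly (map_poly (ev (\<lambda>i. ev x (\<zeta> i))) f) (ev x t) = 0"
      if "spec a x" "poly (map_poly (ev z) f) (ev a t) = 0" for f t and x :: "nat \<Rightarrow> 'c::complex_alg"
    proof -
      have "ev a (poly (map_poly (ev \<zeta>) f) t) = 0" using that(2) by (simp only: ev_poly_map_poly z)
      with that(1) have "ev x (poly (map_poly (ev \<zeta>) f) t) = 0" by (simp add: spec_def)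
      then show ?thesis by (simp only: ev_poly_map_poly)
    qed
    have F0: "poly (map_poly (ev z0) F) (ev p \<theta>) = 0"
      using transfer[OF p F(3)] by (simp only: z0)
    \<comment> \<open>The direction is chosen so that the line \<open>z0 + t u\<close> passes at
      \<open>t = 1\<close> through the fixed point where \<open>N\<close> is nonzero.\<close>
    define u where "u i = restr r c' i - z0 i" for i
    define \<tau> where "\<tau> i = fps_of_poly [:z0 i, u i:]" for i
    define \<sigma> where "\<sigma> i = tpow E (\<tau> i)" for i
    have u0: "u i = 0" if "i \<ge> r" for i using z0r[OF that] that by (simp add: u_def restr_def)
    have \<sigma>r: "\<sigma> i = 0" if "i \<ge> r" for i
      using z0r[OF that] u0[OF that] alg_homD'(3)[OF alg_hom_tpow[OF E]] by (simp add: \<sigma>_def \<tau>_def)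
    have \<sigma>0: "fps_nth (\<sigma> i) 0 = z0 i" for i
      by (simp add: \<sigma>_def \<tau>_def tpow_nth[OF E])
    have split\<sigma>: "splits (map_poly (ev \<sigma>) f)" if "lead_coeff f = 1" "degree f \<le> D" for f
    proof -
      have "map_poly (ev \<sigma>) f = map_poly (tpow E) (map_poly (ev \<tau>) f)"
        unfolding map_poly_alg_hom_ev[OF alg_hom_tpow[OF E]] by (simp add: \<sigma>_def[abs_def])
      then show ?thesis using spl[of "map_poly (ev \<tau>) f"] monic_map_poly_ev[OF that(1), of \<tau>] that(2) by simp
    qed
    have at0: "map_poly (\<lambda>a. fps_nth a 0) (map_poly (ev \<sigma>) f) = map_poly (ev z0) f" for f
      unfolding map_poly_alg_hom_ev[OF alg_hom_fps_nth_0] by (simp only: \<sigma>0)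
    obtain xs where xs: "map_poly (ev \<sigma>) F = (\<Prod>x\<leftarrow>xs. [:-x, 1:])"
      using split\<sigma>[OF F(1,2)] unfolding splits_def by blast
    \<comment> \<open>The constant terms of the roots along the arc are all the roots of
      \<open>F\<close> at \<open>z0\<close>. The value of \<open>\<theta>\<close> at
      \<open>p\<close> is among them, so some root starts there.\<close>
    have "map_poly (ev z0) F = (\<Prod>x\<leftarrow>map (\<lambda>a. fps_nth a 0) xs. [:-x, 1:])"
      using map_poly_linear_factors[OF alg_hom_fps_nth_0, of xs] at0[of F] unfolding xs by (simp only:)
    with F0 have "\<exists>\<rho>\<in>set xs. fps_nth \<rho> 0 = ev p \<theta>"
      by (auto simp: poly_prod_list prod_list_zero_iff o_def)
    then obtain \<rho> where \<rho>: "\<rho> \<in> set xs" "fps_nth \<rho> 0 = ev p \<theta>" by blast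
    have F\<rho>: "poly (map_poly (ev \<sigma>) F) \<rho> = 0"
      using \<rho>(1) unfolding xs by (auto simp: poly_prod_list prod_list_zero_iff o_def)
    have tr: "map_poly (ev x) (map_poly (ev (restr r var)) f) = map_poly (ev (restr r x)) f"
      for f and x :: "nat \<Rightarrow> 'c::complex_alg"
      by (rule poly_eqI) (simp add: coeff_map_poly ev_restr_var)
    have \<sigma>rr: "restr r \<sigma> = \<sigma>" using \<sigma>r by (auto simp: restr_def fun_eq_iff)
    \<comment> \<open>The partially built tuple: \<open>z\<close> below index \<open>r\<close>, the
      value of \<open>\<theta>\<close> at \<open>r\<close>, then the generators
      \<open>a 0, a 1, ...\<close> from \<open>Suc r\<close> on. They are adjoined one at a time by
      \<open>extend_spec\<close>.\<close>
    define \<alpha> where "\<alpha> j i = (if i < r then z i else if i = r then ev a \<theta> else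
        if i < Suc r + j then a (i - Suc r) else 0)" for j i
    have \<alpha>0: "\<alpha> 0 = z(r := ev a \<theta>)" using \<zeta> by (auto simp: \<alpha>_def z_def fun_eq_iff)
    have \<alpha>S: "\<alpha> (Suc j) = (\<alpha> j)(Suc r + j := a j)" for j by (auto simp: \<alpha>_def fun_eq_iff)
    have \<alpha>r: "restr r (\<alpha> j) = z" for j using \<zeta> by (auto simp: \<alpha>_def restr_def z_def fun_eq_iff)
    have "\<exists>B. spec (\<alpha> j) B \<and> restr r B = \<sigma> \<and> B r = \<rho>" for j
    proof (induction j)
      case 0
      \<comment> \<open>Here normality enters: all relations of \<open>\<theta>\<close> are
        multiples of \<open>F\<close>, hence any root of \<open>F\<close> along the arc, in
        particular \<open>\<rho>\<close>, defines a specialization.\<close>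
      have "spec (z(r := ev a \<theta>)) (\<sigma>(r := \<rho>))"
      proof (rule spec_fun_upd)
        fix f assume "poly (map_poly (ev z) f) (ev a \<theta>) = 0"
        then obtain s where s: "map_poly (ev (restr r var)) f = F * s" using Fdvd by blast
        have "map_poly (ev \<sigma>) f = map_poly (ev \<sigma>) (F * s)" unfolding s[symmetric] tr \<sigma>rr ..
        also have "\<dots> = map_poly (ev \<sigma>) F * map_poly (ev \<sigma>) s"
          by (rule alg_homD'(2)[OF alg_hom_map_poly[OF alg_hom_ev]])
        finally show "poly (map_poly (ev \<sigma>) f) \<rho> = 0" using F\<rho> by simp
      qed
      moreover have "restr r (\<sigma>(r := \<rho>)) = \<sigma>" using \<sigma>r by (auto simp: restr_def fun_eq_iff)
      ultimately show ?case unfolding \<alpha>0 by (intro exI[of _ "\<sigma>(r := \<rho>)"] conjI fun_upd_same)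
    next
      case (Suc j)
      then obtain B where B: "spec (\<alpha> j) B" "restr r B = \<sigma>" "B r = \<rho>" by blast
      \<comment> \<open>Truncation is needed because positions from \<open>r\<close> on are now
        occupied in \<open>\<alpha> j\<close> and \<open>B\<close>, whereas \<open>z\<close> and
        \<open>\<sigma>\<close> are 0 there.\<close>
      let ?q = "map_poly (ev (restr r var)) (Q j)"
      obtain ys where ys: "map_poly (ev \<sigma>) (Q j) = (\<Prod>x\<leftarrow>ys. [:-x, 1:])"
        using split\<sigma>[of "Q j"] Q(1,2) unfolding splits_def by auto
      have "\<exists>\<eta>\<in>set ys. spec ((\<alpha> j)(Suc r + j := a j)) (B(Suc r + j := \<eta>))"
      proof (rule extend_spec[OF B(1)])
        show "lead_coeff ?q = 1" by (rule monic_map_poly_ev(1)[OF Q(2)])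
        show "poly (map_poly (ev (\<alpha> j)) ?q) (a j) = 0" unfolding tr \<alpha>r by (rule Q(3))
        show "map_poly (ev B) ?q = (\<Prod>x\<leftarrow>ys. [:-x, 1:])" unfolding tr B(2) by (rule ys)
      qed
      then obtain \<eta> where "spec (\<alpha> (Suc j)) (B(Suc r + j := \<eta>))" unfolding \<alpha>S by blast
      moreover have "restr r (B(Suc r + j := \<eta>)) = \<sigma>"
        unfolding B(2)[symmetric] by (auto simp: restr_def fun_eq_iff)
      ultimately show ?case using B(3) by (intro exI[of _ "B(Suc r + j := \<eta>)"] conjI) (assumption | simp)+
    qed
    then obtain B where B: "spec (\<alpha> m) B" "restr r B = \<sigma>" "B r = \<rho>" by blast
    \<comment> \<open>Translates the index of a generator into its position in the extended
      tuple.\<close>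
    define sh where "sh = (\<lambda>j. if j < m then var (Suc r + j) else (0 :: nat cpoly))"
    define \<eta> where "\<eta> j = ev B (sh j)" for j
    have a0: "a j = 0" if "j \<ge> m" for j using fun_cong[OF am, of j] that by (simp add: restr_def)
    have "ev (\<alpha> m) (sh j) = a j" for j using a0[of j] by (auto simp: sh_def \<alpha>_def)
    then have ash: "ev (\<alpha> m) (ev sh f) = ev a f" for f by (simp add: ev_ev)
    have bsh: "ev B (ev sh f) = ev \<eta> f" for f by (simp add: ev_ev \<eta>_def[abs_def])
    have sp: "spec a \<eta>"
      unfolding spec_def using B(1) by (metis ash bsh spec_def)
    have eqB: "B i = ev \<eta> f" if "\<alpha> m i = ev a f" for i f
    proof -
      have "ev (\<alpha> m) (var i - ev sh f) = 0" using that by (simp add: ev.hom_minus ash)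
      then have "ev B (var i - ev sh f) = 0" using B(1) by (simp add: spec_def)
      then show ?thesis by (simp add: ev.hom_minus bsh)
    qed
    have \<sigma>\<eta>: "(\<lambda>i. ev \<eta> (\<zeta> i)) = \<sigma>"
    proof (rule ext)
      fix i
      show "ev \<eta> (\<zeta> i) = \<sigma> i"
      proof (cases "i < r")
        case True
        then have "\<sigma> i = B i" using fun_cong[OF B(2), of i] by (simp add: restr_def)
        moreover have "B i = ev \<eta> (\<zeta> i)" using True by (intro eqB) (simp add: \<alpha>_def z_def)
        ultimately show ?thesis by simp
      next
        case False
        then show ?thesis using \<zeta>[of i] \<sigma>r[of i] by simp
      qed
    qed
    have "\<rho> = ev \<eta> \<theta>" unfolding B(3)[symmetric] by (rule eqB) (simp add: \<alpha>_def)
    \<comment> \<open>The center of the lift has coordinates in the sets \<open>X j\<close> and the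
      same value of \<open>\<theta>\<close> as \<open>p\<close>; by the choice of \<open>c\<close>
      it is \<open>p\<close>.\<close>
    then have sum0: "(\<Sum>j<m. c ^ j * fps_nth (\<eta> j) 0) = (\<Sum>j<m. c ^ j * p j)"
      using \<rho>(2) by (simp add: ev\<theta> fps_sum_nth cst_fps_def cst_complex_def)
    have "fps_nth (\<eta> j) 0 \<in> X j" for j
    proof -
      have "poly (map_poly (ev \<sigma>) (Q j)) (\<eta> j) = 0"
        using transfer[OF sp, of "Q j" "var j"] Q(3)[of j] unfolding \<sigma>\<eta> by simp
      then have "fps_nth (poly (map_poly (ev \<sigma>) (Q j)) (\<eta> j)) 0 = 0" by simp
      moreover have "fps_nth (poly f x) 0 = poly (map_poly (\<lambda>a. fps_nth a 0) f) (fps_nth x 0)"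
        for f and x :: "complex fps"
        by (induction f) (simp_all add: map_poly_pCons_hom)
      ultimately show ?thesis unfolding X_def by (simp add: at0)
    qed
    then have center: "fps_nth (\<eta> j) 0 = p j" for j
    proof (cases "j < m")
      case True
      with c[rule_format, OF _ sum0] \<open>\<And>j. fps_nth (\<eta> j) 0 \<in> X j\<close> show ?thesis by blast
    next
      case False
      then have "ev a (var j) = 0" using a0[of j] by simp
      then have "ev p (var j) = 0" using p unfolding spec_def by blast
      then show ?thesis using False by (simp add: \<eta>_def sh_def)
    qed
    define P where "P = ev (\<lambda>i. [:z0 i, u i:]) N"
    have "poly P 1 = ev (\<lambda>i. poly [:z0 i, u i:] 1) N" unfolding P_def by (rule alg_hom_ev_eq[OF alg_hom_poly])
    also have "\<dots> = ev (restr r c') N" by (simp add: u_def)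
    finally have "P \<noteq> 0" using c' by auto
    have "ev \<tau> N = fps_of_poly P" unfolding P_def alg_hom_ev_eq[OF alg_hom_fps_of_poly] by (simp add: \<tau>_def[abs_def])
    then have \<sigma>N: "ev \<sigma> N = tpow E (fps_of_poly P)"
      using alg_hom_ev_eq[OF alg_hom_tpow[OF E], of \<tau> N] by (simp add: \<sigma>_def[abs_def])
    have "fps_nth (fps_of_poly P) (degree P) \<noteq> 0" using \<open>P \<noteq> 0\<close> by simp
    then have "fps_of_poly P \<noteq> 0" "subdegree (fps_of_poly P) \<le> degree P" by (auto intro: subdegree_leI)
    moreover have "degree P \<le> M" unfolding P_def by (rule M)
    ultimately have N0: "ev \<sigma> N \<noteq> 0" "subdegree (ev \<sigma> N) \<le> E * M"
      using subdegree_tpow_le[OF E, of "fps_of_poly P"] unfolding \<sigma>N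
      by (auto intro: order_trans mult_le_mono2)
    \<comment> \<open>The identity \<open>N = \<beta> * \<gamma>\<close> passes to the arc, and
      orders of power series add, so the order of \<open>\<beta>\<close> is at most that of
      \<open>N\<close>.\<close>
    have "ev a (ev \<zeta> N - \<beta> * \<gamma>) = 0" using N(2) by (simp add: ev.hom_minus ev_ev z)
    then have "ev \<eta> (ev \<zeta> N - \<beta> * \<gamma>) = 0" using sp by (simp add: spec_def)
    then have "ev \<sigma> N = ev \<eta> \<beta> * ev \<eta> \<gamma>" by (simp add: ev.hom_minus ev_ev \<sigma>\<eta> ev_mult)
    with N0 have "ev \<eta> \<beta> \<noteq> 0" "subdegree (ev \<eta> \<beta>) \<le> E * M" by (auto simp: subdegree_mult)
    with sp center show ?thesis by blast
  qed
  then show ?thesis by blast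
qed

subsection \<open>Forms and the blowup\<close>

lemma ev_UNIV:
  fixes x :: "'i::finite \<Rightarrow> 'a::complex_alg"
  shows "ev x f = (\<Sum>m\<in>Poly_Mapping.keys f. cst (Poly_Mapping.lookup f m) *
    (\<Prod>i\<in>UNIV. x i ^ Poly_Mapping.lookup m i))"
  unfolding ev_def by (intro sum.cong refl arg_cong2[of _ _ _ _ "(*)"] monomial_value_superset) auto

lemma cpoly_value_id: "cpoly_value id f x = ev x f"
  by (simp add: cpoly_value_def ev_UNIV cst_complex_def)

lemma cpoly_value_fps_const: "cpoly_value fps_const f x = ev x f"
  by (simp add: cpoly_value_def ev_UNIV cst_fps_def cst_complex_def)

lemma prod_UNIV_sum:
  fixes h :: "'n::finite + 'N::finite \<Rightarrow> 'a::comm_monoid_mult"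
  shows "(\<Prod>s\<in>UNIV. h s) = (\<Prod>l\<in>UNIV. h (Inl l)) * (\<Prod>j\<in>UNIV. h (Inr j))"
  unfolding UNIV_sum by (subst prod.union_disjoint) (auto simp: prod.reindex)

definition fdegree :: "('n + 'N::finite \<Rightarrow>\<^sub>0 nat) \<Rightarrow> nat" where
  "fdegree m = (\<Sum>j\<in>UNIV. Poly_Mapping.lookup m (Inr j))"

lemma ev_form_scale:
  fixes f :: "('n::finite + 'N::finite) cpoly" and x :: "'n \<Rightarrow> 'a::complex_alg"
  assumes "\<And>m. m \<in> Poly_Mapping.keys f \<Longrightarrow> fdegree m = d"
  shows "ev (case_sum x (\<lambda>j. t * w j)) f = t ^ d * ev (case_sum x w) f"
proof -
  have "(\<Prod>s\<in>UNIV. case_sum x (\<lambda>j. t * w j) s ^ Poly_Mapping.lookup m s) =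
      t ^ d * (\<Prod>s\<in>UNIV. case_sum x w s ^ Poly_Mapping.lookup m s)"
    if "m \<in> Poly_Mapping.keys f" for m
    by (simp add: prod_UNIV_sum power_mult_distrib prod.distrib power_sum[symmetric] assms[OF that, unfolded fdegree_def] mult_ac)
  then show ?thesis
    unfolding ev_UNIV sum_distrib_left by (intro sum.cong refl) (simp add: mult_ac)
qed

text \<open>Each monomial is padded with powers of the \<open>i\<close>-th homogeneous coordinate up
  to the sum of all degrees. This common target is at least each single degree, so the
  natural-number subtraction never truncates, and \<open>g = 0\<close> is no exception.\<close>

definition homogenize :: "'N \<Rightarrow> ('n + 'N::finite) cpoly \<Rightarrow> ('n + 'N) cpoly" where
  "homogenize i g = (\<Sum>m\<in>Poly_Mapping.keys g.
     Poly_Mapping.single (m + Poly_Mapping.single (Inr i) (sum fdegree (Poly_Mapping.keys g) - fdegree m))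
       (Poly_Mapping.lookup g m))"

lemma ev_homogenize:
  fixes y :: "'n + 'N::finite \<Rightarrow> 'a::complex_alg"
  assumes "y (Inr i) = 1"
  shows "ev y (homogenize i g) = ev y g"
proof -
  have "(\<Prod>s\<in>Poly_Mapping.keys (Poly_Mapping.single (Inr i) n).
      y s ^ Poly_Mapping.lookup (Poly_Mapping.single (Inr i) n) s) = 1" for n
    using assms by (cases "n = 0") simp_all
  note one = this
  show ?thesis
    unfolding homogenize_def ev_sum ev_single monomial_value_add one by (simp add: ev_def)
qed

lemma fdegree_homogenize:
  assumes "m \<in> Poly_Mapping.keys (homogenize i g)"
  shows "fdegree m = sum fdegree (Poly_Mapping.keys g)"
proof -
  let ?K = "Poly_Mapping.keys g"
  let ?h = "\<lambda>m. m + Poly_Mapping.single (Inr i) (sum fdegree ?K - fdegree m)"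
  have "Poly_Mapping.keys (homogenize i g) \<subseteq>
      (\<Union>m\<in>?K. Poly_Mapping.keys (Poly_Mapping.single (?h m) (Poly_Mapping.lookup g m)))"
    unfolding homogenize_def by (rule Poly_Mapping.keys_sum)
  with assms obtain m' where m': "m' \<in> ?K" "m = ?h m'" by (fastforce split: if_splits)
  have "fdegree (?h m') = fdegree m' + (\<Sum>j\<in>UNIV. if j = i then sum fdegree ?K - fdegree m' else 0)"
    unfolding fdegree_def lookup_add sum.distrib by (simp add: lookup_single when_def eq_commute)
  also have "\<dots> = fdegree m' + (sum fdegree ?K - fdegree m')" by simp
  also have "\<dots> = sum fdegree ?K" using m'(1) by (intro le_add_diff_inverse member_le_sum) auto
  finally show ?thesis by (simp only: m'(2))
qed

section \<open>Points and equations of the blowup\<close>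

lemma ex_representative:
  fixes Q :: "'N::finite proj"
  shows "\<exists>w. w \<noteq> 0 \<and> proj_class w = Q"
proof -
  have "proportional (rep_proj Q) (rep_proj Q)" by (rule Quotient_rep_reflp[OF Quotient_proj])
  moreover have "proj_class (rep_proj Q) = Q" by (rule Quotient_abs_rep[OF Quotient_proj])
  ultimately show ?thesis unfolding proportional_def by blast
qed

definition graph_point :: "('N::finite \<Rightarrow> 'n::finite cpoly) \<Rightarrow> complex ^ 'n \<Rightarrow> complex ^ 'N" where
  "graph_point v x = (\<chi> j. ev (vec_nth x) (v j))"

lemma graph_point_neq_0: "x \<notin> zero_locus v \<Longrightarrow> graph_point v x \<noteq> 0"
  by (auto simp: zero_locus_def graph_point_def Finite_Cartesian_Product.vec_eq_iff cpoly_value_id)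

text \<open>The zero set of a form is closed, so it contains the hull of the graph as soon as it
  contains the graph. By homogeneity it is enough to test the representative
  \<open>graph_point v x\<close>.\<close>

lemma form_vanishes_on_blowup:
  fixes v :: "'N::finite \<Rightarrow> 'n::finite cpoly"
  assumes f: "\<And>m. m \<in> Poly_Mapping.keys f \<Longrightarrow> fdegree m = d"
    and van: "\<And>x. x \<notin> zero_locus v \<Longrightarrow> ev (case_sum (vec_nth x) (vec_nth (graph_point v x))) f = 0"
    and P: "P \<in> blowup v" and w: "w \<noteq> 0" "proj_class w = snd P"
  shows "ev (case_sum (vec_nth (fst P)) (vec_nth w)) f = 0"
proof -
  have "is_form f" using f unfolding is_form_def fdegree_def by blast
  then have "zariski_closed {Q. form_vanishes f Q}"
    unfolding zariski_closed_def by (intro exI[of _ "{f}"]) auto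
  moreover have "{(x, proj_class (\<chi> i. cpoly_value id (v i) (vec_nth x))) | x. x \<notin> zero_locus v}
      \<subseteq> {Q. form_vanishes f Q}"
  proof safe
    fix x assume x: "x \<notin> zero_locus v"
    show "form_vanishes f (x, proj_class (\<chi> i. cpoly_value id (v i) (vec_nth x)))"
      unfolding form_vanishes_def cpoly_value_id graph_point_def[symmetric] fst_conv snd_conv
    proof (intro allI impI)
      fix w assume "w \<noteq> 0 \<and> proj_class w = proj_class (graph_point v x)"
      then obtain c where "w = c *s graph_point v x"
        using proj_class_eq_iff[OF graph_point_neq_0[OF x], of w] by auto
      then have "vec_nth w = (\<lambda>j. c * vec_nth (graph_point v x) j)" by (simp add: fun_eq_iff)
      then have "ev (case_sum (vec_nth x) (vec_nth w)) f =
          c ^ d * ev (case_sum (vec_nth x) (vec_nth (graph_point v x))) f"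
        using ev_form_scale[OF f, where x = "vec_nth x" and t = c and w = "vec_nth (graph_point v x)"]
        by simp
      then show "ev (case_sum (vec_nth x) (vec_nth w)) f = 0" using van[OF x] by simp
    qed
  qed
  ultimately have "blowup v \<subseteq> {Q. form_vanishes f Q}"
    unfolding blowup_def by (intro hull_minimal)
  with P w show ?thesis unfolding form_vanishes_def cpoly_value_id by blast
qed

lemma graph_subset_blowup:
  assumes "x \<notin> zero_locus v"
  shows "(x, proj_class (graph_point v x)) \<in> blowup v"
proof -
  have "(x, proj_class (graph_point v x)) \<in>
      {(x, proj_class (\<chi> i. cpoly_value id (v i) (vec_nth x))) | x. x \<notin> zero_locus v}"
    using assms unfolding graph_point_def cpoly_value_id by blast
  then show ?thesis unfolding blowup_def using hull_subset by (rule subsetD[rotated])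
qed

lemma to_fract_ev: "to_fract (ev x f) = ev (\<lambda>i. to_fract (x i)) f"
  by (rule alg_hom_ev_eq[OF alg_hom_to_fract])

lemma fdegree_var: "m \<in> Poly_Mapping.keys (var (Inr i)) \<Longrightarrow> fdegree m = 1"
  by (simp add: var_def fdegree_def lookup_single when_def)

text \<open>The chart ring is realized inside the fraction field of the polynomial ring, generated
  by the coordinates and the quotients of the \<open>v j\<close> by \<open>v i\<close>. Points of
  the blowup in the chart are specializations of these generators, and specializations in power
  series are arcs on the blowup.\<close>

lemma min_arc_order_le_on_chart:
  fixes v :: "'N::finite \<Rightarrow> 'n::finite cpoly" and i :: 'N
  shows "\<exists>K. \<forall>P w. P \<in> exceptional_locus v \<and> w \<noteq> 0 \<and> proj_class w = snd P \<and> vec_nth w i \<noteq> 0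
    \<longrightarrow> min_arc_order v P \<le> enat K"
proof -
  \<comment> \<open>Numbers the affine and projective coordinates by natural numbers, as the general
    theorem uses tuples indexed by \<open>nat\<close>.\<close>
  obtain enc :: "'n + 'N \<Rightarrow> nat" where enc: "bij_betw enc UNIV {0..<CARD('n + 'N)}"
    using ex_bij_betw_finite_nat[of "UNIV :: ('n + 'N) set"] by auto
  define m where "m = CARD('n + 'N)"
  define dec where "dec = inv_into UNIV enc"
  have dec: "dec (enc s) = s" for s using enc by (simp add: dec_def bij_betw_def)
  have encm: "enc s < m" for s using enc by (auto simp: bij_betw_def m_def)
  define x where "x l = (var (enc (Inl l)) :: nat cpoly)" for l
  define V where "V j = ev x (v j)" for j
  have evX: "ev X (ev (case_sum x V) f) = ev (case_sum (vec_nth t) (vec_nth (graph_point v t))) f"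
    if "\<And>l. X (enc (Inl l)) = vec_nth t l" for X t f
  proof -
    have "ev X (case_sum x V s) = case_sum (vec_nth t) (vec_nth (graph_point v t)) s" for s
      using that by (cases s) (simp_all add: x_def V_def graph_point_def ev_ev)
    then show ?thesis by (simp add: ev_ev)
  qed
  have ex_X: "\<exists>X :: nat \<Rightarrow> complex. \<forall>l. X (enc (Inl l)) = vec_nth t l" for t
    by (rule exI[of _ "\<lambda>k. case_sum (vec_nth t) (\<lambda>_. 0) (dec k)"]) (simp add: dec)
  show ?thesis
  proof (cases "V i = 0")
    \<comment> \<open>If \<open>v i\<close> is the zero polynomial, the \<open>i\<close>-th
      homogeneous coordinate vanishes on the whole blowup and the chart contains no point.\<close>
    case True
    have "vec_nth w i = 0" if P: "P \<in> exceptional_locus v" and w: "w \<noteq> 0" "proj_class w = snd P" for P w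
    proof -
      have "ev (case_sum (vec_nth t) (vec_nth (graph_point v t))) (var (Inr i)) = 0" for t
      proof -
        obtain X :: "nat \<Rightarrow> complex" where "\<And>l. X (enc (Inl l)) = vec_nth t l" using ex_X by blast
        from evX[OF this, of "var (Inr i)"] show ?thesis using True by simp
      qed
      from form_vanishes_on_blowup[OF fdegree_var this _ w] P show ?thesis
        by (simp add: exceptional_locus_def)
    qed
    then show ?thesis by blast
  next
    case False
    define b :: "nat cpoly fract" where "b = to_fract (V i)"
    have b0: "b \<noteq> 0" using False by (simp add: b_def)
    define A where "A = case_sum (\<lambda>l. to_fract (x l)) (\<lambda>j. to_fract (V j) / b)"
    define a where "a = (\<lambda>k. if k < m then A (dec k) else 0)"
    have a: "restr m a = a" by (auto simp: a_def restr_def)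
    have a_enc: "a (enc s) = A s" for s by (simp add: a_def encm dec)
    define emb where "emb = ev (\<lambda>s. var (enc s) :: nat cpoly)"
    have ev_emb: "ev y (emb g) = ev (\<lambda>s. y (enc s)) g" for y :: "nat \<Rightarrow> 'c::complex_alg" and g
      by (simp add: emb_def ev_ev)
    have A_form: "b ^ d * ev A f = to_fract (ev (case_sum x V) f)"
      if "\<And>m. m \<in> Poly_Mapping.keys f \<Longrightarrow> fdegree m = d" for f d
    proof -
      have "(\<lambda>s. to_fract (case_sum x V s)) = case_sum (\<lambda>l. to_fract (x l)) (\<lambda>j. b * (to_fract (V j) / b))"
        using b0 by (auto simp: fun_eq_iff split: sum.split)
      then have "to_fract (ev (case_sum x V) f) =
          ev (case_sum (\<lambda>l. to_fract (x l)) (\<lambda>j. b * (to_fract (V j) / b))) f"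
        by (simp only: to_fract_ev)
      also have "\<dots> = b ^ d * ev A f" unfolding A_def by (rule ev_form_scale[OF that])
      finally show ?thesis by simp
    qed
    have A_i: "A (Inr i) = 1" using b0 by (simp add: A_def b_def)
    have A_v: "ev (\<lambda>l. A (Inl l)) (v j) = to_fract (V j)" for j
      by (simp add: A_def V_def to_fract_ev)
    define \<beta> where "\<beta> = emb (ev (\<lambda>l. var (Inl l)) (v i))"
    have ev_\<beta>: "ev y \<beta> = ev (\<lambda>l. y (enc (Inl l))) (v i)" for y :: "nat \<Rightarrow> 'c::complex_alg"
      by (simp add: \<beta>_def ev_emb ev_ev)
    have "ev a \<beta> \<noteq> 0" using b0 by (simp add: ev_\<beta> a_enc A_v b_def)
    from arcs_through_specializations[OF a this] obtain K where
      K: "\<And>p. spec a p \<Longrightarrow> \<exists>\<eta> :: nat \<Rightarrow> complex fps. spec a \<eta> \<and>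
        (\<forall>i. fps_nth (\<eta> i) 0 = p i) \<and> ev \<eta> \<beta> \<noteq> 0 \<and> subdegree (ev \<eta> \<beta>) \<le> K" by blast
    have "min_arc_order v P \<le> enat K"
      if P: "P \<in> exceptional_locus v" and w: "w \<noteq> 0" "proj_class w = snd P" and wi: "vec_nth w i \<noteq> 0" for P w
    proof -
      define p' where "p' = case_sum (vec_nth (fst P)) (\<lambda>j. vec_nth w j / vec_nth w i)"
      have Pb: "P \<in> blowup v" and P0: "fst P \<in> zero_locus v" using P by (auto simp: exceptional_locus_def)
      \<comment> \<open>A relation between the generators, once homogenized, vanishes on the graph,
        hence on the blowup and at \<open>P\<close>. Rescaling by the \<open>i\<close>-th coordinate
        leads back to the chart.\<close>
      have sp': "ev p' g = 0" if g: "ev A g = 0" for g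
      proof -
        let ?G = "homogenize i g" and ?d = "sum fdegree (Poly_Mapping.keys g)"
        have "ev A ?G = 0" using g by (simp add: ev_homogenize A_i)
        moreover have "b ^ ?d * ev A ?G = to_fract (ev (case_sum x V) ?G)"
          by (rule A_form) (rule fdegree_homogenize)
        ultimately have "to_fract (ev (case_sum x V) ?G) = 0" by simp
        then have G0: "ev (case_sum x V) ?G = 0" by simp
        have "ev (case_sum (vec_nth t) (vec_nth (graph_point v t))) ?G = 0" for t
        proof -
          obtain X :: "nat \<Rightarrow> complex" where "\<And>l. X (enc (Inl l)) = vec_nth t l" using ex_X by blast
          from evX[OF this, of ?G] show ?thesis using G0 by simp
        qed
        from form_vanishes_on_blowup[OF fdegree_homogenize this Pb w]
        have "ev (case_sum (vec_nth (fst P)) (vec_nth w)) ?G = 0" by simp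
        also have "vec_nth w = (\<lambda>j. vec_nth w i * (vec_nth w j / vec_nth w i))" using wi by (simp add: fun_eq_iff)
        also have "ev (case_sum (vec_nth (fst P)) \<dots>) ?G = vec_nth w i ^ ?d * ev p' ?G"
          unfolding p'_def by (rule ev_form_scale[OF fdegree_homogenize])
        finally have "ev p' ?G = 0" using wi by simp
        then show ?thesis using ev_homogenize[of p' i g] wi by (simp add: p'_def)
      qed
      define p where "p = (\<lambda>k. if k < m then p' (dec k) else 0)"
      have "spec a p" unfolding spec_def
      proof (intro allI impI)
        fix f assume "ev a f = 0"
        let ?g = "ev (\<lambda>k. if k < m then var (dec k) else 0) f"
        have "ev y ?g = ev (\<lambda>k. if k < m then y (dec k) else 0) f" for y :: "'n + 'N \<Rightarrow> 'c::complex_alg"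
          unfolding ev_ev by (intro arg_cong2[of _ _ _ _ ev] ext) simp_all
        note g = this
        have "ev A ?g = 0" using \<open>ev a f = 0\<close> by (simp only: g a_def)
        then have "ev p' ?g = 0" by (rule sp')
        then show "ev p f = 0" by (simp only: g p_def)
      qed
      with K obtain \<eta> :: "nat \<Rightarrow> complex fps" where \<eta>: "spec a \<eta>" "\<And>i. fps_nth (\<eta> i) 0 = p i"
        "ev \<eta> \<beta> \<noteq> 0" "subdegree (ev \<eta> \<beta>) \<le> K" by blast
      define H where "H s = \<eta> (enc s)" for s
      have H: "ev H g = 0" if "ev A g = 0" for g
      proof -
        have "ev a (emb g) = 0" using that by (simp add: ev_emb a_enc)
        then have "ev \<eta> (emb g) = 0" using \<eta>(1) by (simp add: spec_def)
        then show ?thesis by (simp add: ev_emb H_def[abs_def])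
      qed
      have H0: "fps_nth (H s) 0 = p' s" for s by (simp add: H_def \<eta>(2) p_def encm dec)
      define \<alpha> :: "('n, 'N) coord_arc" where "\<alpha> = (\<chi> l. H (Inl l), \<chi> j. H (Inr j))"
      have \<alpha>H: "case_sum (vec_nth (fst \<alpha>)) (vec_nth (snd \<alpha>)) = H"
        by (auto simp: \<alpha>_def fun_eq_iff split: sum.split)
      have pb: "pullback v \<alpha> j = ev (\<lambda>l. H (Inl l)) (v j)" for j
        by (simp add: pullback_def cpoly_value_fps_const \<alpha>_def vec_lambda_inverse)
      have pb_i: "pullback v \<alpha> i = ev \<eta> \<beta>" by (simp add: pb ev_\<beta> H_def)
      \<comment> \<open>The relation \<open>v j = (v j / v i) * v i\<close> carries over to the arc.
        As \<open>H (Inr j)\<close> is a power series, no pullback has smaller order than that of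
        \<open>v i\<close>.\<close>
      have pb_j: "pullback v \<alpha> j = H (Inr j) * pullback v \<alpha> i" for j
      proof -
        let ?g = "ev (\<lambda>l. var (Inl l)) (v j) - var (Inr j) * ev (\<lambda>l. var (Inl l)) (v i)"
        have "ev A ?g = 0"
          using b0 by (simp add: ev.hom_minus ev_mult ev_ev A_v) (simp add: A_def b_def)
        then have "ev H ?g = 0" by (rule H)
        then show ?thesis by (simp add: ev.hom_minus ev_mult ev_ev pb)
      qed
      define k where "k = subdegree (pullback v \<alpha> i)"
      have center1: "fps_vec_at_0 (fst \<alpha>) = fst P"
        by (simp add: fps_vec_at_0_def \<alpha>_def Finite_Cartesian_Product.vec_eq_iff H0 p'_def)
      have center2: "fps_vec_at_0 (snd \<alpha>) = (\<chi> j. vec_nth w j / vec_nth w i)"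
        by (simp add: fps_vec_at_0_def \<alpha>_def Finite_Cartesian_Product.vec_eq_iff H0 p'_def)
      have nz: "(\<chi> j. vec_nth w j / vec_nth w i) \<noteq> (0 :: complex ^ 'N)"
        using wi by (auto simp: Finite_Cartesian_Product.vec_eq_iff intro!: exI[of _ i])
      have "w = vec_nth w i *s (\<chi> j. vec_nth w j / vec_nth w i)"
        using wi by (simp add: Finite_Cartesian_Product.vec_eq_iff)
      then have "proj_class (\<chi> j. vec_nth w j / vec_nth w i) = proj_class w"
        unfolding proj_class_eq_iff[OF nz w(1)] by blast
      then have center: "arc_center \<alpha> = P"
        using w(2) by (simp add: arc_center_def center1 center2 prod_eq_iff)
      have arc: "is_arc \<alpha>" using nz by (simp add: is_arc_def center2)
      have not_exc: "\<not> arc_in_exceptional v \<alpha>"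
        using \<eta>(3) pb_i unfolding arc_in_exceptional_def by metis
      have on: "arc_on (blowup v) \<alpha>"
        unfolding arc_on_def cpoly_value_fps_const \<alpha>H
      proof (intro allI impI, elim conjE)
        fix f assume "is_form f" and van: "\<forall>Q\<in>blowup v. form_vanishes f Q"
        then obtain d where d: "\<And>m. m \<in> Poly_Mapping.keys f \<Longrightarrow> fdegree m = d"
          unfolding is_form_def fdegree_def by blast
        \<comment> \<open>\<open>f\<close> is known to vanish only at graph points, which lie off
          the zero locus; on the zero locus \<open>V i\<close> vanishes. The product is zero
          everywhere, and the nonzero \<open>V i\<close> cancels.\<close>
        have "ev X (ev (case_sum x V) f * V i) = 0" for X :: "nat \<Rightarrow> complex"
        proof -
          define t :: "complex ^ 'n" where "t = (\<chi> l. X (enc (Inl l)))"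
          have t: "X (enc (Inl l)) = vec_nth t l" for l by (simp add: t_def)
          have Vt: "ev X (V j) = vec_nth (graph_point v t) j" for j
            by (simp add: V_def x_def ev_ev graph_point_def t)
          show ?thesis
          proof (cases "t \<in> zero_locus v")
            case True
            then have "vec_nth (graph_point v t) i = 0"
              by (simp add: zero_locus_def graph_point_def cpoly_value_id)
            then show ?thesis by (simp add: ev_mult Vt)
          next
            case False
            then have "form_vanishes f (t, proj_class (graph_point v t))"
              using van graph_subset_blowup by blast
            then have "ev (case_sum (vec_nth t) (vec_nth (graph_point v t))) f = 0"
              using graph_point_neq_0[OF False] by (simp add: form_vanishes_def cpoly_value_id)
            then show ?thesis by (simp add: ev_mult evX[OF t])
          qed
        qed
        then have "ev (case_sum x V) f * V i = 0" using ex_ev_neq_0 by blast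
        with False have "ev (case_sum x V) f = 0" by simp
        moreover have "b ^ d * ev A f = to_fract (ev (case_sum x V) f)" by (rule A_form) (rule d)
        ultimately have "ev A f = 0" using b0 by simp
        then show "ev H f = 0" by (rule H)
      qed
      have \<alpha>: "\<alpha> \<in> arcs_at v P" using arc on center not_exc by (simp add: arcs_at_def)
      have pb_nz: "pullback v \<alpha> i \<noteq> 0" using \<eta>(3) pb_i by simp
      have "fps_nth (pullback v \<alpha> i) 0 = 0"
        using P0 by (simp add: pullback_nth_0 center1 zero_locus_def)
      then have "k \<noteq> 0" using nth_subdegree_nonzero[OF pb_nz] unfolding k_def by metis
      have "has_arc_order v \<alpha> k"
        unfolding has_arc_order_def
      proof (intro conjI exI allI)
        \<comment> \<open>The pullbacks divided by \<open>fps_X ^ k\<close>. Component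
          \<open>i\<close> has nonzero constant term because the \<open>i\<close>-th chart
          coordinate starts at 1.\<close>
        let ?u = "\<chi> j. H (Inr j) * fps_shift k (pullback v \<alpha> i)"
        have "fps_nth (H (Inr i)) 0 = 1" using wi by (simp add: H0 p'_def)
        then have "fps_nth (vec_nth ?u i) 0 \<noteq> 0"
          using nth_subdegree_nonzero[OF pb_nz] by (simp add: fps_mult_nth_0 k_def)
        then show "fps_vec_at_0 ?u \<noteq> 0"
          by (auto simp: fps_vec_at_0_def Finite_Cartesian_Product.vec_eq_iff)
        fix j
        have "fps_X ^ k * fps_shift k (pullback v \<alpha> i) = pullback v \<alpha> i"
          using subdegree_decompose[of "pullback v \<alpha> i"] unfolding k_def by (metis mult.commute)
        then have "H (Inr j) * pullback v \<alpha> i = fps_X ^ k * (H (Inr j) * fps_shift k (pullback v \<alpha> i))"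
          by (metis mult.left_commute)
        then show "pullback v \<alpha> j = fps_X ^ k * vec_nth ?u j"
          by (simp only: pb_j[of j] vec_lambda_beta)
      qed (use \<open>k \<noteq> 0\<close> in simp)
      moreover have "\<exists>!k. has_arc_order v \<alpha> k" by (rule ex1_arc_order) (use P center not_exc in auto)
      ultimately have "arc_order v \<alpha> = k" unfolding arc_order_def by (intro the1_equality)
      moreover have "k \<le> K" using \<eta>(4) pb_i by (simp add: k_def)
      ultimately show ?thesis unfolding min_arc_order_def using \<alpha> by (intro INF_lower2[of \<alpha>]) simp_all
    qed
    then show ?thesis by blast
  qed
qed

text \<open>Some homogeneous coordinate of any point is nonzero, so the finitely many charts cover
  the exceptional locus, and the sum of their bounds dominates each of them.\<close>

theorem theorem5:
  fixes v :: "'N::finite \<Rightarrow> 'n::finite cpoly"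
  shows "max_arc_order v < \<infinity>"
proof -
  obtain K where K: "\<And>i P w. P \<in> exceptional_locus v \<Longrightarrow> w \<noteq> 0 \<Longrightarrow> proj_class w = snd P \<Longrightarrow>
      vec_nth w i \<noteq> 0 \<Longrightarrow> min_arc_order v P \<le> enat (K i)"
    using min_arc_order_le_on_chart[of v] by metis
  define K' where "K' = (\<Sum>i\<in>UNIV. K i)"
  have "min_arc_order v P \<le> enat K'" if P: "P \<in> exceptional_locus v" for P
  proof -
    obtain w where w: "w \<noteq> 0" "proj_class w = snd P" using ex_representative by blast
    then obtain i where "vec_nth w i \<noteq> 0" by (auto simp: Finite_Cartesian_Product.vec_eq_iff)
    with K[OF P w] have "min_arc_order v P \<le> enat (K i)" by blast
    also have "K i \<le> K'" unfolding K'_def by (intro member_le_sum) auto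
    finally show ?thesis by simp
  qed
  then have "max_arc_order v \<le> enat K'" unfolding max_arc_order_def by (rule SUP_least)
  then show ?thesis using enat_ord_simps(4) le_less_trans by blast
qed

end
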